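(* Let $\tau\in\{A',A,B,C,D\}$ and let $(G_N)_{N\ge1}$ be a sequence of compact classical groups of type $\tau$ with $G_N\subset\mathrm{GL}_N(\mathbb C)$. For every $t>0$ and every $\gamma\in(0,1)$, as $N\to\infty$: (1) If $\tau\in\{A',A\}$, $$\mathrm{Tr}(e^{\frac t2\Delta_{G_N}})=\int_{\mathcal R^2}\mathbf 1_{\{\deg(X_1),\deg(X_2)\le N^\gamma\}}\,\Phi^\tau_{t,N}(X_1,X_2)\,N^{\chi(X_1)+\chi(X_2)}\,d\rho_t^{\otimes2}([X_1],[X_2])+O_t\big(e^{-\frac t8N^\gamma}\big),$$ where $$\Phi^{A'}_{t,N}(X_1,X_2)=\sum_{n\in\mathbb Z}e^{-\frac t2n^2}\cosh\Big(\frac tNn(\deg(X_1)-\deg(X_2))\Big),\qquad \Phi^{A}_{t,N}(X_1,X_2)=e^{\frac t{2N^2}(\deg(X_1)-\deg(X_2))^2}.$$ (2) If $\tau\in\{B,C,D\}$, $$\mathrm{Tr}(e^{\frac t2\Delta_{G_N}})=\int_{\mathcal R}\mathbf 1_{\{\deg(X)\le N^\gamma\}}\,\Phi^\tau_{t,N}(X)\,N^{\chi(X)}\,d\rho_t([X])+O_t\big(e^{-\frac t{12}N^\gamma}\big),$$ where $\Phi^B_{t,N}(X)=\Phi^D_{t,N}(X)=e^{\frac t{2N}\deg(X)}$ and $\Phi^C_{t,N}(X)=e^{-\frac t{2N}\deg(X)}$.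
   Context: **Groups and central heat trace.** Compact classical groups are indexed by matrix size $N$, $G_N\subset\mathrm{GL}_N(\mathbb C)$: type $A'$: $\mathrm U(N)$; type $A$: $\mathrm{SU}(N)$; type $B$: $\mathrm{SO}(N)$ with $N$ odd; type $D$: $\mathrm{SO}(N)$ with $N$ even; type $C$: $\mathrm{Sp}(N/2)=\{S\in\mathrm{GL}_N(\mathbb C):S^*=S^{-1},S^tJS=J\}$ with $N$ even, $J=\begin{pmatrix}0&I\\-I&0\end{pmatrix}$. $N\to\infty$ through the values admissible for the type. $\Delta_{G_N}$ is the Laplace–Beltrami operator of $G_N$ for an invariant inner product on its Lie algebra. For an irreducible representation $\lambda\in\widehat G_N$ with character $\chi_\lambda$, $\Delta_{G_N}\chi_\lambda=-c_2(\lambda)\chi_\lambda$ with $c_2(\lambda)\ge0$; the inner product is normalized so that the numbers $c_2(\lambda)$ are those listed below. The central heat trace is the trace of $e^{\frac t2\Delta_{G_N}}$ on the Hilbert space of square-integrable central (conjugation-invariant) functions: $$\mathrm{Tr}(e^{\frac t2\Delta_{G_N}})=\sum_{\lambda\in\widehat G_N}e^{-\frac t2c_2(\lambda)}.$$ With highest weights $\lambda=(\lambda_1,\dots,\lambda_r)$, $r=N$ for $A',A$, $r=(N-1)/2$ for $B$, $r=N/2$ for $C,D$ ($\mathbb N$ contains $0$): - $A'$: $\lambda\in\mathbb Z^N$ nonincreasing, $c_2(\lambda)=\frac1N\sum_i\lambda_i(\lambda_i+N+1-2i)$; - $A$: $\lambda\in\mathbb N^N$ nonincreasing with $\lambda_N=0$,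 $c_2(\lambda)=\frac1N\sum_i\lambda_i(\lambda_i+N+1-2i)-\frac1{N^2}(\sum_i\lambda_i)^2$; - $B$: $\lambda\in\mathbb N^r$ nonincreasing, $c_2(\lambda)=\frac1N\sum_i\lambda_i(\lambda_i+N-2i)$; - $C$: $\lambda\in\mathbb N^r$ nonincreasing, $c_2(\lambda)=\frac1N\sum_i\lambda_i(\lambda_i+N+2-2i)$; - $D$: $\lambda\in\mathbb N^{r-1}\times\mathbb Z$ with $\lambda_1\ge\dots\ge\lambda_{r-1}\ge|\lambda_r|$, $c_2(\lambda)=\frac1N\sum_i\lambda_i(\lambda_i+N-2i)$. **Hurwitz spaces.** Put $q_t=e^{-t/2}$. For $n\ge1$, $k\ge0$, let $\mathbb X_1(n,k)$ be the set of ramified coverings $X$ of a complex torus of degree $n$ with $k$ generic ramifications; via monodromy it is the set of tuples $(\sigma_1,\sigma_2,\tau_1,\dots,\tau_k)\in S_n^{2+k}$ with all $\tau_i$ transpositions and $[\sigma_1,\sigma_2]\tau_1\cdots\tau_k=1$. The Hurwitz space $\mathcal H_1(n,k)=\mathbb X_1(n,k)/S_n$ (quotient by simultaneous conjugation) is the set of equivalence classes $[X]$ of such coverings. Its cardinality is the Hurwitz number $H_1(n,k)$, for which the formula $H_1(n,k)=\sum_{\alpha\vdash n}K(\alpha)^k$ is used, where $K(\alpha)=\frac12\sum_i\alpha_i(\alpha_i+1-2i)$ is the total content of the partition $\alpha$; it vanishes for $k$ odd. For $[X]\in\mathcal H_1(n,2k)$ one has $\deg(X)=n$ and Euler characteristic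 $\chi(X)=-2k$. Put $\mathcal R=\bigsqcup_{n\ge1}\bigsqcup_{k\ge0}\mathcal H_1(n,2k)$ and let $\rho_t$ be the measure on the countable set $\mathcal R$ given by $$d\rho_t([X])=\sum_{n\ge1}q_t^n\sum_{k\ge0}\frac{t^{2k}}{(2k)!}\sum_{[Y]\in\mathcal H_1(n,2k)}\delta_{[Y]}([X]),$$ with the resulting identity $\int_{\mathcal R}f(\deg(X),\chi(X))\,d\rho_t([X])=\sum_{n\ge1}q_t^n\sum_{k\ge0}\frac{t^{2k}}{(2k)!}f(n,-2k)H_1(n,2k)$. **Notation.** $f(t,N)=O_t(g(t,N))$ as $N\to\infty$ means: for every $t>0$ there are a constant $C(t)$ and an integer $N_0$ (which may depend on the other fixed parameters such as $\gamma$) such that $|f(t,N)|\le C(t)|g(t,N)|$ for all $N\ge N_0$.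
   Formalization: The empty covering (degree 0) is included in R, so the sum in rho_t starts at n=0, and each class [Y] has its mass multiplied by 1/|Aut Y|: with n>=1 the trivial representation's contribution is missed, and the number of classes is not H_1(n,k) (4 versus 2 for n=2, k=0). *)

theory Defs
  imports
    "HOL-Analysis.Analysis"
    "HOL-Combinatorics.Combinatorics"
    "Jordan_Normal_Form.Schur_Decomposition"
begin

hide_const (open) Finite_Cartesian_Product.mat Finite_Cartesian_Product.row
  Finite_Cartesian_Product.column Determinants.det

section \<open>Compact classical groups\<close>

datatype classical_type = TypeA' | TypeA | TypeB | TypeC | TypeD

fun admissible :: "classical_type \<Rightarrow> nat \<Rightarrow> bool" where
  "admissible TypeA' N \<longleftrightarrow> N \<ge> 1"
| "admissible TypeA N \<longleftrightarrow> N \<ge> 1"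
| "admissible TypeB N \<longleftrightarrow> N \<ge> 1 \<and> odd N"
| "admissible TypeC N \<longleftrightarrow> N \<ge> 1 \<and> even N"
| "admissible TypeD N \<longleftrightarrow> N \<ge> 1 \<and> even N"

definition unitary_group :: "nat \<Rightarrow> complex mat set" where
  "unitary_group N = {S \<in> carrier_mat N N. S * mat_adjoint S = 1\<^sub>m N}"

definition special_unitary_group :: "nat \<Rightarrow> complex mat set" where
  "special_unitary_group N = {S \<in> unitary_group N. det S = 1}"

definition special_orthogonal_group :: "nat \<Rightarrow> complex mat set" where
  "special_orthogonal_group N =
     {S \<in> carrier_mat N N. (\<forall>i<N. \<forall>j<N. S $$ (i, j) \<in> \<real>) \<and> S * transpose_mat S = 1\<^sub>m N \<and> det S = 1}"

definition symplectic_form :: "nat \<Rightarrow> complex mat" where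
  "symplectic_form r = four_block_mat (0\<^sub>m r r) (1\<^sub>m r) (- 1\<^sub>m r) (0\<^sub>m r r)"

definition compact_symplectic_group :: "nat \<Rightarrow> complex mat set" where
  "compact_symplectic_group r =
     {S \<in> unitary_group (2 * r). transpose_mat S * symplectic_form r * S = symplectic_form r}"

fun classical_group :: "classical_type \<Rightarrow> nat \<Rightarrow> complex mat set" where
  "classical_group TypeA' N = unitary_group N"
| "classical_group TypeA N = special_unitary_group N"
| "classical_group TypeB N = special_orthogonal_group N"
| "classical_group TypeC N = compact_symplectic_group (N div 2)"
| "classical_group TypeD N = special_orthogonal_group N"

section \<open>Irreducible representations\<close>

definition mat_trace :: "complex mat \<Rightarrow> complex" where
  "mat_trace M = (\<Sum>i<dim_row M. M $$ (i, i))"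

text \<open>Continuity is entrywise sequential continuity, there being no topology on the type of matrices.\<close>

definition continuous_rep ::
  "nat \<Rightarrow> complex mat set \<Rightarrow> nat \<Rightarrow> (complex mat \<Rightarrow> complex mat) \<Rightarrow> bool" where
  "continuous_rep N G d \<rho> \<longleftrightarrow>
     (\<forall>g\<in>G. \<rho> g \<in> carrier_mat d d) \<and>
     \<rho> (1\<^sub>m N) = 1\<^sub>m d \<and>
     (\<forall>g\<in>G. \<forall>h\<in>G. \<rho> (g * h) = \<rho> g * \<rho> h) \<and>
     (\<forall>s. \<forall>g\<in>G. (\<forall>k. s k \<in> G) \<longrightarrow>
        (\<forall>i<N. \<forall>j<N. (\<lambda>k::nat. s k $$ (i, j)) \<longlonglongrightarrow> g $$ (i, j)) \<longrightarrow>
        (\<forall>i<d. \<forall>j<d. (\<lambda>k. \<rho> (s k) $$ (i, j)) \<longlonglongrightarrow> \<rho> g $$ (i, j)))"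

definition vec_subspace :: "nat \<Rightarrow> complex vec set \<Rightarrow> bool" where
  "vec_subspace d W \<longleftrightarrow> W \<subseteq> carrier_vec d \<and> 0\<^sub>v d \<in> W \<and>
     (\<forall>v\<in>W. \<forall>w\<in>W. v + w \<in> W) \<and> (\<forall>a. \<forall>v\<in>W. a \<cdot>\<^sub>v v \<in> W)"

definition irreducible_reps ::
  "nat \<Rightarrow> complex mat set \<Rightarrow> (nat \<times> (complex mat \<Rightarrow> complex mat)) set" where
  "irreducible_reps N G = {(d, \<rho>). d \<ge> 1 \<and> continuous_rep N G d \<rho> \<and>
     (\<forall>W. vec_subspace d W \<longrightarrow> (\<forall>g\<in>G. \<forall>w\<in>W. \<rho> g *\<^sub>v w \<in> W) \<longrightarrow>
        W = {0\<^sub>v d} \<or> W = carrier_vec d)}"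

definition rep_equivalence ::
  "nat \<Rightarrow> complex mat set \<Rightarrow>
     ((nat \<times> (complex mat \<Rightarrow> complex mat)) \<times> (nat \<times> (complex mat \<Rightarrow> complex mat))) set" where
  "rep_equivalence N G = {((d, \<rho>), (d', \<rho>')).
     (d, \<rho>) \<in> irreducible_reps N G \<and> (d', \<rho>') \<in> irreducible_reps N G \<and> d = d' \<and>
     (\<exists>P \<in> carrier_mat d d. invertible_mat P \<and> (\<forall>g\<in>G. P * \<rho> g = \<rho>' g * P))}"

text \<open>The set \<open>\<widehat>G\<close> of equivalence classes of irreducible representations.\<close>

definition group_dual ::
  "nat \<Rightarrow> complex mat set \<Rightarrow> (nat \<times> (complex mat \<Rightarrow> complex mat)) set set" where
  "group_dual N G = irreducible_reps N G // rep_equivalence N G"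

definition rep_character :: "nat \<times> (complex mat \<Rightarrow> complex mat) \<Rightarrow> complex mat \<Rightarrow> complex" where
  "rep_character R g = mat_trace (snd R g)"

section \<open>Laplacian\<close>

definition mat_exp :: "complex mat \<Rightarrow> complex mat" where
  "mat_exp X = Matrix.mat (dim_row X) (dim_col X) (\<lambda>ij. \<Sum>k. (X ^\<^sub>m k) $$ ij / fact k)"

definition lie_algebra :: "nat \<Rightarrow> complex mat set \<Rightarrow> complex mat set" where
  "lie_algebra N G = {X \<in> carrier_mat N N. \<forall>s::real. mat_exp (complex_of_real s \<cdot>\<^sub>m X) \<in> G}"

text \<open>\<open>g\<^sup>-\<^sup>1\<close> is the adjoint of \<open>g\<close>, because all groups considered are unitary.\<close>

definition invariant_inner_product ::
  "nat \<Rightarrow> complex mat set \<Rightarrow> (complex mat \<Rightarrow> complex mat \<Rightarrow> real) \<Rightarrow> bool" where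
  "invariant_inner_product N G ip \<longleftrightarrow>
     (\<forall>X \<in> lie_algebra N G. \<forall>Y \<in> lie_algebra N G. ip X Y = ip Y X) \<and>
     (\<forall>X \<in> lie_algebra N G. \<forall>Y \<in> lie_algebra N G. \<forall>Z \<in> lie_algebra N G.
        ip (X + Y) Z = ip X Z + ip Y Z) \<and>
     (\<forall>a::real. \<forall>X \<in> lie_algebra N G. \<forall>Y \<in> lie_algebra N G.
        ip (complex_of_real a \<cdot>\<^sub>m X) Y = a * ip X Y) \<and>
     (\<forall>X \<in> lie_algebra N G. X \<noteq> 0\<^sub>m N N \<longrightarrow> ip X X > 0) \<and>
     (\<forall>g\<in>G. \<forall>X \<in> lie_algebra N G. \<forall>Y \<in> lie_algebra N G.
        ip (g * X * mat_adjoint g) (g * Y * mat_adjoint g) = ip X Y)"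

definition orthonormal_basis ::
  "nat \<Rightarrow> complex mat set \<Rightarrow> (complex mat \<Rightarrow> complex mat \<Rightarrow> real) \<Rightarrow> complex mat set \<Rightarrow> bool" where
  "orthonormal_basis N G ip B \<longleftrightarrow> finite B \<and> B \<subseteq> lie_algebra N G \<and>
     (\<forall>X\<in>B. \<forall>Y\<in>B. ip X Y = (if X = Y then 1 else 0)) \<and>
     (\<forall>X \<in> lie_algebra N G. (\<forall>Y\<in>B. ip X Y = 0) \<longrightarrow> X = 0\<^sub>m N N)"

text \<open>
  The Laplace--Beltrami operator of the bi-invariant metric given by \<open>ip\<close>: the sum of the squares
  of the left-invariant vector fields of an orthonormal basis of the Lie algebra.  On twice
  differentiable functions it does not depend on the basis.
\<close>

definition laplacian ::
  "nat \<Rightarrow> complex mat set \<Rightarrow> (complex mat \<Rightarrow> complex mat \<Rightarrow> real) \<Rightarrow>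
     (complex mat \<Rightarrow> complex) \<Rightarrow> complex mat \<Rightarrow> complex" where
  "laplacian N G ip f g =
     (\<Sum>X \<in> (SOME B. orthonormal_basis N G ip B).
        vector_derivative
          (\<lambda>u::real. vector_derivative
             (\<lambda>s::real. f (g * mat_exp (complex_of_real s \<cdot>\<^sub>m X))) (at u)) (at 0))"

definition casimir_eigenvalue ::
  "nat \<Rightarrow> complex mat set \<Rightarrow> (complex mat \<Rightarrow> complex mat \<Rightarrow> real) \<Rightarrow>
     (nat \<times> (complex mat \<Rightarrow> complex mat)) set \<Rightarrow> real \<Rightarrow> bool" where
  "casimir_eigenvalue N G ip V c \<longleftrightarrow>
     (\<forall>R\<in>V. \<forall>g\<in>G. laplacian N G ip (rep_character R) g = - complex_of_real c * rep_character R g)"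

definition c2 ::
  "nat \<Rightarrow> complex mat set \<Rightarrow> (complex mat \<Rightarrow> complex mat \<Rightarrow> real) \<Rightarrow>
     (nat \<times> (complex mat \<Rightarrow> complex mat)) set \<Rightarrow> real" where
  "c2 N G ip V = (THE c. casimir_eigenvalue N G ip V c)"

text \<open>
  The trace of \<open>exp (t \<Delta> / 2)\<close> on square-integrable central functions, of which the irreducible
  characters form an orthonormal basis of eigenvectors.
\<close>

definition central_heat_trace ::
  "nat \<Rightarrow> complex mat set \<Rightarrow> (complex mat \<Rightarrow> complex mat \<Rightarrow> real) \<Rightarrow> real \<Rightarrow> real" where
  "central_heat_trace N G ip t = (\<Sum>\<^sub>\<infinity>V \<in> group_dual N G. exp (- (t / 2) * c2 N G ip V))"

section \<open>Highest weights and the normalization of the inner product\<close>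

definition nonincreasing :: "int list \<Rightarrow> bool" where
  "nonincreasing l \<longleftrightarrow> sorted_wrt (\<ge>) l"

text \<open>A weight \<open>(\<lambda>\<^sub>1, \<dots>, \<lambda>\<^sub>r)\<close> is a list, so that \<open>\<lambda>\<^sub>i\<close> is \<open>l ! (i - 1)\<close>.\<close>

fun highest_weights :: "classical_type \<Rightarrow> nat \<Rightarrow> int list set" where
  "highest_weights TypeA' N = {l. length l = N \<and> nonincreasing l}"
| "highest_weights TypeA N =
     {l. length l = N \<and> nonincreasing l \<and> (\<forall>x \<in> set l. x \<ge> 0) \<and> l ! (N - 1) = 0}"
| "highest_weights TypeB N =
     {l. length l = (N - 1) div 2 \<and> nonincreasing l \<and> (\<forall>x \<in> set l. x \<ge> 0)}"
| "highest_weights TypeC N =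
     {l. length l = N div 2 \<and> nonincreasing l \<and> (\<forall>x \<in> set l. x \<ge> 0)}"
| "highest_weights TypeD N =
     {l. length l = N div 2 \<and> nonincreasing (butlast l) \<and> (\<forall>x \<in> set (butlast l). x \<ge> \<bar>last l\<bar>)}"

definition weight_sum :: "nat \<Rightarrow> int \<Rightarrow> int list \<Rightarrow> real" where
  "weight_sum N a l =
     (\<Sum>i = 1..length l. real_of_int (l ! (i - 1) * (l ! (i - 1) + int N + a - 2 * int i))) / real N"

fun casimir_number :: "classical_type \<Rightarrow> nat \<Rightarrow> int list \<Rightarrow> real" where
  "casimir_number TypeA' N l = weight_sum N 1 l"
| "casimir_number TypeA N l = weight_sum N 1 l - (real_of_int (sum_list l))\<^sup>2 / (real N)\<^sup>2"
| "casimir_number TypeB N l = weight_sum N 0 l"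
| "casimir_number TypeC N l = weight_sum N 2 l"
| "casimir_number TypeD N l = weight_sum N 0 l"

text \<open>
  \<open>ip\<close> is an invariant inner product on the Lie algebra, normalized so that the eigenvalues of the
  Laplacian are the \<open>casimir_number\<close>s, the irreducible representations being labelled by the
  highest weights.  The theorem only uses that such a labelling \<open>V\<close> exists, so it is
  not required here that \<open>l\<close> be the highest weight of \<open>V l\<close> for a chosen maximal torus.
\<close>

definition normalized_inner_product ::
  "classical_type \<Rightarrow> nat \<Rightarrow> (complex mat \<Rightarrow> complex mat \<Rightarrow> real) \<Rightarrow> bool" where
  "normalized_inner_product \<tau> N ip \<longleftrightarrow>
     invariant_inner_product N (classical_group \<tau> N) ip \<and>
     (\<exists>V. bij_betw V (highest_weights \<tau> N) (group_dual N (classical_group \<tau> N)) \<and>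
        (\<forall>l \<in> highest_weights \<tau> N.
           casimir_eigenvalue N (classical_group \<tau> N) ip (V l) (casimir_number \<tau> N l)))"

section \<open>Ramified coverings of the torus\<close>

text \<open>Monodromy data of a covering of degree \<open>n\<close>, the symmetric group acting on \<open>{..<n}\<close>.\<close>

type_synonym monodromy = "(nat \<Rightarrow> nat) \<times> (nat \<Rightarrow> nat) \<times> (nat \<Rightarrow> nat) list"

definition coverings :: "nat \<Rightarrow> nat \<Rightarrow> monodromy set" where
  "coverings n k = {(\<sigma>\<^sub>1, \<sigma>\<^sub>2, \<tau>s).
     \<sigma>\<^sub>1 permutes {..<n} \<and> \<sigma>\<^sub>2 permutes {..<n} \<and> length \<tau>s = k \<and>
     (\<forall>\<tau> \<in> set \<tau>s. \<exists>a<n. \<exists>b<n. a \<noteq> b \<and> \<tau> = Transposition.transpose a b) \<and>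
     \<sigma>\<^sub>1 \<circ> \<sigma>\<^sub>2 \<circ> Hilbert_Choice.inv \<sigma>\<^sub>1 \<circ> Hilbert_Choice.inv \<sigma>\<^sub>2 \<circ> foldr (\<circ>) \<tau>s id = id}"

definition conjugate_monodromy :: "(nat \<Rightarrow> nat) \<Rightarrow> monodromy \<Rightarrow> monodromy" where
  "conjugate_monodromy \<pi> X = (case X of (\<sigma>\<^sub>1, \<sigma>\<^sub>2, \<tau>s) \<Rightarrow>
     (\<pi> \<circ> \<sigma>\<^sub>1 \<circ> Hilbert_Choice.inv \<pi>, \<pi> \<circ> \<sigma>\<^sub>2 \<circ> Hilbert_Choice.inv \<pi>, map (\<lambda>\<tau>. \<pi> \<circ> \<tau> \<circ> Hilbert_Choice.inv \<pi>) \<tau>s))"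

definition covering_equivalence :: "nat \<Rightarrow> nat \<Rightarrow> (monodromy \<times> monodromy) set" where
  "covering_equivalence n k = {(X, Y). X \<in> coverings n k \<and> Y \<in> coverings n k \<and>
     (\<exists>\<pi>. \<pi> permutes {..<n} \<and> Y = conjugate_monodromy \<pi> X)}"

definition hurwitz_space :: "nat \<Rightarrow> nat \<Rightarrow> monodromy set set" where
  "hurwitz_space n k = coverings n k // covering_equivalence n k"

text \<open>
  An element of \<open>\<R>\<close> is a triple \<open>(n, m, c)\<close> of a degree, an even number \<open>m\<close> of ramification points
  and a class \<open>c\<close> of coverings.  The empty covering (degree \<open>0\<close>, \<open>m = 0\<close>) is included; it accounts
  for the contribution of empty partitions to the heat trace.
\<close>

definition covering_classes :: "(nat \<times> nat \<times> monodromy set) set" where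
  "covering_classes = {(n, m, c). even m \<and> c \<in> hurwitz_space n m}"

definition cover_deg :: "nat \<times> nat \<times> monodromy set \<Rightarrow> nat" where
  "cover_deg X = fst X"

text \<open>Riemann--Hurwitz over a torus: the Euler characteristic is minus the number of simple ramifications.\<close>

definition cover_euler :: "nat \<times> nat \<times> monodromy set \<Rightarrow> int" where
  "cover_euler X = - int (fst (snd X))"

text \<open>
  Coverings are counted, as always for Hurwitz numbers, with weight \<open>1 / card Aut\<close>, which for a
  conjugation orbit \<open>c\<close> is \<open>card c / n!\<close>.  The total weight of \<open>hurwitz_space n k\<close> is then the Hurwitz
  number \<open>card (coverings n k) / n!\<close>, that is, the sum over the partitions of \<open>n\<close> of the \<open>k\<close>-th
  powers of their total contents.
\<close>

definition cover_weight :: "nat \<times> nat \<times> monodromy set \<Rightarrow> real" where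
  "cover_weight X = (case X of (n, m, c) \<Rightarrow> real (card c) / fact n)"

definition hurwitz_measure :: "real \<Rightarrow> (nat \<times> nat \<times> monodromy set) measure" where
  "hurwitz_measure t = point_measure covering_classes (\<lambda>(n, m, c).
     ennreal (exp (- t / 2) ^ n * (t ^ m / fact m) * cover_weight (n, m, c)))"

section \<open>Integrands\<close>

text \<open>\<open>\<Phi>_double\<close> is meant for types \<open>A'\<close> and \<open>A\<close>, \<open>\<Phi>_single\<close> for types \<open>B\<close>, \<open>C\<close> and \<open>D\<close>.\<close>

definition \<Phi>_double :: "classical_type \<Rightarrow> real \<Rightarrow> nat \<Rightarrow>
    nat \<times> nat \<times> monodromy set \<Rightarrow> nat \<times> nat \<times> monodromy set \<Rightarrow> real" where
  "\<Phi>_double \<tau> t N X\<^sub>1 X\<^sub>2 =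
     (if \<tau> = TypeA'
      then (\<Sum>\<^sub>\<infinity>n\<in>(UNIV :: int set). exp (- (t / 2) * (real_of_int n)\<^sup>2) *
        cosh (t / real N * real_of_int n * (real (cover_deg X\<^sub>1) - real (cover_deg X\<^sub>2))))
      else exp (t / (2 * (real N)\<^sup>2) * (real (cover_deg X\<^sub>1) - real (cover_deg X\<^sub>2))\<^sup>2))"

definition \<Phi>_single :: "classical_type \<Rightarrow> real \<Rightarrow> nat \<Rightarrow> nat \<times> nat \<times> monodromy set \<Rightarrow> real" where
  "\<Phi>_single \<tau> t N X =
     (if \<tau> = TypeC then exp (- (t / (2 * real N)) * real (cover_deg X))
      else exp (t / (2 * real N) * real (cover_deg X)))"

end

theory Submission
  imports Defs
begin

text \<open>
  The irreducible characters turn the heat trace into a sum over highest weights. In types \<open>B\<close>, \<open>C\<close>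
  and \<open>D\<close> these are partitions (up to a sign of the last part in type \<open>D\<close>), and in types \<open>A'\<close> and \<open>A\<close> a
  weight is cut at its middle entry \<open>n\<close> into two partitions: \<open>(\<alpha> + n, n, n - rev \<beta>)\<close>. The Casimir
  number of a partition \<open>\<alpha>\<close> is its size plus \<open>2 K(\<alpha>) / N\<close>, up to explicit corrections which give \<open>\<Phi>\<close>.

  On the covering side, expanding \<open>exp (- t K(\<alpha>) / N)\<close> in powers of \<open>t\<close> reduces the integral to the
  formula \<open>card (coverings n k) = n! \<Sum>\<^sub>\<alpha> K(\<alpha>)\<^sup>k\<close>. Here the left side is \<open>n!\<close> times the trace of the
  \<open>k\<close>-th power of multiplication by the sum of all transpositions on class functions. That operator
  is triangular in the basis of the characters of \<open>S\<^sub>n\<close> on words of given content, with the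
  \<open>K(\<alpha>)\<close> on the diagonal: this is the Casimir operator of \<open>gl\<^sub>L\<close> computed on the weight spaces of the
  \<open>n\<close>-th tensor power.

  The error is thus the part of the heat trace with a partition of size more than \<open>N\<^sup>\<gamma>\<close>.
  Chebyshev's sum inequality, with Cauchy-Schwarz for types \<open>A'\<close> and \<open>A\<close>, bounds Casimir numbers
  below by a multiple of the size, and \<open>\<Sum>\<^sub>\<alpha> exp (- s \<bar>\<alpha>\<bar>)\<close> converges uniformly in the number of parts.
\<close>

section \<open>Words fixed by a permutation\<close>

text \<open>The main term is exact, not asymptotic: a partition of size at most X =
  \<open>N powr \<gamma>\<close> has at most X nonzero parts, and since \<gamma> < 1 this is
  eventually below the rank, so the bound on the number of parts that the group imposes is void on
  the truncated range. Only the tail needs estimates. There the Casimir number has to dominate the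
  size with a constant uniform in N: 1/2 for types A' and A, where a negative square of the
  difference of the two sizes has to be absorbed, and 1/3 for the others. Times t/2 this gives decay
  t/4 and t/6; one half of it pays for the convergence of the sum over partitions, the other half is
  the rate t/8 or t/12 of the error.

  The trace formula needs no irreducible characters of the symmetric group: a trace can be read off
  in any basis in which the operator is triangular, and permutation characters suffice. Two orders
  on partitions are involved: the sum of squares, in which the sum of transpositions is triangular,
  and dominance, in which the values of the permutation characters on cycle types are triangular, so
  that they form a basis.\<close>

definition word_content :: "nat \<Rightarrow> (nat \<Rightarrow> nat) \<Rightarrow> nat \<Rightarrow> nat" where
  "word_content n w c = card {x. x < n \<and> w x = c}"

text \<open>\<open>extensional\<close> fixes the junk values off \<open>{..<n}\<close>, so a word is
  its n letters and equality of functions is equality of words. The alphabet is not a parameter: it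
  is bounded by the support of \<nu>.\<close>

definition words :: "nat \<Rightarrow> (nat \<Rightarrow> nat) \<Rightarrow> (nat \<Rightarrow> nat) set" where
  "words n \<nu> = {w \<in> extensional {..<n}. word_content n w = \<nu>}"

text \<open>
  As a function of \<open>\<sigma>\<close> this is the character of the permutation module of words of content \<open>\<nu>\<close>, that is,
  the trace of \<open>\<sigma>\<close> on the \<open>\<nu>\<close>-weight space of the \<open>n\<close>-th tensor power of \<open>\<complex>\<^sup>L\<close>.
\<close>

definition fixed_words :: "nat \<Rightarrow> (nat \<Rightarrow> nat) \<Rightarrow> (nat \<Rightarrow> nat) \<Rightarrow> nat" where
  "fixed_words n \<nu> \<sigma> = card {w \<in> words n \<nu>. w \<circ> \<sigma> = w}"

text \<open>
  With \<open>E\<^sub>i\<^sub>j\<close> the elementary matrices of \<open>gl\<^sub>L\<close>, \<open>move_triples\<close> counts the trace of \<open>E\<^sub>j\<^sub>i E\<^sub>i\<^sub>j \<sigma>\<close> on the \<open>\<nu>\<close>-weight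
  space; \<open>swap_triples\<close> omits the terms where the same letter is moved back.
\<close>

definition swap_triples ::
  "nat \<Rightarrow> (nat \<Rightarrow> nat) \<Rightarrow> (nat \<Rightarrow> nat) \<Rightarrow> nat \<Rightarrow> nat \<Rightarrow> ((nat \<Rightarrow> nat) \<times> nat \<times> nat) set" where
  "swap_triples n \<nu> \<sigma> i j = {(w, a, b). w \<in> words n \<nu> \<and> a < n \<and> b < n \<and> w a = i \<and> w b = j \<and>
     w \<circ> \<sigma> = w(a := j, b := i)}"

definition move_triples ::
  "nat \<Rightarrow> (nat \<Rightarrow> nat) \<Rightarrow> (nat \<Rightarrow> nat) \<Rightarrow> nat \<Rightarrow> nat \<Rightarrow> ((nat \<Rightarrow> nat) \<times> nat \<times> nat) set" where
  "move_triples n \<nu> \<sigma> i j = {(w, b, a). w \<in> words n \<nu> \<and> b < n \<and> a < n \<and> w b = j \<and>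
     (w(b := i)) a = i \<and> w \<circ> \<sigma> = w(b := i, a := j)}"

lemma word_content_upd:
  assumes "b < n" "w b = j" "i \<noteq> j"
  shows "word_content n (w(b := i)) = (word_content n w)(i := word_content n w i + 1, j := word_content n w j - 1)"
proof
  fix c
  consider "c = i" | "c = j" | "c \<noteq> i" "c \<noteq> j" by blast
  then show "word_content n (w(b := i)) c = ((word_content n w)(i := word_content n w i + 1, j := word_content n w j - 1)) c"
  proof cases
    case 1
    have "{x. x < n \<and> (w(b := i)) x = i} = insert b {x. x < n \<and> w x = i}"
      using assms by auto
    moreover have "b \<notin> {x. x < n \<and> w x = i}" using assms by auto
    ultimately show ?thesis using 1 assms by (simp add: word_content_def)
  next
    case 2
    have "{x. x < n \<and> (w(b := i)) x = j} = {x. x < n \<and> w x = j} - {b}"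
      using assms by auto
    moreover have "b \<in> {x. x < n \<and> w x = j}" using assms by auto
    ultimately show ?thesis using 2 assms by (simp add: word_content_def)
  next
    case 3
    then have "{x. x < n \<and> (w(b := i)) x = c} = {x. x < n \<and> w x = c}"
      using assms by auto
    then show ?thesis using 3 by (simp add: word_content_def)
  qed
qed

lemma word_content_pos: "b < n \<Longrightarrow> w b = j \<Longrightarrow> word_content n w j \<ge> 1"
proof -
  assume "b < n" "w b = j"
  then have "{x. x < n \<and> w x = j} \<noteq> {}" by auto
  then show ?thesis by (simp add: word_content_def Suc_le_eq card_gt_0_iff)
qed

lemma word_lt:
  assumes "w \<in> words n \<nu>" "\<forall>c\<ge>L. \<nu> c = 0" "x < n"
  shows "w x < L"
  using assms word_content_pos[of x n w "w x"] unfolding words_def by (force simp: not_less[symmetric])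

lemma finite_words [intro]:
  assumes "\<forall>c\<ge>L. \<nu> c = 0"
  shows "finite (words n \<nu>)"
proof (rule finite_subset)
  show "words n \<nu> \<subseteq> {..<n} \<rightarrow>\<^sub>E {..<L}"
  proof
    fix w assume w: "w \<in> words n \<nu>"
    then have "w \<in> extensional {..<n}" by (simp add: words_def)
    then show "w \<in> {..<n} \<rightarrow>\<^sub>E {..<L}"
      using word_lt[OF w assms] by (auto simp: PiE_def)
  qed
qed (auto intro: finite_PiE)

text \<open>E_ji E_ij turns a letter j at position b into i and then a letter i at position a into
  j. For a = b nothing has changed, so each fixed word is counted once for each of its \<nu> j
  letters j; for distinct positions what remains is an exchange of two letters.\<close>

lemma card_move_triples:
  assumes ij: "i \<noteq> j" and L: "\<forall>c\<ge>L. \<nu> c = 0"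
  shows "card (move_triples n \<nu> \<sigma> i j) = card (swap_triples n \<nu> \<sigma> i j) + \<nu> j * fixed_words n \<nu> \<sigma>"
proof -
  let ?A = "{(w, b, a). (w, b, a) \<in> move_triples n \<nu> \<sigma> i j \<and> a = b}"
  let ?B = "{(w, b, a). (w, b, a) \<in> move_triples n \<nu> \<sigma> i j \<and> a \<noteq> b}"
  have fin: "finite (words n \<nu> \<times> {..<n} \<times> {..<n})"
    using finite_words[of L \<nu>] L by auto
  have fm: "finite (move_triples n \<nu> \<sigma> i j)"
    by (rule finite_subset[OF _ fin]) (auto simp: move_triples_def)
  have "move_triples n \<nu> \<sigma> i j = ?A \<union> ?B" by auto
  moreover have "card (?A \<union> ?B) = card ?A + card ?B"
    by (rule card_Un_disjoint) (auto intro: finite_subset[OF _ fm])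
  moreover have "card ?A = \<nu> j * fixed_words n \<nu> \<sigma>"
  proof -
    have "card ?A = card (Sigma {w \<in> words n \<nu>. w \<circ> \<sigma> = w} (\<lambda>w. {x. x < n \<and> w x = j}))"
      by (rule bij_betw_same_card[of "\<lambda>(w, b, a). (w, b)"])
        (auto simp: bij_betw_def inj_on_def move_triples_def image_iff fun_upd_idem)
    also have "\<dots> = (\<Sum>w\<in>{w \<in> words n \<nu>. w \<circ> \<sigma> = w}. card {x. x < n \<and> w x = j})"
      using finite_words[of L \<nu>] L by (intro card_SigmaI) auto
    also have "\<dots> = (\<Sum>w\<in>{w \<in> words n \<nu>. w \<circ> \<sigma> = w}. \<nu> j)"
      by (rule sum.cong) (auto simp: words_def word_content_def)
    finally show ?thesis by (simp add: fixed_words_def mult.commute)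
  qed
  moreover have "card ?B = card (swap_triples n \<nu> \<sigma> i j)"
    by (rule bij_betw_same_card[of "\<lambda>(w, b, a). (w, a, b)"])
      (use ij in \<open>auto simp: bij_betw_def inj_on_def move_triples_def swap_triples_def image_iff fun_upd_twist\<close>)
  ultimately show ?thesis by simp
qed

lemma card_swap_triples_commute:
  "card (swap_triples n \<nu> \<sigma> i j) = card (swap_triples n \<nu> \<sigma> j i)"
  by (rule bij_betw_same_card[of "\<lambda>(w, a, b). (w, b, a)"])
    (auto simp: bij_betw_def inj_on_def swap_triples_def image_iff fun_upd_twist;
      metis fun_upd_twist)

lemma fun_upd_comp_perm:
  assumes "\<sigma> permutes S"
  shows "(w(b := i)) \<circ> \<sigma> = (w \<circ> \<sigma>)(Hilbert_Choice.inv \<sigma> b := i)"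
  using assms by (auto simp: fun_eq_iff permutes_inverses)

text \<open>Cyclicity of the trace: \<open>E\<^sub>i\<^sub>j\<close> maps the \<open>\<nu>\<close>-weight space to the \<open>(\<nu> + e\<^sub>i - e\<^sub>j)\<close>-weight space.\<close>

lemma card_move_triples_shift:
  assumes ij: "i \<noteq> j" and \<sigma>: "\<sigma> permutes {..<n}" and pos: "\<nu> j \<ge> 1"
  shows "card (move_triples n \<nu> \<sigma> i j) =
    card (move_triples n (\<nu>(i := \<nu> i + 1, j := \<nu> j - 1)) \<sigma> j i)"
proof -
  let ?\<mu> = "\<nu>(i := \<nu> i + 1, j := \<nu> j - 1)"
  \<comment> \<open>The intermediate word \<open>w(b := i)\<close> becomes the starting word and the
    return move at \<open>a\<close> becomes the first one. The move at \<open>b\<close> then comes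
    after a passage through \<sigma>, which shifts its position to
    \<open>inv \<sigma> b\<close>.\<close>
  let ?f = "\<lambda>(w, b, a). (w(b := i), a, Hilbert_Choice.inv \<sigma> b)"
  let ?g = "\<lambda>(u, a, c). (u(\<sigma> c := j), \<sigma> c, a)"
  have s1: "\<sigma> (Hilbert_Choice.inv \<sigma> x) = x" "Hilbert_Choice.inv \<sigma> (\<sigma> x) = x" for x
    using \<sigma> by (auto simp: permutes_inverses)
  have s2: "\<sigma> x < n \<longleftrightarrow> x < n" "Hilbert_Choice.inv \<sigma> x < n \<longleftrightarrow> x < n" for x
    using permutes_in_image[OF \<sigma>, of x] permutes_in_image[OF permutes_inv[OF \<sigma>], of x] by auto
  have f: "?f p \<in> move_triples n ?\<mu> \<sigma> j i \<and> ?g (?f p) = p" if "p \<in> move_triples n \<nu> \<sigma> i j" for p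
  proof -
    obtain w b a where p: "p = (w, b, a)" by (cases p)
    have *: "w \<in> words n \<nu>" "b < n" "a < n" "w b = j" "(w(b := i)) a = i" "w \<circ> \<sigma> = w(b := i, a := j)"
      using that p by (auto simp: move_triples_def)
    have "w(b := i) \<in> words n ?\<mu>"
      using * ij by (auto simp: words_def word_content_upd extensional_def)
    moreover have "(w(b := i)) \<circ> \<sigma> = (w(b := i))(a := j, Hilbert_Choice.inv \<sigma> b := i)"
      unfolding fun_upd_comp_perm[OF \<sigma>] *(6) ..
    moreover have "(w(b := i, a := j)) (Hilbert_Choice.inv \<sigma> b) = j"
      using *(4) *(6)[symmetric] s1 by simp
    ultimately show ?thesis
      using * p s1 s2 by (auto simp: move_triples_def)
  qed
  have g: "?g p \<in> move_triples n \<nu> \<sigma> i j \<and> ?f (?g p) = p" if "p \<in> move_triples n ?\<mu> \<sigma> j i" for p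
  proof -
    obtain u a c where p: "p = (u, a, c)" by (cases p)
    have *: "u \<in> words n ?\<mu>" "c < n" "a < n" "u a = i" "(u(a := j)) c = j" "u \<circ> \<sigma> = u(a := j, c := i)"
      using that p by (auto simp: move_triples_def)
    have uc: "u (\<sigma> c) = i" using fun_cong[OF *(6), of c] by simp
    have cu: "word_content n u = ?\<mu>" using * by (simp add: words_def)
    have "word_content n (u(\<sigma> c := j)) = \<nu>"
      using word_content_upd[of "\<sigma> c" n u i j] uc *(2) ij s2 pos by (auto simp: fun_eq_iff cu)
    then have "u(\<sigma> c := j) \<in> words n \<nu>"
      using * s2 by (auto simp: words_def extensional_def)
    moreover have "u(\<sigma> c := j) \<circ> \<sigma> = u(a := j)"
      unfolding fun_upd_comp_perm[OF \<sigma>] *(6) s1 using *(5) by (auto simp: fun_eq_iff)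
    moreover have "u(\<sigma> c := j, \<sigma> c := i) = u" using uc by auto
    ultimately show ?thesis using * p s1 s2 uc by (auto simp: move_triples_def)
  qed
  show ?thesis
    by (rule bij_betw_same_card[of ?f], rule bij_betw_byWitness[where f' = ?g])
      (use f g in blast)+
qed

lemma swap_triples_diag:
  assumes L: "\<forall>c\<ge>L. \<nu> c = 0"
  shows "card (swap_triples n \<nu> \<sigma> i i) = (\<nu> i)\<^sup>2 * fixed_words n \<nu> \<sigma>"
proof -
  have eq: "swap_triples n \<nu> \<sigma> i i =
      Sigma {w \<in> words n \<nu>. w \<circ> \<sigma> = w} (\<lambda>w. {x. x < n \<and> w x = i} \<times> {x. x < n \<and> w x = i})"
    by (auto simp: swap_triples_def fun_upd_idem)
  have "card (swap_triples n \<nu> \<sigma> i i) =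
      (\<Sum>w\<in>{w \<in> words n \<nu>. w \<circ> \<sigma> = w}. card ({x. x < n \<and> w x = i} \<times> {x. x < n \<and> w x = i}))"
    unfolding eq using finite_words[of L \<nu>] L by (intro card_SigmaI) auto
  also have "\<dots> = (\<Sum>w\<in>{w \<in> words n \<nu>. w \<circ> \<sigma> = w}. \<nu> i * \<nu> i)"
    by (rule sum.cong) (auto simp: words_def word_content_def card_cartesian_product)
  finally show ?thesis by (simp add: fixed_words_def power2_eq_square mult.commute)
qed

text \<open>Exchanging positions a and b affects a word only through the letters i =
  \<open>w a\<close> and j = \<open>w b\<close>. Sorting by these letters turns a sum over pairs of
  positions into a sum over pairs of letters, which is the passage from S_n to gl_L. Pairs with a =
  b are kept, as identities, so that both sides are full squares.\<close>

lemma sum_pairs_fixed_words: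
  assumes L: "\<forall>c\<ge>L. \<nu> c = 0"
  shows "(\<Sum>a<n. \<Sum>b<n. fixed_words n \<nu> (\<sigma> \<circ> Transposition.transpose a b)) =
    (\<Sum>i<L. \<Sum>j<L. card (swap_triples n \<nu> \<sigma> i j))"
proof -
  let ?P = "\<lambda>w a b. w \<circ> (\<sigma> \<circ> Transposition.transpose a b) = (w::nat\<Rightarrow>nat)"
  let ?Z = "{(w, a, b). w \<in> words n \<nu> \<and> a < n \<and> b < n \<and> ?P w a b}"
  have fin: "finite (words n \<nu> \<times> {..<n} \<times> {..<n})"
    using finite_words[of L \<nu>] L by auto
  have fZ: "finite ?Z" by (rule finite_subset[OF _ fin]) auto
  have P: "?P w a b \<longleftrightarrow> w \<circ> \<sigma> = w(a := w b, b := w a)" for w a b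
  proof -
    have "?P w a b \<longleftrightarrow> w \<circ> \<sigma> = w \<circ> Transposition.transpose a b"
      by (auto simp: fun_eq_iff) (metis transpose_involutory)+
    also have "w \<circ> Transposition.transpose a b = w(a := w b, b := w a)"
      by (auto simp: fun_eq_iff Transposition.transpose_def)
    finally show ?thesis .
  qed
  have "(\<Sum>a<n. \<Sum>b<n. fixed_words n \<nu> (\<sigma> \<circ> Transposition.transpose a b)) =
      (\<Sum>p\<in>{..<n} \<times> {..<n}. card {w \<in> words n \<nu>. ?P w (fst p) (snd p)})"
    by (simp add: fixed_words_def sum.cartesian_product split_def)
  also have "\<dots> = card (Sigma ({..<n} \<times> {..<n}) (\<lambda>p. {w \<in> words n \<nu>. ?P w (fst p) (snd p)}))"
    using finite_words[of L \<nu>] L by (subst card_SigmaI) auto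
  also have "\<dots> = card ?Z"
    by (rule bij_betw_same_card[of "\<lambda>((a, b), w). (w, a, b)"])
      (auto simp: bij_betw_def inj_on_def image_iff)
  also have "\<dots> = (\<Sum>p\<in>{..<L} \<times> {..<L}. \<Sum>z | z \<in> ?Z \<and> (case z of (w, a, b) \<Rightarrow> (w a, w b)) = p. 1)"
    unfolding card_eq_sum
    by (rule sum.group[symmetric]) (use fZ word_lt[OF _ L] in auto)
  also have "\<dots> = (\<Sum>p\<in>{..<L} \<times> {..<L}. card (swap_triples n \<nu> \<sigma> (fst p) (snd p)))"
    unfolding P by (intro sum.cong refl) (auto simp: swap_triples_def intro!: arg_cong[where f = card])
  also have "\<dots> = (\<Sum>i<L. \<Sum>j<L. card (swap_triples n \<nu> \<sigma> i j))"
    by (simp add: sum.cartesian_product split_def)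
  finally show ?thesis .
qed

section \<open>Products with transpositions\<close>

definition compositions :: "nat \<Rightarrow> nat \<Rightarrow> (nat \<Rightarrow> nat) set" where
  "compositions L n = {\<nu>. (\<forall>c\<ge>L. \<nu> c = 0) \<and> sum \<nu> {..<L} = n}"

definition partitions :: "nat \<Rightarrow> nat \<Rightarrow> (nat \<Rightarrow> nat) set" where
  "partitions L n = {\<nu> \<in> compositions L n. antimono \<nu>}"

text \<open>The rank for triangularity: strictly increased when a unit moves from one entry to
  another at least as large, and blind to the order of the entries.\<close>

definition sum_squares :: "nat \<Rightarrow> (nat \<Rightarrow> nat) \<Rightarrow> nat" where
  "sum_squares L \<nu> = (\<Sum>i<L. (\<nu> i)\<^sup>2)"

text \<open>The formula for \<open>K(\<alpha>)\<close> with parts indexed from \<open>0\<close>.\<close>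

definition total_content :: "nat \<Rightarrow> (nat \<Rightarrow> nat) \<Rightarrow> real" where
  "total_content L \<nu> = (\<Sum>i<L. real (\<nu> i) * (real (\<nu> i) - 1 - 2 * real i)) / 2"

definition transpositions :: "nat \<Rightarrow> (nat \<Rightarrow> nat) set" where
  "transpositions n = {\<tau>. \<exists>a<n. \<exists>b<n. a \<noteq> b \<and> \<tau> = Transposition.transpose a b}"

lemma finite_compositions [simp]: "finite (compositions L n)"
proof (rule finite_subset)
  show "compositions L n \<subseteq> {f. \<forall>x. (x \<in> {..<L} \<longrightarrow> f x \<in> {..n}) \<and> (x \<notin> {..<L} \<longrightarrow> f x = 0)}"
    by (auto simp: compositions_def intro: member_le_sum)
  show "finite {f. \<forall>x. (x \<in> {..<L} \<longrightarrow> f x \<in> {..n}) \<and> (x \<notin> {..<L} \<longrightarrow> f x = (0::nat))}"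
    by (rule finite_set_of_finite_funs) auto
qed

lemma finite_partitions [simp]: "finite (partitions L n)"
  by (rule finite_subset[OF _ finite_compositions[of L n]]) (auto simp: partitions_def)

lemma partitions_subset: "\<nu> \<in> partitions L n \<Longrightarrow> \<nu> \<in> compositions L n"
  by (simp add: partitions_def)

lemma compositions_zero: "\<nu> \<in> compositions L n \<Longrightarrow> \<forall>c\<ge>L. \<nu> c = 0"
  by (simp add: compositions_def)

lemma composition_sortable:
  assumes "\<nu> \<in> compositions L n"
  obtains \<pi> where "\<pi> permutes {..<L}" "\<nu> \<circ> \<pi> \<in> partitions L n"
proof -
  define ys where "ys = map \<nu> [0..<L]"
  have "mset (rev (sort ys)) = mset ys" by simp
  then obtain \<pi> where \<pi>: "\<pi> permutes {..<length ys}" "permute_list \<pi> ys = rev (sort ys)"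
    by (metis mset_eq_permutation)
  have \<pi>': "\<pi> permutes {..<L}" using \<pi>(1) by (simp add: ys_def)
  have eq: "\<nu> (\<pi> i) = rev (sort ys) ! i" if "i < L" for i
    using that permute_list_nth[OF \<pi>(1), of i] permutes_in_image[OF \<pi>', of i] \<pi>(2)
    by (simp add: ys_def)
  have len: "length (sort ys) = L" by (simp add: ys_def)
  have zero: "\<nu> (\<pi> c) = 0" if "c \<ge> L" for c
    using that permutes_not_in[OF \<pi>', of c] compositions_zero[OF assms] by simp
  have "antimono (\<nu> \<circ> \<pi>)"
  proof (rule antimonoI)
    fix x y :: nat assume xy: "x \<le> y"
    show "(\<nu> \<circ> \<pi>) y \<le> (\<nu> \<circ> \<pi>) x"
    proof (cases "y < L")
      case True
      then show ?thesis using xy len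
        by (auto simp: eq rev_nth intro!: sorted_nth_mono)
    qed (simp add: zero)
  qed
  moreover have "\<nu> \<circ> \<pi> \<in> compositions L n"
    using assms zero sum.permute[OF \<pi>', of \<nu>] by (simp add: compositions_def)
  ultimately show ?thesis using that \<pi>' by (simp add: partitions_def)
qed

text \<open>Renaming letters commutes with permuting positions, so only the multiset of entries of
  \<nu> matters. This brings the weights produced by raising operators, which need not be sorted,
  back to partitions.\<close>

lemma fixed_words_permute:
  assumes \<pi>: "\<pi> permutes {..<L}" and \<sigma>: "\<sigma> permutes {..<n}" and \<nu>: "\<nu> \<in> compositions L n"
  shows "fixed_words n (\<nu> \<circ> \<pi>) \<sigma> = fixed_words n \<nu> \<sigma>"
proof -
  have s: "\<sigma> x < n \<longleftrightarrow> x < n" for x using permutes_in_image[OF \<sigma>, of x] by simp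
  have cont: "word_content n (restrict (p \<circ> w) {..<n}) = word_content n w \<circ> Hilbert_Choice.inv p" if "bij p" for p w
  proof
    fix c
    have "{x. x < n \<and> restrict (p \<circ> w) {..<n} x = c} = {x. x < n \<and> w x = Hilbert_Choice.inv p c}"
      using that by (auto simp: bij_inv_eq_iff bij_is_inj inv_f_f)
    then show "word_content n (restrict (p \<circ> w) {..<n}) c = (word_content n w \<circ> Hilbert_Choice.inv p) c"
      by (simp add: word_content_def)
  qed
  have fix1: "restrict (p \<circ> w) {..<n} \<circ> \<sigma> = restrict (p \<circ> w) {..<n}" if "w \<circ> \<sigma> = w" for p and w :: "nat \<Rightarrow> nat"
    using that s by (auto simp: fun_eq_iff restrict_def)
  have bij: "bij \<pi>" "bij (Hilbert_Choice.inv \<pi>)" using \<pi> permutes_bij permutes_inv by blast+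
  have ii: "Hilbert_Choice.inv (Hilbert_Choice.inv \<pi>) = \<pi>" using bij inv_inv_eq by blast
  have res: "restrict (p \<circ> restrict (q \<circ> w) {..<n}) {..<n} = w"
    if "w \<in> extensional {..<n}" "p \<circ> q = id" for p q and w :: "nat \<Rightarrow> nat"
    using that by (auto simp: fun_eq_iff restrict_def extensional_def)
  have c1: "Hilbert_Choice.inv \<pi> \<circ> \<pi> = id" "\<pi> \<circ> Hilbert_Choice.inv \<pi> = id"
    using permutes_inv_o[OF \<pi>] by auto
  let ?f = "\<lambda>w. restrict (\<pi> \<circ> w) {..<n}" and ?g = "\<lambda>w. restrict (Hilbert_Choice.inv \<pi> \<circ> w) {..<n}"
  have "?f w \<in> words n \<nu>" if "w \<in> words n (\<nu> \<circ> \<pi>)" for w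
    using that by (simp add: words_def cont[OF bij(1)] o_assoc[symmetric] c1)
  moreover have "?g w \<in> words n (\<nu> \<circ> \<pi>)" if "w \<in> words n \<nu>" for w
    using that by (simp add: words_def cont[OF bij(2)] ii)
  moreover have "?g (?f w) = w" "?f (?g w) = w" if "w \<in> extensional {..<n}" for w
    using that by (simp_all add: res c1)
  ultimately have "bij_betw ?f {w \<in> words n (\<nu> \<circ> \<pi>). w \<circ> \<sigma> = w} {w \<in> words n \<nu>. w \<circ> \<sigma> = w}"
    using fix1[of _ \<pi>] fix1[of _ "Hilbert_Choice.inv \<pi>"]
    by (intro bij_betw_byWitness[where f' = ?g]) (auto simp: words_def)
  then show ?thesis unfolding fixed_words_def by (rule bij_betw_same_card)
qed

lemma sum_square_symmetric:
  fixes f :: "nat \<Rightarrow> nat \<Rightarrow> 'a :: comm_semiring_1"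
  assumes "\<And>i j. f i j = f j i"
  shows "(\<Sum>i<L. \<Sum>j<L. f i j) = (\<Sum>i<L. f i i) + 2 * (\<Sum>j<L. \<Sum>i<j. f i j)"
proof (induction L)
  case (Suc L)
  have "(\<Sum>i<Suc L. \<Sum>j<Suc L. f i j) = (\<Sum>i<L. \<Sum>j<L. f i j) + (\<Sum>i<L. f i L) + (\<Sum>j<L. f L j) + f L L"
    by (simp add: sum.distrib algebra_simps)
  also have "(\<Sum>j<L. f L j) = (\<Sum>i<L. f i L)" using assms by simp
  finally show ?case using Suc by (simp add: algebra_simps mult_2)
qed simp

lemma transpose_ordered_inj:
  "inj_on (\<lambda>(b, a). Transposition.transpose a b) (Sigma {..<n::nat} (\<lambda>b. {..<b}))"
proof (rule inj_onI, clarify)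
  fix a b c d :: nat
  assume "a < b" "c < d" and eq: "Transposition.transpose a b = Transposition.transpose c d"
  have "{x. Transposition.transpose a b x \<noteq> x} = {a, b}" "{x. Transposition.transpose c d x \<noteq> x} = {c, d}"
    using \<open>a < b\<close> \<open>c < d\<close> by (auto simp: Transposition.transpose_def)
  then have "{a, b} = {c, d}" using eq by simp
  then show "b = d \<and> a = c" using \<open>a < b\<close> \<open>c < d\<close> by (auto simp: doubleton_eq_iff)
qed

lemma transpositions_ordered:
  "transpositions n = (\<lambda>(b, a). Transposition.transpose a b) ` Sigma {..<n} (\<lambda>b. {..<b})"
proof
  show "transpositions n \<subseteq> (\<lambda>(b, a). Transposition.transpose a b) ` Sigma {..<n} (\<lambda>b. {..<b})"
  proof
    fix \<tau> assume "\<tau> \<in> transpositions n"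
    then obtain a b where ab: "a < n" "b < n" "a \<noteq> b" "\<tau> = Transposition.transpose a b"
      by (auto simp: transpositions_def)
    show "\<tau> \<in> (\<lambda>(b, a). Transposition.transpose a b) ` Sigma {..<n} (\<lambda>b. {..<b})"
    proof (cases "a < b")
      case True
      then show ?thesis using ab by (auto intro!: image_eqI[of _ _ "(b, a)"])
    next
      case False
      then show ?thesis using ab
        by (intro image_eqI[of _ _ "(a, b)"]) (auto simp: transpose_commute)
    qed
  qed
  show "(\<lambda>(b, a). Transposition.transpose a b) ` Sigma {..<n} (\<lambda>b. {..<b}) \<subseteq> transpositions n"
    unfolding transpositions_def by (auto; metis less_irrefl less_trans)
qed

lemma finite_transpositions [simp]: "finite (transpositions n)"
  by (simp add: transpositions_ordered)

lemma sum_transpositions: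
  fixes f :: "(nat \<Rightarrow> nat) \<Rightarrow> real"
  shows "(\<Sum>a<n. \<Sum>b<n. f (Transposition.transpose a b)) = real n * f id + 2 * (\<Sum>\<tau>\<in>transpositions n. f \<tau>)"
proof -
  have "(\<Sum>a<n. \<Sum>b<n. f (Transposition.transpose a b)) =
      (\<Sum>a<n. f (Transposition.transpose a a)) + 2 * (\<Sum>b<n. \<Sum>a<b. f (Transposition.transpose a b))"
    by (rule sum_square_symmetric) (metis transpose_commute)
  also have "(\<Sum>b<n. \<Sum>a<b. f (Transposition.transpose a b)) = (\<Sum>\<tau>\<in>transpositions n. f \<tau>)"
    unfolding transpositions_ordered
    by (subst sum.reindex[OF transpose_ordered_inj]) (simp add: sum.Sigma split_def)
  also have "(\<Sum>a<n. f (Transposition.transpose a a)) = (\<Sum>a<n. f id)"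
    by (intro sum.cong arg_cong[of _ _ f]) (auto simp: fun_eq_iff)
  finally show ?thesis by simp
qed

lemma transposition_permutes: "\<tau> \<in> transpositions n \<Longrightarrow> \<tau> permutes {..<n}"
  by (auto simp: transpositions_def intro: permutes_swap_id)

text \<open>Functions on \<open>S\<^sub>n\<close> which are combinations of the characters strictly above \<open>R\<close> in the order that
  makes the sum of transpositions triangular.\<close>

definition in_span :: "nat \<Rightarrow> nat \<Rightarrow> nat \<Rightarrow> ((nat \<Rightarrow> nat) \<Rightarrow> real) \<Rightarrow> bool" where
  "in_span L n R f \<longleftrightarrow> (\<exists>a. \<forall>\<sigma>. \<sigma> permutes {..<n} \<longrightarrow>
     f \<sigma> = (\<Sum>\<nu> | \<nu> \<in> partitions L n \<and> R < sum_squares L \<nu>. a \<nu> * real (fixed_words n \<nu> \<sigma>)))"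

lemma in_span_cong:
  "in_span L n R f \<Longrightarrow> (\<And>\<sigma>. \<sigma> permutes {..<n} \<Longrightarrow> f \<sigma> = g \<sigma>) \<Longrightarrow> in_span L n R g"
  unfolding in_span_def by simp

lemma in_span_zero: "in_span L n R (\<lambda>_. 0)"
  unfolding in_span_def by (rule exI[of _ "\<lambda>_. 0"]) simp

lemma in_span_add:
  assumes "in_span L n R f" "in_span L n R g"
  shows "in_span L n R (\<lambda>\<sigma>. f \<sigma> + g \<sigma>)"
proof -
  obtain a where a: "\<forall>\<sigma>. \<sigma> permutes {..<n} \<longrightarrow>
     f \<sigma> = (\<Sum>\<nu> | \<nu> \<in> partitions L n \<and> R < sum_squares L \<nu>. a \<nu> * real (fixed_words n \<nu> \<sigma>))"
    using assms(1) by (auto simp: in_span_def)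
  obtain b where b: "\<forall>\<sigma>. \<sigma> permutes {..<n} \<longrightarrow>
     g \<sigma> = (\<Sum>\<nu> | \<nu> \<in> partitions L n \<and> R < sum_squares L \<nu>. b \<nu> * real (fixed_words n \<nu> \<sigma>))"
    using assms(2) by (auto simp: in_span_def)
  show ?thesis unfolding in_span_def
    by (rule exI[of _ "\<lambda>\<nu>. a \<nu> + b \<nu>"]) (simp add: a b sum.distrib ring_distribs)
qed

lemma in_span_scale:
  assumes "in_span L n R f"
  shows "in_span L n R (\<lambda>\<sigma>. c * f \<sigma>)"
proof -
  obtain a where a: "\<forall>\<sigma>. \<sigma> permutes {..<n} \<longrightarrow>
     f \<sigma> = (\<Sum>\<nu> | \<nu> \<in> partitions L n \<and> R < sum_squares L \<nu>. a \<nu> * real (fixed_words n \<nu> \<sigma>))"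
    using assms(1) by (auto simp: in_span_def)
  show ?thesis unfolding in_span_def
    by (rule exI[of _ "\<lambda>\<nu>. c * a \<nu>"]) (simp add: a sum_distrib_left mult.assoc)
qed

lemma in_span_sum:
  "finite A \<Longrightarrow> (\<And>x. x \<in> A \<Longrightarrow> in_span L n R (f x)) \<Longrightarrow> in_span L n R (\<lambda>\<sigma>. \<Sum>x\<in>A. f x \<sigma>)"
  by (induction A rule: finite_induct) (auto intro: in_span_zero in_span_add)

lemma in_span_partition:
  assumes "\<nu> \<in> partitions L n" "R < sum_squares L \<nu>"
  shows "in_span L n R (\<lambda>\<sigma>. real (fixed_words n \<nu> \<sigma>))"
  unfolding in_span_def
proof (rule exI[of _ "\<lambda>\<mu>. if \<mu> = \<nu> then 1 else 0"], intro allI impI)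
  fix \<sigma>
  show "real (fixed_words n \<nu> \<sigma>) = (\<Sum>\<mu> | \<mu> \<in> partitions L n \<and> R < sum_squares L \<mu>.
      (if \<mu> = \<nu> then 1 else 0) * real (fixed_words n \<mu> \<sigma>))"
    using assms by (simp add: if_distrib[of "\<lambda>x. x * _"] cong: if_cong)
qed

lemma in_span_mono:
  assumes "in_span L n R f" "R' \<le> R"
  shows "in_span L n R' f"
proof -
  obtain a where a: "\<And>\<sigma>. \<sigma> permutes {..<n} \<Longrightarrow>
     f \<sigma> = (\<Sum>\<nu> | \<nu> \<in> partitions L n \<and> R < sum_squares L \<nu>. a \<nu> * real (fixed_words n \<nu> \<sigma>))"
    using assms(1) by (auto simp: in_span_def)
  have "in_span L n R' (\<lambda>\<sigma>. \<Sum>\<nu> | \<nu> \<in> partitions L n \<and> R < sum_squares L \<nu>. a \<nu> * real (fixed_words n \<nu> \<sigma>))"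
    using assms(2) by (intro in_span_sum in_span_scale in_span_partition) auto
  then show ?thesis by (rule in_span_cong) (simp add: a)
qed

lemma in_span_composition:
  assumes "\<nu> \<in> compositions L n" "R < sum_squares L \<nu>"
  shows "in_span L n R (\<lambda>\<sigma>. real (fixed_words n \<nu> \<sigma>))"
proof -
  obtain \<pi> where \<pi>: "\<pi> permutes {..<L}" "\<nu> \<circ> \<pi> \<in> partitions L n"
    using composition_sortable[OF assms(1)] by blast
  have "sum_squares L (\<nu> \<circ> \<pi>) = sum_squares L \<nu>"
    unfolding sum_squares_def using sum.permute[OF \<pi>(1), of "\<lambda>i. (\<nu> i)\<^sup>2"] by (simp add: o_def)
  then have "in_span L n R (\<lambda>\<sigma>. real (fixed_words n (\<nu> \<circ> \<pi>) \<sigma>))"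
    using \<pi> assms by (intro in_span_partition) auto
  then show ?thesis
    by (rule in_span_cong) (simp add: fixed_words_permute[OF \<pi>(1) _ assms(1)])
qed

text \<open>The squares gain 2 (\<nu> i - \<nu> j) + 2, which is positive even for equal
  entries.\<close>

lemma composition_shift:
  assumes \<nu>: "\<nu> \<in> compositions L n" and ij: "i < L" "j < L" "i \<noteq> j" and pos: "\<nu> j \<ge> 1"
  defines "\<mu> \<equiv> \<nu>(i := \<nu> i + 1, j := \<nu> j - 1)"
  shows "\<mu> \<in> compositions L n"
    and "\<nu> j \<le> \<nu> i \<Longrightarrow> sum_squares L \<nu> < sum_squares L \<mu>"
proof -
  have split: "(\<Sum>c<L. g (f c)) = g (f i) + g (f j) + (\<Sum>c\<in>{..<L} - {i} - {j}. g (f c))"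
    for f :: "nat \<Rightarrow> nat" and g :: "nat \<Rightarrow> nat"
    using ij by (simp add: sum.remove[of "{..<L}" i] sum.remove[of "{..<L} - {i}" j])
  have rest: "(\<Sum>c\<in>{..<L} - {i} - {j}. g (\<mu> c)) = (\<Sum>c\<in>{..<L} - {i} - {j}. g (\<nu> c))" for g :: "nat \<Rightarrow> nat"
    by (rule sum.cong) (auto simp: \<mu>_def)
  have v: "\<mu> i = \<nu> i + 1" "\<mu> j = \<nu> j - 1" using ij by (auto simp: \<mu>_def)
  have "sum \<mu> {..<L} = sum \<nu> {..<L}"
    using split[of "\<lambda>x. x" \<mu>] split[of "\<lambda>x. x" \<nu>] rest[of "\<lambda>x. x"] v pos by simp
  then show "\<mu> \<in> compositions L n"
    using \<nu> ij by (auto simp: compositions_def \<mu>_def)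
  assume le: "\<nu> j \<le> \<nu> i"
  obtain m where m: "\<nu> j = Suc m" using pos by (cases "\<nu> j") auto
  show "sum_squares L \<nu> < sum_squares L \<mu>"
    unfolding sum_squares_def using split[of "\<lambda>x. x\<^sup>2" \<mu>] split[of "\<lambda>x. x\<^sup>2" \<nu>] rest[of "\<lambda>x. x\<^sup>2"] v m le
    by (simp add: power2_eq_square)
qed

text \<open>Cyclicity carries the trace of E_ji E_ij at \<nu> to that of E_ij E_ji at the higher
  weight \<mu>, and the commutator [E_ij, E_ji] = E_ii - E_jj turns it back into the original shape
  up to (\<mu> i - \<mu> j) times the character of \<mu>. Each round lowers entry j by one, and the
  process stops when no letter j is left to move.\<close>

lemma in_span_move_triples:
  assumes "\<nu> \<in> compositions L n" "i < L" "j < L" "i \<noteq> j" "\<nu> j \<le> \<nu> i" "R \<le> sum_squares L \<nu>"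
  shows "in_span L n R (\<lambda>\<sigma>. real (card (move_triples n \<nu> \<sigma> i j)))"
  using assms
proof (induction "\<nu> j" arbitrary: \<nu>)
  case 0
  have "move_triples n \<nu> \<sigma> i j = {}" for \<sigma>
    using word_content_pos[of _ n _ j] 0 by (force simp: move_triples_def words_def)
  then show ?case by (simp add: in_span_zero)
next
  case (Suc m)
  define \<mu> where "\<mu> = \<nu>(i := \<nu> i + 1, j := \<nu> j - 1)"
  have pos: "\<nu> j \<ge> 1" using Suc(2) by simp
  have v: "\<mu> i = \<nu> i + 1" "\<mu> j = \<nu> j - 1" using Suc by (auto simp: \<mu>_def)
  have \<mu>: "\<mu> \<in> compositions L n" "sum_squares L \<nu> < sum_squares L \<mu>"
    unfolding \<mu>_def using composition_shift[of \<nu> L n i j] Suc pos by auto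
  have "in_span L n R (\<lambda>\<sigma>. real (card (move_triples n \<mu> \<sigma> i j)))"
    using Suc v \<mu> by (intro Suc(1)) auto
  then have "in_span L n R (\<lambda>\<sigma>. real (card (move_triples n \<mu> \<sigma> i j)) +
      (real (\<mu> i) - real (\<mu> j)) * real (fixed_words n \<mu> \<sigma>))"
    using \<mu> Suc by (intro in_span_add in_span_scale in_span_composition) auto
  then show ?case
  proof (rule in_span_cong)
    fix \<sigma> assume \<sigma>: "\<sigma> permutes {..<n}"
    note c = card_move_triples[OF _ compositions_zero[OF \<mu>(1)]]
    show "real (card (move_triples n \<mu> \<sigma> i j)) + (real (\<mu> i) - real (\<mu> j)) * real (fixed_words n \<mu> \<sigma>) =
        real (card (move_triples n \<nu> \<sigma> i j))"
      using card_move_triples_shift[of i j \<sigma> n \<nu>, OF \<open>i \<noteq> j\<close> \<sigma> pos, folded \<mu>_def] c[of i j n \<sigma>] c[of j i n \<sigma>]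
        card_swap_triples_commute[of n \<mu> \<sigma> i j] \<open>i \<noteq> j\<close>
      by (simp add: algebra_simps)
  qed
qed

text \<open>Normal ordering of the Casimir operator. Since \<nu> is nonincreasing, moving a letter j
  to i < j goes up, so the move counts lie in the span. What is left is the sum of the squares of
  the entries from equal letters, minus twice the sum of the j \<nu> j from the reordering, minus n
  from equal positions: in total 2 K(\<nu>).\<close>

lemma transposition_sum_triangular:
  assumes \<nu>: "\<nu> \<in> partitions L n"
  shows "in_span L n (sum_squares L \<nu>) (\<lambda>\<sigma>.
    (\<Sum>\<tau>\<in>transpositions n. real (fixed_words n \<nu> (\<sigma> \<circ> \<tau>))) - total_content L \<nu> * real (fixed_words n \<nu> \<sigma>))"
proof -
  have \<nu>c: "\<nu> \<in> compositions L n" using \<nu> by (simp add: partitions_def)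
  have mono: "\<nu> j \<le> \<nu> i" if "i < j" for i j
    using \<nu> that antimonoD[of \<nu> i j] by (simp add: partitions_def)
  have "in_span L n (sum_squares L \<nu>) (\<lambda>\<sigma>. \<Sum>j<L. \<Sum>i<j. real (card (move_triples n \<nu> \<sigma> i j)))"
    using \<nu>c mono by (intro in_span_sum in_span_move_triples) auto
  then show ?thesis
  proof (rule in_span_cong)
    fix \<sigma> assume \<sigma>: "\<sigma> permutes {..<n}"
    let ?U = "real (fixed_words n \<nu> \<sigma>)"
    let ?T = "\<Sum>\<tau>\<in>transpositions n. real (fixed_words n \<nu> (\<sigma> \<circ> \<tau>))"
    have S: "real (card (swap_triples n \<nu> \<sigma> i j)) = real (card (move_triples n \<nu> \<sigma> i j)) - real (\<nu> j) * ?U"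
      if "i < j" for i j
      using card_move_triples[OF _ compositions_zero[OF \<nu>c], of i j n \<sigma>] that by simp
    have "(\<Sum>a<n. \<Sum>b<n. real (fixed_words n \<nu> (\<sigma> \<circ> Transposition.transpose a b))) =
        (\<Sum>i<L. \<Sum>j<L. real (card (swap_triples n \<nu> \<sigma> i j)))"
      using arg_cong[OF sum_pairs_fixed_words[OF compositions_zero[OF \<nu>c], of n \<sigma>], of real] by simp
    also have "\<dots> = (\<Sum>i<L. real (card (swap_triples n \<nu> \<sigma> i i))) +
        2 * (\<Sum>j<L. \<Sum>i<j. real (card (swap_triples n \<nu> \<sigma> i j)))"
      by (rule sum_square_symmetric) (simp add: card_swap_triples_commute)
    also have "(\<Sum>i<L. real (card (swap_triples n \<nu> \<sigma> i i))) = (\<Sum>i<L. (real (\<nu> i))\<^sup>2 * ?U)"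
      using swap_triples_diag[OF compositions_zero[OF \<nu>c], of n \<sigma>] by (simp add: mult.commute)
    also have "(\<Sum>j<L. \<Sum>i<j. real (card (swap_triples n \<nu> \<sigma> i j))) =
        (\<Sum>j<L. \<Sum>i<j. real (card (move_triples n \<nu> \<sigma> i j))) - (\<Sum>j<L. real j * real (\<nu> j) * ?U)"
      by (simp add: S sum_subtractf mult.assoc)
    finally have "real n * ?U + 2 * ?T = (\<Sum>i<L. (real (\<nu> i))\<^sup>2 * ?U) +
        2 * ((\<Sum>j<L. \<Sum>i<j. real (card (move_triples n \<nu> \<sigma> i j))) - (\<Sum>j<L. real j * real (\<nu> j) * ?U))"
      unfolding sum_transpositions[of "\<lambda>\<tau>. real (fixed_words n \<nu> (\<sigma> \<circ> \<tau>))" n, unfolded o_id] .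
    moreover have "2 * total_content L \<nu> * ?U = (\<Sum>i<L. (real (\<nu> i))\<^sup>2 * ?U) - real n * ?U
        - 2 * (\<Sum>j<L. real j * real (\<nu> j) * ?U)"
    proof -
      have "real n = (\<Sum>i<L. real (\<nu> i))" using \<nu>c by (auto simp: compositions_def)
      then show ?thesis
        by (simp add: total_content_def sum_distrib_left sum_distrib_right sum_subtractf[symmetric]
            algebra_simps power2_eq_square)
    qed
    ultimately show "(\<Sum>j<L. \<Sum>i<j. real (card (move_triples n \<nu> \<sigma> i j))) =
        ?T - total_content L \<nu> * ?U" by (simp add: algebra_simps)
  qed
qed

text \<open>Multiplication by the k-th power of the class sum of transpositions, written on
  functions instead of in the group algebra.\<close>

fun transposition_power :: "nat \<Rightarrow> nat \<Rightarrow> ((nat \<Rightarrow> nat) \<Rightarrow> real) \<Rightarrow> (nat \<Rightarrow> nat) \<Rightarrow> real" where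
  "transposition_power n 0 f \<sigma> = f \<sigma>"
| "transposition_power n (Suc k) f \<sigma> = (\<Sum>\<tau>\<in>transpositions n. transposition_power n k f (\<sigma> \<circ> \<tau>))"

text \<open>The span strictly above \<nu> is stable under the operator, each of its characters going
  to a multiple of itself plus higher ones; so modulo that span every further step multiplies by
  \<open>total_content L \<nu>\<close>.\<close>

lemma transposition_power_triangular:
  assumes \<nu>: "\<nu> \<in> partitions L n"
  shows "in_span L n (sum_squares L \<nu>) (\<lambda>\<sigma>.
    transposition_power n k (\<lambda>\<sigma>. real (fixed_words n \<nu> \<sigma>)) \<sigma> - total_content L \<nu> ^ k * real (fixed_words n \<nu> \<sigma>))"
proof (induction k)
  case 0
  then show ?case by (simp add: in_span_zero)
next
  case (Suc k)
  let ?K = "total_content L" and ?U = "\<lambda>\<nu> \<sigma>. real (fixed_words n \<nu> \<sigma>)"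
  let ?T = "\<lambda>f \<sigma>. \<Sum>\<tau>\<in>transpositions n. f (\<sigma> \<circ> \<tau>)"
  let ?A = "{\<mu>. \<mu> \<in> partitions L n \<and> sum_squares L \<nu> < sum_squares L \<mu>}"
  obtain a where a: "\<And>\<sigma>. \<sigma> permutes {..<n} \<Longrightarrow>
     transposition_power n k (?U \<nu>) \<sigma> - ?K \<nu> ^ k * ?U \<nu> \<sigma> = (\<Sum>\<mu>\<in>?A. a \<mu> * ?U \<mu> \<sigma>)"
    using Suc unfolding in_span_def by blast
  have *: "in_span L n (sum_squares L \<nu>) (\<lambda>\<sigma>. ?K \<nu> ^ k * (?T (?U \<nu>) \<sigma> - ?K \<nu> * ?U \<nu> \<sigma>) +
      (\<Sum>\<mu>\<in>?A. a \<mu> * ((?T (?U \<mu>) \<sigma> - ?K \<mu> * ?U \<mu> \<sigma>) + ?K \<mu> * ?U \<mu> \<sigma>)))"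
    using \<nu> by (intro in_span_add in_span_sum in_span_scale transposition_sum_triangular in_span_partition
        in_span_mono[OF transposition_sum_triangular]) auto
  show ?case
  proof (rule in_span_cong[OF *])
    fix \<sigma> assume \<sigma>: "\<sigma> permutes {..<n}"
    have "transposition_power n (Suc k) (?U \<nu>) \<sigma> = 
        (\<Sum>\<tau>\<in>transpositions n. ?K \<nu> ^ k * ?U \<nu> (\<sigma> \<circ> \<tau>) + (\<Sum>\<mu>\<in>?A. a \<mu> * ?U \<mu> (\<sigma> \<circ> \<tau>)))"
      unfolding transposition_power.simps
    proof (rule sum.cong)
      fix \<tau> assume "\<tau> \<in> transpositions n"
      then have "\<sigma> \<circ> \<tau> permutes {..<n}" using \<sigma> transposition_permutes by (auto intro: permutes_compose)
      then show "transposition_power n k (?U \<nu>) (\<sigma> \<circ> \<tau>) =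
          ?K \<nu> ^ k * ?U \<nu> (\<sigma> \<circ> \<tau>) + (\<Sum>\<mu>\<in>?A. a \<mu> * ?U \<mu> (\<sigma> \<circ> \<tau>))" using a by (simp add: algebra_simps)
    qed simp
    also have "\<dots> = ?K \<nu> ^ k * ?T (?U \<nu>) \<sigma> + (\<Sum>\<mu>\<in>?A. a \<mu> * ?T (?U \<mu>) \<sigma>)"
      by (simp add: sum.distrib sum_distrib_left sum.swap[of _ "?A" "transpositions n"])
    finally show "?K \<nu> ^ k * (?T (?U \<nu>) \<sigma> - ?K \<nu> * ?U \<nu> \<sigma>) +
      (\<Sum>\<mu>\<in>?A. a \<mu> * ((?T (?U \<mu>) \<sigma> - ?K \<mu> * ?U \<mu> \<sigma>) + ?K \<mu> * ?U \<mu> \<sigma>)) =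
      transposition_power n (Suc k) (?U \<nu>) \<sigma> - ?K \<nu> ^ Suc k * ?U \<nu> \<sigma>"
      by (simp add: algebra_simps)
  qed
qed

section \<open>Cycle types\<close>

text \<open>The boxes of the diagram of \<nu>. Shifting every row cyclically by one box is the model
  permutation with cycle lengths \<nu>, and \<open>cycle_type\<close> asks for a numbering of the
  boxes that carries it to \<sigma>. Rows of length 0 contain no box, so padding by zeros is
  harmless.\<close>

definition cells :: "nat \<Rightarrow> (nat \<Rightarrow> nat) \<Rightarrow> (nat \<times> nat) set" where
  "cells L \<nu> = Sigma {..<L} (\<lambda>c. {..<\<nu> c})"

definition rotate_rows :: "(nat \<Rightarrow> nat) \<Rightarrow> nat \<times> nat \<Rightarrow> nat \<times> nat" where
  "rotate_rows \<nu> p = (fst p, Suc (snd p) mod \<nu> (fst p))"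

definition cycle_type :: "nat \<Rightarrow> nat \<Rightarrow> (nat \<Rightarrow> nat) \<Rightarrow> (nat \<Rightarrow> nat) \<Rightarrow> bool" where
  "cycle_type L n \<nu> \<sigma> \<longleftrightarrow> \<sigma> permutes {..<n} \<and>
     (\<exists>g. bij_betw g (cells L \<nu>) {..<n} \<and> (\<forall>p\<in>cells L \<nu>. \<sigma> (g p) = g (rotate_rows \<nu> p)))"

lemma finite_cells [simp]: "finite (cells L \<nu>)"
  by (simp add: cells_def)

lemma card_cells: "card (cells L \<nu>) = sum \<nu> {..<L}"
  by (simp add: cells_def)

lemma rotate_rows_cells: "p \<in> cells L \<nu> \<Longrightarrow> rotate_rows \<nu> p \<in> cells L \<nu>"
  by (auto simp: cells_def rotate_rows_def)

lemma bij_rotate_rows: "bij_betw (rotate_rows \<nu>) (cells L \<nu>) (cells L \<nu>)"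
proof -
  have inj: "k = k'" if "Suc k mod m = Suc k' mod m" "k < m" "k' < m" for k k' m :: nat
    using that by (cases "Suc k = m"; cases "Suc k' = m") auto
  have "inj_on (rotate_rows \<nu>) (cells L \<nu>)"
    by (rule inj_onI) (auto simp: cells_def rotate_rows_def prod_eq_iff intro: inj)
  moreover have "rotate_rows \<nu> ` cells L \<nu> \<subseteq> cells L \<nu>"
    using rotate_rows_cells by blast
  ultimately show ?thesis
    by (simp add: bij_betw_def endo_inj_surj)
qed

lemma cycle_type_exists:
  assumes "\<nu> \<in> compositions L n"
  shows "\<exists>\<sigma>. cycle_type L n \<nu> \<sigma>"
proof -
  have "card (cells L \<nu>) = card {..<n}" using assms by (simp add: card_cells compositions_def)
  then obtain g where g: "bij_betw g (cells L \<nu>) {..<n}"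
    using finite_same_card_bij[of "cells L \<nu>" "{..<n}"] by auto
  let ?g' = "inv_into (cells L \<nu>) g"
  define \<sigma> where "\<sigma> = (\<lambda>x. if x < n then g (rotate_rows \<nu> (?g' x)) else x)"
  have "bij_betw (g \<circ> rotate_rows \<nu> \<circ> ?g') {..<n} {..<n}"
    using g bij_rotate_rows bij_betw_inv_into[OF g] by (intro bij_betw_trans)
  then have "bij_betw \<sigma> {..<n} {..<n}"
    by (rule bij_betw_cong[THEN iffD1, rotated]) (auto simp: \<sigma>_def)
  then have "\<sigma> permutes {..<n}" by (rule bij_imp_permutes) (auto simp: \<sigma>_def)
  moreover have "\<sigma> (g p) = g (rotate_rows \<nu> p)" if "p \<in> cells L \<nu>" for p
    using that g bij_betw_apply[OF g] by (auto simp: \<sigma>_def bij_betw_inv_into_left)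
  ultimately have "cycle_type L n \<nu> \<sigma>" using g unfolding cycle_type_def by blast
  then show ?thesis by (rule exI[of "cycle_type L n \<nu>"])
qed

lemma cycle_type_permute:
  assumes "cycle_type L n \<nu> \<sigma>" "\<pi> permutes {..<L}"
  shows "cycle_type L n (\<nu> \<circ> \<pi>) \<sigma>"
proof -
  obtain g where g: "bij_betw g (cells L \<nu>) {..<n}" "\<And>p. p \<in> cells L \<nu> \<Longrightarrow> \<sigma> (g p) = g (rotate_rows \<nu> p)"
    using assms by (auto simp: cycle_type_def)
  let ?f = "\<lambda>(c, k). (\<pi> c, k)"
  have \<pi>: "\<pi> c < L \<longleftrightarrow> c < L" "Hilbert_Choice.inv \<pi> c < L \<longleftrightarrow> c < L"
     "\<pi> (Hilbert_Choice.inv \<pi> c) = c" "Hilbert_Choice.inv \<pi> (\<pi> c) = c" for c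
    using permutes_in_image[OF assms(2), of c] permutes_in_image[OF permutes_inv[OF assms(2)], of c]
      permutes_inverses[OF assms(2)] by auto
  have "bij_betw ?f (cells L (\<nu> \<circ> \<pi>)) (cells L \<nu>)"
    by (rule bij_betw_byWitness[where f' = "\<lambda>(c, k). (Hilbert_Choice.inv \<pi> c, k)"])
      (auto simp: cells_def \<pi>)
  then have "bij_betw (g \<circ> ?f) (cells L (\<nu> \<circ> \<pi>)) {..<n}"
    using g(1) by (rule bij_betw_trans)
  moreover have "\<sigma> ((g \<circ> ?f) p) = (g \<circ> ?f) (rotate_rows (\<nu> \<circ> \<pi>) p)" if "p \<in> cells L (\<nu> \<circ> \<pi>)" for p
    using g(2)[of "?f p"] that \<pi> by (auto simp: cells_def rotate_rows_def split_def)
  ultimately show ?thesis using assms(1) by (auto simp: cycle_type_def)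
qed

text \<open>Row c is the cycle with least element c, of length
  \<open>funpow_dist1 \<sigma> c c\<close>, and is empty when c is not least in its cycle. Rows are
  thus indexed by points, which is where n \<le> L comes in; sorting them is left to the
  end.\<close>

lemma permutation_has_cycle_type:
  assumes \<sigma>: "\<sigma> permutes {..<n}" and L: "n \<le> L"
  shows "\<exists>\<nu>\<in>partitions L n. cycle_type L n \<nu> \<sigma>"
proof -
  have perm: "permutation \<sigma>" using \<sigma> by (auto simp: permutation_permutes)
  have self: "x \<in> orbit \<sigma> x" for x by (rule permutation_self_in_orbit[OF perm])
  have orb: "orbit \<sigma> y = orbit \<sigma> x" if "y \<in> orbit \<sigma> x" for x y
    using orbit_cyclic_eq3[OF cyclic_on_orbit'[OF perm] that] .
  have fin: "finite (orbit \<sigma> x)" for x using finite_orbit[OF self] .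
  define low where "low x = Min (orbit \<sigma> x)" for x
  have low_in: "low x \<in> orbit \<sigma> x" for x
    unfolding low_def by (rule Min_in) (use fin self in auto)
  have low_eq: "low y = low x" if "y \<in> orbit \<sigma> x" for x y using orb[OF that] by (simp add: low_def)
  define \<nu> where "\<nu> c = (if c < n \<and> low c = c then funpow_dist1 \<sigma> c c else 0)" for c
  define g where "g = (\<lambda>(c, k). (\<sigma> ^^ k) c)"
  have g_orbit: "(\<sigma> ^^ k) c \<in> orbit \<sigma> c" for k c by (rule funpow_in_orbit[OF self])
  have cell: "c < n \<and> low c = c \<and> k < funpow_dist1 \<sigma> c c" if "(c, k) \<in> cells L \<nu>" for c k
    using that by (auto simp: cells_def \<nu>_def split: if_splits)
  have inj: "inj_on g (cells L \<nu>)"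
  proof (rule inj_onI, clarify)
    fix c k d l assume A: "(c, k) \<in> cells L \<nu>" "(d, l) \<in> cells L \<nu>" "g (c, k) = g (d, l)"
    then have "(\<sigma> ^^ k) c = (\<sigma> ^^ l) d" by (simp add: g_def)
    then have "low c = low d" using low_eq[OF g_orbit[of k c]] low_eq[OF g_orbit[of l d]] by simp
    then have "c = d" using cell A by metis
    moreover have "k = l"
      using inj_onD[OF inj_on_funpow_dist1[OF self[of c]], of k l] A cell[of c k] cell[of d l] \<open>c = d\<close>
      by (auto simp: g_def)
    ultimately show "c = d \<and> k = l" by simp
  qed
  have sub: "orbit \<sigma> x \<subseteq> {..<n}" if "x < n" for x using permutes_orbit_subset[OF \<sigma>] that by auto
  have img: "g ` cells L \<nu> = {..<n}"
  proof
    show "g ` cells L \<nu> \<subseteq> {..<n}"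
      using cell g_orbit sub by (force simp: g_def)
    show "{..<n} \<subseteq> g ` cells L \<nu>"
    proof
      fix x assume x: "x \<in> {..<n}"
      let ?c = "low x"
      have c: "?c < n" "low ?c = ?c" using sub x low_in low_eq[OF low_in] by auto
      have "x \<in> orbit \<sigma> ?c" using orb[OF low_in] self by simp
      then obtain k where k: "k < funpow_dist1 \<sigma> ?c ?c" "x = (\<sigma> ^^ k) ?c"
        using orbit_conv_funpow_dist1[OF self] by auto
      then show "x \<in> g ` cells L \<nu>" using c L
        by (intro image_eqI[of _ _ "(?c, k)"]) (auto simp: g_def cells_def \<nu>_def)
    qed
  qed
  have bij: "bij_betw g (cells L \<nu>) {..<n}" using inj img by (simp add: bij_betw_def)
  have "\<sigma> (g p) = g (rotate_rows \<nu> p)" if "p \<in> cells L \<nu>" for p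
  proof -
    obtain c k where p: "p = (c, k)" by (cases p)
    have ck: "c < n" "low c = c" "k < funpow_dist1 \<sigma> c c" using cell that p by auto
    then have v: "\<nu> c = funpow_dist1 \<sigma> c c" by (simp add: \<nu>_def)
    show ?thesis
    proof (cases "Suc k = \<nu> c")
      case True
      then have "(\<sigma> ^^ Suc k) c = c" using funpow_dist1_prop[OF self[of c]] v by simp
      then have "\<sigma> ((\<sigma> ^^ k) c) = c" by simp
      then show ?thesis using True by (simp add: p g_def rotate_rows_def)
    next
      case False
      then show ?thesis using ck v by (simp add: p g_def rotate_rows_def)
    qed
  qed
  then have type: "cycle_type L n \<nu> \<sigma>" using \<sigma> bij by (auto simp: cycle_type_def)
  have "\<nu> \<in> compositions L n"
    using bij_betw_same_card[OF bij] L by (auto simp: compositions_def card_cells \<nu>_def)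
  then obtain \<pi> where "\<pi> permutes {..<L}" "\<nu> \<circ> \<pi> \<in> partitions L n" by (rule composition_sortable)
  then show ?thesis using cycle_type_permute[OF type] by blast
qed

lemma cycle_type_conjugate:
  assumes "cycle_type L n \<nu> \<sigma>" "cycle_type L n \<nu> \<sigma>'"
  shows "\<exists>\<pi>. \<pi> permutes {..<n} \<and> \<sigma>' = \<pi> \<circ> \<sigma> \<circ> Hilbert_Choice.inv \<pi>"
proof -
  obtain g where g: "bij_betw g (cells L \<nu>) {..<n}" "\<And>p. p \<in> cells L \<nu> \<Longrightarrow> \<sigma> (g p) = g (rotate_rows \<nu> p)"
    using assms by (auto simp: cycle_type_def)
  obtain h where h: "bij_betw h (cells L \<nu>) {..<n}" "\<And>p. p \<in> cells L \<nu> \<Longrightarrow> \<sigma>' (h p) = h (rotate_rows \<nu> p)"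
    using assms by (auto simp: cycle_type_def)
  have \<sigma>: "\<sigma> permutes {..<n}" "\<sigma>' permutes {..<n}" using assms by (auto simp: cycle_type_def)
  let ?g' = "inv_into (cells L \<nu>) g"
  define \<pi> where "\<pi> = (\<lambda>x. if x < n then h (?g' x) else x)"
  have "bij_betw (h \<circ> ?g') {..<n} {..<n}"
    using h(1) bij_betw_inv_into[OF g(1)] by (intro bij_betw_trans)
  then have "bij_betw \<pi> {..<n} {..<n}"
    by (rule bij_betw_cong[THEN iffD1, rotated]) (auto simp: \<pi>_def)
  then have \<pi>: "\<pi> permutes {..<n}" by (rule bij_imp_permutes) (auto simp: \<pi>_def)
  have \<pi>g: "\<pi> (g p) = h p" if "p \<in> cells L \<nu>" for p
    using that bij_betw_apply[OF g(1) that] g(1) by (auto simp: \<pi>_def bij_betw_inv_into_left)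
  have "\<sigma>' (\<pi> x) = \<pi> (\<sigma> x)" for x
  proof (cases "x < n")
    case True
    then have "x \<in> g ` cells L \<nu>" using g(1) by (simp add: bij_betw_def)
    then obtain p where p: "p \<in> cells L \<nu>" "x = g p" by blast
    then show ?thesis using g(2) h(2) \<pi>g rotate_rows_cells by simp
  next
    case False
    then show ?thesis using \<sigma> \<pi> by (auto simp: permutes_not_in)
  qed
  then have "\<sigma>' = \<pi> \<circ> \<sigma> \<circ> Hilbert_Choice.inv \<pi>"
    using \<pi> by (auto simp: fun_eq_iff permutes_inverses) (metis permutes_inverses(1))
  then show ?thesis using \<pi> by blast
qed

text \<open>The maximum of a set of k + 1 indices is at least k; trading it for k and inducting
  compresses the set to an initial segment, which only increases the sum.\<close>

lemma antimono_sum_le: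
  fixes \<nu> :: "nat \<Rightarrow> nat"
  assumes "antimono \<nu>" "finite E" "card E \<le> m"
  shows "sum \<nu> E \<le> sum \<nu> {..<m}"
proof -
  have "sum \<nu> E \<le> sum \<nu> {..<card E}" using assms(2)
  proof (induction "card E" arbitrary: E)
    case (Suc k)
    let ?e = "Max E"
    have ne: "E \<noteq> {}" using Suc by auto
    then have e: "?e \<in> E" using Suc by simp
    have "E \<subseteq> {..?e}" using Suc by auto
    then have "card E \<le> Suc ?e" using card_mono[of "{..?e}" E] by simp
    then have "\<nu> ?e \<le> \<nu> k" using Suc(2) antimonoD[OF assms(1), of k ?e] by simp
    moreover have "k = card (E - {?e})" using Suc(2,3) e by simp
    then have "sum \<nu> (E - {?e}) \<le> sum \<nu> {..<k}"
      using Suc(1)[of "E - {?e}"] Suc(3) by simp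
    moreover have "sum \<nu> E = \<nu> ?e + sum \<nu> (E - {?e})" using Suc e by (simp add: sum.remove)
    ultimately show ?case unfolding Suc(2)[symmetric] by simp
  qed simp
  also have "\<dots> \<le> sum \<nu> {..<m}" using assms by (intro sum_mono2) auto
  finally show ?thesis .
qed

text \<open>A word fixed by \<sigma> is constant along each cycle, so the first m cycles use at most
  m letters. The positions carrying these letters number at most the sum of m entries of \<nu>,
  hence at most the sum of the m largest.\<close>

lemma fixed_words_dominance:
  assumes type: "cycle_type L n \<mu> \<sigma>" and pos: "fixed_words n \<nu> \<sigma> \<noteq> 0" and \<nu>: "antimono \<nu>" and m: "m \<le> L"
  shows "sum \<mu> {..<m} \<le> sum \<nu> {..<m}"
proof -
  obtain g where g: "bij_betw g (cells L \<mu>) {..<n}" "\<And>p. p \<in> cells L \<mu> \<Longrightarrow> \<sigma> (g p) = g (rotate_rows \<mu> p)"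
    using type by (auto simp: cycle_type_def)
  have "{w \<in> words n \<nu>. w \<circ> \<sigma> = w} \<noteq> {}" 
    using pos unfolding fixed_words_def by force
  then obtain w where w: "word_content n w = \<nu>" "\<And>x. w (\<sigma> x) = w x"
    by (auto simp: words_def fun_eq_iff)
  have const: "w (g (c, k)) = w (g (c, 0))" if "c < L" "k < \<mu> c" for c k
    using that(2)
  proof (induction k)
    case (Suc k)
    have "(c, k) \<in> cells L \<mu>" using that Suc by (auto simp: cells_def)
    then have "\<sigma> (g (c, k)) = g (c, Suc k)" using Suc g(2) by (auto simp: rotate_rows_def)
    then show ?case using w(2)[of "g (c, k)"] Suc by simp
  qed simp
  let ?E = "(\<lambda>c. w (g (c, 0))) ` {..<m}"
  let ?X = "Sigma {..<m} (\<lambda>c. {..<\<mu> c})"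
  have sub: "?X \<subseteq> cells L \<mu>" using m by (auto simp: cells_def)
  have "sum \<mu> {..<m} = card ?X" by simp
  also have "\<dots> = card (g ` ?X)"
    using inj_on_subset[OF bij_betw_imp_inj_on[OF g(1)] sub] by (simp add: card_image)
  also have "\<dots> \<le> card (\<Union>d\<in>?E. {x. x < n \<and> w x = d})"
  proof (rule card_mono)
    show "finite (\<Union>d\<in>?E. {x. x < n \<and> w x = d})" by simp
    show "g ` ?X \<subseteq> (\<Union>d\<in>?E. {x. x < n \<and> w x = d})"
    proof
      fix x assume "x \<in> g ` ?X"
      then obtain c k where ck: "c < m" "k < \<mu> c" "x = g (c, k)" by auto
      moreover have "x < n" using ck sub bij_betw_apply[OF g(1), of "(c, k)"] by auto
      ultimately show "x \<in> (\<Union>d\<in>?E. {x. x < n \<and> w x = d})" using const[of c k] m by auto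
    qed
  qed
  also have "\<dots> \<le> (\<Sum>d\<in>?E. \<nu> d)"
    using card_UN_le[of ?E "\<lambda>d. {x. x < n \<and> w x = d}"] by (simp add: w(1)[symmetric] word_content_def)
  also have "\<dots> \<le> sum \<nu> {..<m}"
    by (rule antimono_sum_le[OF \<nu>]) (use card_image_le[of "{..<m}"] in auto)
  finally show ?thesis .
qed

text \<open>Writing in each box the index of its row gives a fixed word of content \<nu>.\<close>

lemma fixed_words_diag_pos:
  assumes type: "cycle_type L n \<nu> \<sigma>" and \<nu>: "\<nu> \<in> compositions L n"
  shows "fixed_words n \<nu> \<sigma> \<noteq> 0"
proof -
  obtain g where g: "bij_betw g (cells L \<nu>) {..<n}" "\<And>p. p \<in> cells L \<nu> \<Longrightarrow> \<sigma> (g p) = g (rotate_rows \<nu> p)"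
    using type by (auto simp: cycle_type_def)
  have \<sigma>: "\<sigma> x < n \<longleftrightarrow> x < n" for x
    using type permutes_in_image[of \<sigma> "{..<n}" x] by (auto simp: cycle_type_def)
  let ?g' = "inv_into (cells L \<nu>) g"
  define w where "w = restrict (\<lambda>x. fst (?g' x)) {..<n}"
  have wg: "w (g p) = fst p" if "p \<in> cells L \<nu>" for p
    using that g bij_betw_apply[OF g(1) that] by (auto simp: w_def bij_betw_inv_into_left)
  have "word_content n w c = \<nu> c" for c
  proof -
    have "{x. x < n \<and> w x = c} = g ` {p \<in> cells L \<nu>. fst p = c}"
    proof
      show "{x. x < n \<and> w x = c} \<subseteq> g ` {p \<in> cells L \<nu>. fst p = c}"
      proof
        fix x assume x: "x \<in> {x. x < n \<and> w x = c}"
        then have "x \<in> g ` cells L \<nu>" using g(1) by (simp add: bij_betw_def)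
        then obtain p where "p \<in> cells L \<nu>" "x = g p" by blast
        then show "x \<in> g ` {p \<in> cells L \<nu>. fst p = c}" using x wg by auto
      qed
      show "g ` {p \<in> cells L \<nu>. fst p = c} \<subseteq> {x. x < n \<and> w x = c}"
        using wg bij_betw_apply[OF g(1)] by auto
    qed
    also have "card \<dots> = card {p \<in> cells L \<nu>. fst p = c}"
      by (rule card_image) (rule inj_on_subset[OF bij_betw_imp_inj_on[OF g(1)]], auto)
    also have "\<dots> = card (if c < L then {..<\<nu> c} else {})"
      by (rule bij_betw_same_card[of snd]) (auto simp: bij_betw_def inj_on_def cells_def image_iff)
    also have "\<dots> = \<nu> c" using \<nu> by (simp add: compositions_def)
    finally show ?thesis by (simp add: word_content_def)
  qed
  then have "w \<in> words n \<nu>" by (auto simp: words_def w_def)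
  moreover have "w \<circ> \<sigma> = w"
  proof
    fix x
    show "(w \<circ> \<sigma>) x = w x"
    proof (cases "x < n")
      case True
      then have "x \<in> g ` cells L \<nu>" using g(1) by (simp add: bij_betw_def)
    then obtain p where p: "p \<in> cells L \<nu>" "x = g p" by blast
      then show ?thesis using g(2) wg rotate_rows_cells by (simp add: rotate_rows_def)
    qed (use \<sigma> in \<open>auto simp: w_def\<close>)
  qed
  ultimately show ?thesis
    using finite_words[OF compositions_zero[OF \<nu>], of n] by (auto simp: fixed_words_def)
qed

section \<open>Counting coverings\<close>

text \<open>Back substitution, from the top of \<open>r\<close> downwards; distinct elements of
  equal rank do not interact. The inverse is recorded to be triangular with nonzero diagonal as
  well, so that the statement can be applied to it in turn.\<close>

lemma triangular_left_inverse:
  fixes M :: "'a \<Rightarrow> 'a \<Rightarrow> real" and r :: "'a \<Rightarrow> nat"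
  assumes fin: "finite A" and diag: "\<forall>x\<in>A. M x x \<noteq> 0"
    and tri: "\<forall>x\<in>A. \<forall>y\<in>A. M x y \<noteq> 0 \<longrightarrow> x \<noteq> y \<longrightarrow> r x < r y"
  shows "\<exists>C. (\<forall>x\<in>A. \<forall>z\<in>A. (\<Sum>y\<in>A. C x y * M y z) = of_bool (x = z)) \<and>
    (\<forall>x\<in>A. C x x \<noteq> 0) \<and> (\<forall>x\<in>A. \<forall>y\<in>A. C x y \<noteq> 0 \<longrightarrow> x \<noteq> y \<longrightarrow> r x < r y)"
proof -
  define P where "P x c \<longleftrightarrow> (\<forall>z\<in>A. (\<Sum>y\<in>A. c y * M y z) = of_bool (x = z)) \<and>
    c x \<noteq> 0 \<and> (\<forall>y\<in>A. c y \<noteq> 0 \<longrightarrow> x \<noteq> y \<longrightarrow> r x < r y)" for x c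
  have "\<exists>c. P x c" if "x \<in> A" for x
    using that
  proof (induction "card {y \<in> A. r x < r y}" arbitrary: x rule: less_induct)
    case less
    have "\<exists>c. P y c" if "y \<in> A" "r x < r y" for y
    proof (rule less(1)[OF _ that(1)], rule psubset_card_mono)
      show "{z \<in> A. r y < r z} \<subset> {y \<in> A. r x < r y}" using that by auto
    qed (use fin in auto)
    then obtain d where d: "\<And>y. y \<in> A \<Longrightarrow> r x < r y \<Longrightarrow> P y (d y)" by metis
    let ?Y = "{y \<in> A. r x < r y}"
    define c where "c y = (of_bool (y = x) - (\<Sum>u\<in>?Y. M x u * d u y)) / M x x" for y
    have dx: "d u y = 0" if "u \<in> ?Y" "y \<in> A" "\<not> r x < r y" for u y
      using d[of u] that by (auto simp: P_def)
    have "P x c" unfolding P_def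
    proof (intro conjI ballI impI)
      fix z assume z: "z \<in> A"
      have "(\<Sum>y\<in>A. c y * M y z) =
          ((\<Sum>y\<in>A. of_bool (y = x) * M y z) - (\<Sum>y\<in>A. (\<Sum>u\<in>?Y. M x u * d u y) * M y z)) / M x x"
        unfolding c_def by (simp add: sum_subtractf[symmetric] sum_divide_distrib left_diff_distrib)
      also have "(\<Sum>y\<in>A. of_bool (y = x) * M y z) = M x z" using less fin by (simp add: of_bool_def if_distrib[of "\<lambda>x. x * _"] cong: if_cong)
      also have "(\<Sum>y\<in>A. (\<Sum>u\<in>?Y. M x u * d u y) * M y z) = (\<Sum>u\<in>?Y. M x u * (\<Sum>y\<in>A. d u y * M y z))"
        by (simp add: sum_distrib_left sum_distrib_right mult.assoc sum.swap[of _ A])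
      also have "\<dots> = (\<Sum>u\<in>?Y. M x u * of_bool (u = z))"
        using d z by (intro sum.cong) (auto simp: P_def)
      also have "\<dots> = (if r x < r z then M x z else 0)"
        using z fin by (simp add: of_bool_def if_distrib[of "\<lambda>x. _ * x"] cong: if_cong)
      also have "(M x z - \<dots>) / M x x = of_bool (x = z)"
        using diag less tri z by auto
      finally show "(\<Sum>y\<in>A. c y * M y z) = of_bool (x = z)" .
    next
      show "c x \<noteq> 0" using dx[of _ x] less diag by (simp add: c_def)
    next
      fix y assume "y \<in> A" "c y \<noteq> 0" "x \<noteq> y"
      moreover have "(\<Sum>u\<in>?Y. M x u * d u y) = 0" if "\<not> r x < r y"
        using dx[of _ y] \<open>y \<in> A\<close> that by (intro sum.neutral) auto
      ultimately show "r x < r y" by (auto simp: c_def)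
    qed
    then show ?case by blast
  qed
  then obtain C where "\<And>x. x \<in> A \<Longrightarrow> P x (C x)" by metis
  then show ?thesis by (intro exI[of _ C]) (auto simp: P_def)
qed

text \<open>If C inverts M from the left and D inverts C from the left, then D = D (C M) = M, so the
  left inverse is two-sided.\<close>

lemma triangular_inverse:
  fixes M :: "'a \<Rightarrow> 'a \<Rightarrow> real" and r :: "'a \<Rightarrow> nat"
  assumes fin: "finite A" and diag: "\<forall>x\<in>A. M x x \<noteq> 0"
    and tri: "\<forall>x\<in>A. \<forall>y\<in>A. M x y \<noteq> 0 \<longrightarrow> x \<noteq> y \<longrightarrow> r x < r y"
  shows "\<exists>C. (\<forall>x\<in>A. \<forall>z\<in>A. (\<Sum>y\<in>A. C x y * M y z) = of_bool (x = z)) \<and>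
    (\<forall>x\<in>A. \<forall>z\<in>A. (\<Sum>y\<in>A. M x y * C y z) = of_bool (x = z))"
proof -
  obtain C where C: "\<forall>x\<in>A. \<forall>z\<in>A. (\<Sum>y\<in>A. C x y * M y z) = of_bool (x = z)"
    "\<forall>x\<in>A. C x x \<noteq> 0" "\<forall>x\<in>A. \<forall>y\<in>A. C x y \<noteq> 0 \<longrightarrow> x \<noteq> y \<longrightarrow> r x < r y"
    using triangular_left_inverse[of A M r, OF fin diag tri] by blast
  from triangular_left_inverse[of A C r, OF fin C(2,3)]
  obtain D where D: "\<forall>x\<in>A. \<forall>z\<in>A. (\<Sum>y\<in>A. D x y * C y z) = of_bool (x = z)"
    by (elim exE conjE)
  have DM: "D x z = M x z" if "x \<in> A" "z \<in> A" for x z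
  proof -
    have "D x z = (\<Sum>u\<in>A. D x u * of_bool (u = z))"
      using that fin by (simp add: of_bool_def if_distrib[of "\<lambda>x. _ * x"] cong: if_cong)
    also have "\<dots> = (\<Sum>u\<in>A. D x u * (\<Sum>y\<in>A. C u y * M y z))" using that C(1) by (intro sum.cong) auto
    also have "\<dots> = (\<Sum>y\<in>A. (\<Sum>u\<in>A. D x u * C u y) * M y z)"
      unfolding sum_distrib_left sum_distrib_right by (subst sum.swap) (simp add: mult.assoc)
    also have "\<dots> = (\<Sum>y\<in>A. of_bool (x = y) * M y z)" using that D by (intro sum.cong) auto
    also have "\<dots> = M x z"
      using that fin by (simp add: of_bool_def if_distrib[of "\<lambda>x. x * _"] cong: if_cong)
    finally show ?thesis .
  qed
  have "(\<Sum>y\<in>A. M x y * C y z) = of_bool (x = z)" if "x \<in> A" "z \<in> A" for x z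
    using D DM that by simp
  then show ?thesis using C(1) by blast
qed

text \<open>The sizes of these sets form the kernel of n! times the projection onto class functions:
  summing a function of \<sigma> against them adds up its values over all conjugates of
  \<rho>.\<close>

definition conjugators :: "nat \<Rightarrow> (nat \<Rightarrow> nat) \<Rightarrow> (nat \<Rightarrow> nat) \<Rightarrow> (nat \<Rightarrow> nat) set" where
  "conjugators n \<sigma> \<rho> = {\<pi>. \<pi> permutes {..<n} \<and> \<rho> = \<pi> \<circ> \<sigma> \<circ> Hilbert_Choice.inv \<pi>}"

lemma finite_permutes [simp]: "finite {\<sigma>. \<sigma> permutes {..<n::nat}}"
  by (simp add: finite_permutations)

lemma foldr_transpositions_permutes:
  "set \<tau>s \<subseteq> transpositions n \<Longrightarrow> foldr (\<circ>) \<tau>s id permutes {..<n}"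
  by (induction \<tau>s) (auto intro: permutes_compose transposition_permutes simp: permutes_id)

lemma transposition_power_lists:
  "transposition_power n k f \<sigma> =
    (\<Sum>\<tau>s | set \<tau>s \<subseteq> transpositions n \<and> length \<tau>s = k. f (\<sigma> \<circ> foldr (\<circ>) \<tau>s id))"
proof (induction k arbitrary: \<sigma>)
  case 0
  have "{\<tau>s :: (nat \<Rightarrow> nat) list. set \<tau>s \<subseteq> transpositions n \<and> length \<tau>s = 0} = {[]}" by auto
  then show ?case by simp
next
  case (Suc k)
  let ?Ls = "{\<tau>s. set \<tau>s \<subseteq> transpositions n \<and> length \<tau>s = k}"
  have "(\<Sum>\<tau>s | set \<tau>s \<subseteq> transpositions n \<and> length \<tau>s = Suc k. f (\<sigma> \<circ> foldr (\<circ>) \<tau>s id)) =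
      (\<Sum>(\<tau>s, \<tau>)\<in>?Ls \<times> transpositions n. f (\<sigma> \<circ> (\<tau> \<circ> foldr (\<circ>) \<tau>s id)))"
    unfolding lists_length_Suc_eq by (subst sum.reindex) (auto simp: inj_on_def split_def)
  also have "\<dots> = (\<Sum>\<tau>\<in>transpositions n. \<Sum>\<tau>s\<in>?Ls. f ((\<sigma> \<circ> \<tau>) \<circ> foldr (\<circ>) \<tau>s id))"
    by (subst sum.swap) (simp add: sum.cartesian_product o_assoc)
  finally show ?case unfolding transposition_power.simps Suc by (rule sym)
qed

lemma transposition_power_linear:
  assumes "\<And>\<rho>. \<rho> permutes {..<n} \<Longrightarrow> f \<rho> = (\<Sum>x\<in>A. a x * g x \<rho>)" "\<sigma> permutes {..<n}"
  shows "transposition_power n k f \<sigma> = (\<Sum>x\<in>A. a x * transposition_power n k (g x) \<sigma>)"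
proof -
  have "transposition_power n k f \<sigma> = (\<Sum>\<tau>s | set \<tau>s \<subseteq> transpositions n \<and> length \<tau>s = k.
      \<Sum>x\<in>A. a x * g x (\<sigma> \<circ> foldr (\<circ>) \<tau>s id))"
    unfolding transposition_power_lists
    by (intro sum.cong refl assms(1)) (auto intro!: permutes_compose foldr_transpositions_permutes assms(2))
  also have "\<dots> = (\<Sum>x\<in>A. a x * transposition_power n k (g x) \<sigma>)"
    unfolding transposition_power_lists sum_distrib_left by (rule sum.swap)
  finally show ?thesis .
qed

text \<open>With \<sigma> the inverse of \<open>\<sigma>\<^sub>2\<close>, the relation says that
  \<open>\<sigma>\<^sub>1\<close> conjugates \<sigma> into \<sigma> times the product of the
  transpositions. Counting the possible \<open>\<sigma>\<^sub>1\<close> evaluates the conjugation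
  kernel, after k multiplications by the sum of transpositions, on its diagonal: a trace.\<close>

lemma card_coverings:
  "real (card (coverings n k)) =
    (\<Sum>\<sigma> | \<sigma> permutes {..<n}. transposition_power n k (\<lambda>\<rho>. real (card (conjugators n \<sigma> \<rho>))) \<sigma>)"
proof -
  let ?S = "{\<sigma>. \<sigma> permutes {..<n}}"
  define Ls where "Ls = {\<tau>s. set \<tau>s \<subseteq> transpositions n \<and> length \<tau>s = k}"
  have finL: "finite Ls" unfolding Ls_def by (rule finite_lists_length_eq) simp
  have finC: "finite (conjugators n \<sigma> \<rho>)" for \<sigma> \<rho>
    by (rule finite_subset[OF _ finite_permutes[of n]]) (auto simp: conjugators_def)
  let ?I = "Hilbert_Choice.inv :: (nat \<Rightarrow> nat) \<Rightarrow> nat \<Rightarrow> nat"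
  have eq: "\<sigma>\<^sub>1 \<circ> \<sigma>\<^sub>2 \<circ> ?I \<sigma>\<^sub>1 \<circ> ?I \<sigma>\<^sub>2 \<circ> g = id \<longleftrightarrow> ?I \<sigma>\<^sub>2 \<circ> g = \<sigma>\<^sub>1 \<circ> ?I \<sigma>\<^sub>2 \<circ> ?I \<sigma>\<^sub>1"
    if "\<sigma>\<^sub>1 permutes {..<n}" "\<sigma>\<^sub>2 permutes {..<n}" for \<sigma>\<^sub>1 \<sigma>\<^sub>2 and g :: "nat \<Rightarrow> nat"
  proof
    note i = permutes_inverses[OF that(1)] permutes_inverses[OF that(2)]
    {
      assume "\<sigma>\<^sub>1 \<circ> \<sigma>\<^sub>2 \<circ> ?I \<sigma>\<^sub>1 \<circ> ?I \<sigma>\<^sub>2 \<circ> g = id"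
      then have e: "\<sigma>\<^sub>1 (\<sigma>\<^sub>2 (?I \<sigma>\<^sub>1 (?I \<sigma>\<^sub>2 (g x)))) = x" for x by (simp add: fun_eq_iff)
      have "?I \<sigma>\<^sub>2 (g x) = \<sigma>\<^sub>1 (?I \<sigma>\<^sub>2 (?I \<sigma>\<^sub>1 x))" for x
        using arg_cong[OF e[of x], of "\<lambda>y. \<sigma>\<^sub>1 (?I \<sigma>\<^sub>2 (?I \<sigma>\<^sub>1 y))"] by (simp add: i)
      then show "?I \<sigma>\<^sub>2 \<circ> g = \<sigma>\<^sub>1 \<circ> ?I \<sigma>\<^sub>2 \<circ> ?I \<sigma>\<^sub>1" by auto
    next
      assume "?I \<sigma>\<^sub>2 \<circ> g = \<sigma>\<^sub>1 \<circ> ?I \<sigma>\<^sub>2 \<circ> ?I \<sigma>\<^sub>1"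
      then have "?I \<sigma>\<^sub>2 (g x) = \<sigma>\<^sub>1 (?I \<sigma>\<^sub>2 (?I \<sigma>\<^sub>1 x))" for x by (simp add: fun_eq_iff)
      then show "\<sigma>\<^sub>1 \<circ> \<sigma>\<^sub>2 \<circ> ?I \<sigma>\<^sub>1 \<circ> ?I \<sigma>\<^sub>2 \<circ> g = id" by (auto simp: fun_eq_iff i)
    }
  qed
  let ?D = "Sigma ?S (\<lambda>\<sigma>. Sigma Ls (\<lambda>\<tau>s. conjugators n \<sigma> (\<sigma> \<circ> foldr (\<circ>) \<tau>s id)))"
  have cov: "(\<sigma>\<^sub>1, \<sigma>\<^sub>2, \<tau>s) \<in> coverings n k \<longleftrightarrow> \<sigma>\<^sub>1 permutes {..<n} \<and> \<sigma>\<^sub>2 permutes {..<n} \<and> \<tau>s \<in> Ls \<and>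
      ?I \<sigma>\<^sub>2 \<circ> foldr (\<circ>) \<tau>s id = \<sigma>\<^sub>1 \<circ> ?I \<sigma>\<^sub>2 \<circ> ?I \<sigma>\<^sub>1" for \<sigma>\<^sub>1 \<sigma>\<^sub>2 \<tau>s
  proof -
    have "(\<forall>\<tau>\<in>set \<tau>s. \<exists>a<n. \<exists>b<n. a \<noteq> b \<and> \<tau> = Transposition.transpose a b) \<longleftrightarrow> set \<tau>s \<subseteq> transpositions n"
      by (auto simp: transpositions_def)
    then show ?thesis unfolding coverings_def Ls_def using eq[of \<sigma>\<^sub>1 \<sigma>\<^sub>2] by auto
  qed
  have inv2: "?I (?I \<sigma>) = \<sigma>" if "\<sigma> permutes {..<n}" for \<sigma>
    using that by (simp add: permutes_bij inv_inv_eq)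
  have "bij_betw (\<lambda>(\<sigma>, \<tau>s, \<pi>). (\<pi>, ?I \<sigma>, \<tau>s)) ?D (coverings n k)"
  proof (rule bij_betw_byWitness[where f' = "\<lambda>(\<sigma>\<^sub>1, \<sigma>\<^sub>2, \<tau>s). (?I \<sigma>\<^sub>2, \<tau>s, \<sigma>\<^sub>1)"])
    show "\<forall>p\<in>?D. (case case p of (\<sigma>, \<tau>s, \<pi>) \<Rightarrow> (\<pi>, ?I \<sigma>, \<tau>s) of (\<sigma>\<^sub>1, \<sigma>\<^sub>2, \<tau>s) \<Rightarrow> (?I \<sigma>\<^sub>2, \<tau>s, \<sigma>\<^sub>1)) = p"
      using inv2 by auto
    show "\<forall>p\<in>coverings n k. (case case p of (\<sigma>\<^sub>1, \<sigma>\<^sub>2, \<tau>s) \<Rightarrow> (?I \<sigma>\<^sub>2, \<tau>s, \<sigma>\<^sub>1) of (\<sigma>, \<tau>s, \<pi>) \<Rightarrow> (\<pi>, ?I \<sigma>, \<tau>s)) = p"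
      using inv2 cov by auto
    show "(\<lambda>(\<sigma>, \<tau>s, \<pi>). (\<pi>, ?I \<sigma>, \<tau>s)) ` ?D \<subseteq> coverings n k"
      using inv2 by (auto simp: cov conjugators_def permutes_inv)
    show "(\<lambda>(\<sigma>\<^sub>1, \<sigma>\<^sub>2, \<tau>s). (?I \<sigma>\<^sub>2, \<tau>s, \<sigma>\<^sub>1)) ` coverings n k \<subseteq> ?D"
      by (auto simp: cov conjugators_def permutes_inv)
  qed
  from bij_betw_same_card[OF this]
  have "card (coverings n k) = (\<Sum>\<sigma>\<in>?S. \<Sum>\<tau>s\<in>Ls. card (conjugators n \<sigma> (\<sigma> \<circ> foldr (\<circ>) \<tau>s id)))"
    using finL finC by simp
  then show ?thesis unfolding transposition_power_lists Ls_def by simp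
qed

lemma class_function_fixed_words:
  assumes "\<sigma> permutes {..<n}" "\<pi> permutes {..<n}"
  shows "fixed_words n \<nu> (\<pi> \<circ> \<sigma> \<circ> Hilbert_Choice.inv \<pi>) = fixed_words n \<nu> \<sigma>"
proof -
  have cont: "word_content n (w \<circ> p) = word_content n w" if "p permutes {..<n}" for p and w :: "nat \<Rightarrow> nat"
  proof
    fix c
    have lt: "p x < n \<longleftrightarrow> x < n" for x using permutes_in_image[OF that, of x] by simp
    have "bij_betw p {x. x < n \<and> (w \<circ> p) x = c} {x. x < n \<and> w x = c}"
      by (rule bij_betw_byWitness[where f' = "Hilbert_Choice.inv p"])
        (use lt permutes_inverses[OF that] permutes_in_image[OF permutes_inv[OF that]] in auto)
    then show "word_content n (w \<circ> p) c = word_content n w c"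
      unfolding word_content_def by (rule bij_betw_same_card)
  qed
  have ext: "w \<circ> p \<in> extensional {..<n}" if "w \<in> extensional {..<n}" "p permutes {..<n}"
    for w :: "nat \<Rightarrow> nat" and p
    using that permutes_not_in[OF that(2)] by (auto simp: extensional_def)
  let ?p = "Hilbert_Choice.inv \<pi>"
  note inv = permutes_inverses[OF assms(2)]
  have "bij_betw (\<lambda>w. w \<circ> \<pi>) {w \<in> words n \<nu>. w \<circ> (\<pi> \<circ> \<sigma> \<circ> ?p) = w} {w \<in> words n \<nu>. w \<circ> \<sigma> = w}"
  proof (rule bij_betw_byWitness[where f' = "\<lambda>w. w \<circ> ?p"])
    show "(\<lambda>w. w \<circ> \<pi>) ` {w \<in> words n \<nu>. w \<circ> (\<pi> \<circ> \<sigma> \<circ> ?p) = w} \<subseteq> {w \<in> words n \<nu>. w \<circ> \<sigma> = w}"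
    proof clarify
      fix w assume w: "w \<in> words n \<nu>" "w \<circ> (\<pi> \<circ> \<sigma> \<circ> ?p) = w"
      have "w (\<pi> (\<sigma> x)) = w (\<pi> x)" for x using fun_cong[OF w(2), of "\<pi> x"] by (simp add: inv)
      then show "w \<circ> \<pi> \<in> words n \<nu> \<and> w \<circ> \<pi> \<circ> \<sigma> = w \<circ> \<pi>"
        using w cont[OF assms(2)] ext[OF _ assms(2)] by (auto simp: words_def)
    qed
    show "(\<lambda>w. w \<circ> ?p) ` {w \<in> words n \<nu>. w \<circ> \<sigma> = w} \<subseteq> {w \<in> words n \<nu>. w \<circ> (\<pi> \<circ> \<sigma> \<circ> ?p) = w}"
    proof clarify
      fix w assume w: "w \<in> words n \<nu>" "w \<circ> \<sigma> = w"
      have "w (\<sigma> x) = w x" for x using fun_cong[OF w(2), of x] by simp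
      then show "w \<circ> ?p \<in> words n \<nu> \<and> w \<circ> ?p \<circ> (\<pi> \<circ> \<sigma> \<circ> ?p) = w \<circ> ?p"
        using w cont[OF permutes_inv[OF assms(2)]] ext[OF _ permutes_inv[OF assms(2)]]
        by (auto simp: words_def inv)
    qed
  qed (auto simp: fun_eq_iff inv)
  then show ?thesis unfolding fixed_words_def by (rule bij_betw_same_card)
qed

lemma class_function_conjugators:
  assumes "\<rho> permutes {..<n}" "\<pi> permutes {..<n}"
  shows "card (conjugators n \<sigma> (\<pi> \<circ> \<rho> \<circ> Hilbert_Choice.inv \<pi>)) = card (conjugators n \<sigma> \<rho>)"
proof -
  let ?p = "Hilbert_Choice.inv \<pi>"
  note inv = permutes_inverses[OF assms(2)]
  have io: "Hilbert_Choice.inv (\<alpha> \<circ> \<beta>) = Hilbert_Choice.inv \<beta> \<circ> Hilbert_Choice.inv \<alpha>"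
    if "\<alpha> permutes {..<n}" "\<beta> permutes {..<n}" for \<alpha> \<beta>
    using that by (intro o_inv_distrib permutes_bij)
  have ii: "Hilbert_Choice.inv ?p = \<pi>" using assms(2) by (simp add: permutes_bij inv_inv_eq)
  have "bij_betw (\<lambda>\<alpha>. ?p \<circ> \<alpha>) (conjugators n \<sigma> (\<pi> \<circ> \<rho> \<circ> ?p)) (conjugators n \<sigma> \<rho>)"
  proof (rule bij_betw_byWitness[where f' = "\<lambda>\<alpha>. \<pi> \<circ> \<alpha>"])
    show "(\<lambda>\<alpha>. ?p \<circ> \<alpha>) ` conjugators n \<sigma> (\<pi> \<circ> \<rho> \<circ> ?p) \<subseteq> conjugators n \<sigma> \<rho>"
    proof clarify
      fix \<alpha> assume "\<alpha> \<in> conjugators n \<sigma> (\<pi> \<circ> \<rho> \<circ> ?p)"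
      then have \<alpha>: "\<alpha> permutes {..<n}" and e: "\<pi> \<circ> \<rho> \<circ> ?p = \<alpha> \<circ> \<sigma> \<circ> Hilbert_Choice.inv \<alpha>"
        by (auto simp: conjugators_def)
      have "\<rho> x = ?p (\<alpha> (\<sigma> (Hilbert_Choice.inv \<alpha> (\<pi> x))))" for x
        using arg_cong[OF fun_cong[OF e, of "\<pi> x"], of ?p] by (simp add: inv)
      then show "?p \<circ> \<alpha> \<in> conjugators n \<sigma> \<rho>"
        using \<alpha> assms(2) io[OF permutes_inv[OF assms(2)] \<alpha>]
        by (auto simp: conjugators_def ii intro: permutes_compose permutes_inv)
    qed
    show "(\<lambda>\<alpha>. \<pi> \<circ> \<alpha>) ` conjugators n \<sigma> \<rho> \<subseteq> conjugators n \<sigma> (\<pi> \<circ> \<rho> \<circ> ?p)"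
    proof clarify
      fix \<alpha> assume "\<alpha> \<in> conjugators n \<sigma> \<rho>"
      then have \<alpha>: "\<alpha> permutes {..<n}" and e: "\<rho> = \<alpha> \<circ> \<sigma> \<circ> Hilbert_Choice.inv \<alpha>"
        by (auto simp: conjugators_def)
      show "\<pi> \<circ> \<alpha> \<in> conjugators n \<sigma> (\<pi> \<circ> \<rho> \<circ> ?p)"
        unfolding conjugators_def mem_Collect_eq io[OF assms(2) \<alpha>] e
        using permutes_compose[OF \<alpha> assms(2)] by (simp add: o_assoc)
    qed
  qed (auto simp: fun_eq_iff inv)
  then show ?thesis by (rule bij_betw_same_card)
qed

text \<open>For n \<le> L every cycle type is a partition with at most L parts, so the characters
  \<open>fixed_words\<close> are as many as the classes and, by dominance, a basis of class
  functions. The kernel is expanded in this basis; its coefficients \<open>l\<close> form, up to n!,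
  the dual basis, and only the diagonal entries survive in the trace.\<close>

theorem card_coverings_eq_sum_content:
  assumes L: "n \<le> L"
  shows "real (card (coverings n k)) = fact n * (\<Sum>\<nu>\<in>partitions L n. total_content L \<nu> ^ k)"
proof -
  let ?\<Lambda> = "partitions L n" and ?S = "{\<sigma>. \<sigma> permutes {..<n}}"
  let ?U = "\<lambda>\<nu> \<sigma>. real (fixed_words n \<nu> \<sigma>)"
  let ?F = "\<lambda>\<sigma> \<rho>. real (card (conjugators n \<sigma> \<rho>))"
  have "\<forall>\<nu>\<in>?\<Lambda>. \<exists>\<sigma>. cycle_type L n \<nu> \<sigma>" using cycle_type_exists[OF partitions_subset] by blast
  from bchoice[OF this] obtain s where "\<forall>\<nu>\<in>?\<Lambda>. cycle_type L n \<nu> (s \<nu>)" ..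
  then have s: "cycle_type L n \<nu> (s \<nu>)" if "\<nu> \<in> ?\<Lambda>" for \<nu> using that by blast
  have sp: "s \<nu> permutes {..<n}" if "\<nu> \<in> ?\<Lambda>" for \<nu> using s[OF that] by (simp add: cycle_type_def)
  define M where "M \<mu> \<nu> = ?U \<nu> (s \<mu>)" for \<mu> \<nu>
  \<comment> \<open>a linear function strictly increasing in the dominance order\<close>
  define r where "r \<nu> = (\<Sum>m\<le>L. sum \<nu> {..<m})" for \<nu> :: "nat \<Rightarrow> nat"
  have diag: "M \<nu> \<nu> \<noteq> 0" if "\<nu> \<in> ?\<Lambda>" for \<nu>
    using fixed_words_diag_pos[OF s[OF that] partitions_subset[OF that]] by (simp add: M_def)
  have tri: "r \<mu> < r \<nu>" if "\<mu> \<in> ?\<Lambda>" "\<nu> \<in> ?\<Lambda>" "M \<mu> \<nu> \<noteq> 0" "\<mu> \<noteq> \<nu>" for \<mu> \<nu>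
  proof -
    have le: "sum \<mu> {..<m} \<le> sum \<nu> {..<m}" if "m \<le> L" for m
      using fixed_words_dominance[OF s _ _ that, of \<mu> \<nu>] \<open>\<mu> \<in> ?\<Lambda>\<close> \<open>\<nu> \<in> ?\<Lambda>\<close> \<open>M \<mu> \<nu> \<noteq> 0\<close>
      by (simp add: M_def partitions_def)
    have "\<exists>m\<le>L. sum \<mu> {..<m} \<noteq> sum \<nu> {..<m}"
    proof (rule ccontr)
      assume "\<not> ?thesis"
      then have e: "sum \<mu> {..<m} = sum \<nu> {..<m}" if "m \<le> L" for m using that by blast
      have "\<mu> c = \<nu> c" for c
      proof (cases "c < L")
        case True
        then show ?thesis using e[of c] e[of "Suc c"] by simp
      next
        case False
        then show ?thesis using that by (simp add: partitions_def compositions_def)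
      qed
      then show False using \<open>\<mu> \<noteq> \<nu>\<close> by auto
    qed
    then obtain m where "m \<le> L" "sum \<mu> {..<m} < sum \<nu> {..<m}" using le by (metis le_neq_implies_less)
    then show ?thesis unfolding r_def using le by (intro sum_strict_mono_ex1) auto
  qed
  have "\<forall>\<nu>\<in>?\<Lambda>. M \<nu> \<nu> \<noteq> 0" "\<forall>\<mu>\<in>?\<Lambda>. \<forall>\<nu>\<in>?\<Lambda>. M \<mu> \<nu> \<noteq> 0 \<longrightarrow> \<mu> \<noteq> \<nu> \<longrightarrow> r \<mu> < r \<nu>"
    using diag tri by blast+
  from triangular_inverse[OF finite_partitions this]
  obtain B where B: "\<forall>x\<in>?\<Lambda>. \<forall>z\<in>?\<Lambda>. (\<Sum>y\<in>?\<Lambda>. B x y * M y z) = of_bool (x = z)"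
    "\<forall>x\<in>?\<Lambda>. \<forall>z\<in>?\<Lambda>. (\<Sum>y\<in>?\<Lambda>. M x y * B y z) = of_bool (x = z)"
    by (elim exE conjE)
  define l where "l \<nu> \<sigma> = (\<Sum>\<mu>\<in>?\<Lambda>. B \<nu> \<mu> * ?F \<sigma> (s \<mu>))" for \<nu> \<sigma>
  \<comment> \<open>Both sides are class functions of \<rho>, so it suffices to compare them at the
    representatives \<open>s \<mu>\<close>, where \<open>B\<close> inverts \<open>M\<close> from the
    right.\<close>
  have expand: "?F \<sigma> \<rho> = (\<Sum>\<nu>\<in>?\<Lambda>. l \<nu> \<sigma> * ?U \<nu> \<rho>)" if \<rho>: "\<rho> permutes {..<n}" for \<sigma> \<rho>
  proof -
    obtain \<mu> where \<mu>: "\<mu> \<in> ?\<Lambda>" "cycle_type L n \<mu> \<rho>" using permutation_has_cycle_type[OF \<rho> L] by blast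
    obtain \<pi> where \<pi>: "\<pi> permutes {..<n}" "\<rho> = \<pi> \<circ> s \<mu> \<circ> Hilbert_Choice.inv \<pi>"
      using cycle_type_conjugate[OF s[OF \<mu>(1)] \<mu>(2)] by blast
    have "(\<Sum>\<nu>\<in>?\<Lambda>. l \<nu> \<sigma> * ?U \<nu> (s \<mu>)) = (\<Sum>\<kappa>\<in>?\<Lambda>. (\<Sum>\<nu>\<in>?\<Lambda>. M \<mu> \<nu> * B \<nu> \<kappa>) * ?F \<sigma> (s \<kappa>))"
      unfolding l_def M_def sum_distrib_right by (subst sum.swap) (simp add: mult_ac)
    also have "\<dots> = (\<Sum>\<kappa>\<in>?\<Lambda>. of_bool (\<mu> = \<kappa>) * ?F \<sigma> (s \<kappa>))" using B(2) \<mu> by (intro sum.cong) auto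
    also have "\<dots> = ?F \<sigma> (s \<mu>)"
      using \<mu> by (simp add: of_bool_def if_distrib[of "\<lambda>x. x * _"] cong: if_cong)
    finally show ?thesis
      unfolding \<pi>(2) using class_function_conjugators[OF sp \<pi>(1)] class_function_fixed_words[OF sp \<pi>(1)] \<mu>(1) by simp
  qed
  \<comment> \<open>The kernel reproduces the character of \<mu> up to n!; inserting this into the
    definition of \<open>l\<close> leaves the product of \<open>B\<close> and \<open>M\<close>, the
    identity matrix.\<close>
  have dual: "(\<Sum>\<sigma>\<in>?S. l \<nu> \<sigma> * ?U \<mu> \<sigma>) = fact n * of_bool (\<nu> = \<mu>)" if "\<nu> \<in> ?\<Lambda>" "\<mu> \<in> ?\<Lambda>" for \<nu> \<mu>
  proof -
    have inner: "(\<Sum>\<sigma>\<in>?S. ?F \<sigma> \<rho> * ?U \<mu> \<sigma>) = fact n * ?U \<mu> \<rho>" if \<rho>: "\<rho> permutes {..<n}" for \<rho>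
    proof -
      have F: "?F \<sigma> \<rho> = (\<Sum>\<pi>\<in>?S. of_bool (Hilbert_Choice.inv \<pi> \<circ> \<rho> \<circ> \<pi> = \<sigma>))" if "\<sigma> permutes {..<n}" for \<sigma>
      proof -
        have "\<rho> = \<pi> \<circ> \<sigma> \<circ> Hilbert_Choice.inv \<pi> \<longleftrightarrow> Hilbert_Choice.inv \<pi> \<circ> \<rho> \<circ> \<pi> = \<sigma>"
          if "\<pi> permutes {..<n}" for \<pi>
          using permutes_inverses[OF that] by (auto simp: fun_eq_iff) metis
        then have "conjugators n \<sigma> \<rho> = {\<pi> \<in> ?S. Hilbert_Choice.inv \<pi> \<circ> \<rho> \<circ> \<pi> = \<sigma>}"
          by (auto simp: conjugators_def)
        then show ?thesis by (simp add: of_bool_def sum.If_cases Int_def)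
      qed
      have "(\<Sum>\<sigma>\<in>?S. ?F \<sigma> \<rho> * ?U \<mu> \<sigma>) =
          (\<Sum>\<pi>\<in>?S. \<Sum>\<sigma>\<in>?S. of_bool (Hilbert_Choice.inv \<pi> \<circ> \<rho> \<circ> \<pi> = \<sigma>) * ?U \<mu> \<sigma>)"
        by (subst sum.swap) (simp add: F sum_distrib_right)
      also have "\<dots> = (\<Sum>\<pi>\<in>?S. ?U \<mu> \<rho>)"
      proof (rule sum.cong)
        fix \<pi> assume "\<pi> \<in> ?S"
        then have \<pi>: "\<pi> permutes {..<n}" by simp
        let ?\<sigma> = "Hilbert_Choice.inv \<pi> \<circ> \<rho> \<circ> \<pi>"
        have in_S: "?\<sigma> \<in> ?S" using \<pi> \<rho> by (auto intro: permutes_compose permutes_inv)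
        have "(\<Sum>\<sigma>\<in>?S. of_bool (?\<sigma> = \<sigma>) * ?U \<mu> \<sigma>) = ?U \<mu> ?\<sigma>"
          using in_S by (simp add: of_bool_def if_distrib[of "\<lambda>x. x * _"] cong: if_cong)
        also have "\<dots> = ?U \<mu> \<rho>"
          using class_function_fixed_words[OF \<rho> permutes_inv[OF \<pi>], of \<mu>] \<pi> by (simp add: permutes_bij inv_inv_eq)
        finally show "(\<Sum>\<sigma>\<in>?S. of_bool (?\<sigma> = \<sigma>) * ?U \<mu> \<sigma>) = ?U \<mu> \<rho>" .
      qed simp
      also have "\<dots> = fact n * ?U \<mu> \<rho>" by (simp add: card_permutations[of "{..<n}" n])
      finally show ?thesis .
    qed
    have "(\<Sum>\<sigma>\<in>?S. l \<nu> \<sigma> * ?U \<mu> \<sigma>) = (\<Sum>\<kappa>\<in>?\<Lambda>. B \<nu> \<kappa> * (\<Sum>\<sigma>\<in>?S. ?F \<sigma> (s \<kappa>) * ?U \<mu> \<sigma>))"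
      unfolding l_def sum_distrib_right sum_distrib_left by (subst sum.swap) (simp add: mult_ac)
    also have "\<dots> = (\<Sum>\<kappa>\<in>?\<Lambda>. B \<nu> \<kappa> * (fact n * M \<kappa> \<mu>))"
      by (intro sum.cong refl) (simp add: inner[OF sp] M_def)
    also have "\<dots> = fact n * of_bool (\<nu> = \<mu>)"
      using B(1) that by (simp add: sum_distrib_left[symmetric] mult.left_commute)
    finally show ?thesis .
  qed
  have main: "(\<Sum>\<sigma>\<in>?S. l \<nu> \<sigma> * transposition_power n k (?U \<nu>) \<sigma>) = fact n * total_content L \<nu> ^ k"
    if \<nu>: "\<nu> \<in> ?\<Lambda>" for \<nu>
  proof -
    let ?A = "{\<mu>. \<mu> \<in> ?\<Lambda> \<and> sum_squares L \<nu> < sum_squares L \<mu>}"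
    obtain a where a: "\<And>\<sigma>. \<sigma> permutes {..<n} \<Longrightarrow>
       transposition_power n k (?U \<nu>) \<sigma> - total_content L \<nu> ^ k * ?U \<nu> \<sigma> = (\<Sum>\<mu>\<in>?A. a \<mu> * ?U \<mu> \<sigma>)"
      using transposition_power_triangular[OF \<nu>, of k] unfolding in_span_def by blast
    have "(\<Sum>\<sigma>\<in>?S. l \<nu> \<sigma> * transposition_power n k (?U \<nu>) \<sigma>) =
        (\<Sum>\<sigma>\<in>?S. l \<nu> \<sigma> * (total_content L \<nu> ^ k * ?U \<nu> \<sigma> + (\<Sum>\<mu>\<in>?A. a \<mu> * ?U \<mu> \<sigma>)))"
    proof (rule sum.cong)
      fix \<sigma> assume "\<sigma> \<in> ?S"
      then show "l \<nu> \<sigma> * transposition_power n k (?U \<nu>) \<sigma> =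
          l \<nu> \<sigma> * (total_content L \<nu> ^ k * ?U \<nu> \<sigma> + (\<Sum>\<mu>\<in>?A. a \<mu> * ?U \<mu> \<sigma>))"
        using a[of \<sigma>] by (simp add: algebra_simps)
    qed simp
    also have "\<dots> = total_content L \<nu> ^ k * (\<Sum>\<sigma>\<in>?S. l \<nu> \<sigma> * ?U \<nu> \<sigma>) +
        (\<Sum>\<mu>\<in>?A. a \<mu> * (\<Sum>\<sigma>\<in>?S. l \<nu> \<sigma> * ?U \<mu> \<sigma>))"
      by (simp add: distrib_left sum.distrib sum_distrib_left sum.swap[of _ ?A ?S] mult_ac)
    \<comment> \<open>Terms strictly above \<nu> differ from \<nu>, so duality removes them.\<close>
    also have "(\<Sum>\<mu>\<in>?A. a \<mu> * (\<Sum>\<sigma>\<in>?S. l \<nu> \<sigma> * ?U \<mu> \<sigma>)) = 0"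
      using dual[OF \<nu>] by (intro sum.neutral) auto
    finally show ?thesis using dual[OF \<nu> \<nu>] by simp
  qed
  have "real (card (coverings n k)) = (\<Sum>\<sigma>\<in>?S. \<Sum>\<nu>\<in>?\<Lambda>. l \<nu> \<sigma> * transposition_power n k (?U \<nu>) \<sigma>)"
    unfolding card_coverings
    by (intro sum.cong refl transposition_power_linear expand) auto
  also have "\<dots> = (\<Sum>\<nu>\<in>?\<Lambda>. \<Sum>\<sigma>\<in>?S. l \<nu> \<sigma> * transposition_power n k (?U \<nu>) \<sigma>)" by (rule sum.swap)
  also have "\<dots> = fact n * (\<Sum>\<nu>\<in>?\<Lambda>. total_content L \<nu> ^ k)" by (simp add: main sum_distrib_left)
  finally show ?thesis .
qed

section \<open>Integrals over coverings\<close>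

text \<open>A commutator is even, while a product of k transpositions has sign (-1)^k.\<close>

lemma coverings_odd_empty:
  assumes "odd k"
  shows "coverings n k = {}"
proof (rule ccontr)
  assume "coverings n k \<noteq> {}"
  then obtain \<sigma>\<^sub>1 \<sigma>\<^sub>2 \<tau>s where "(\<sigma>\<^sub>1, \<sigma>\<^sub>2, \<tau>s) \<in> coverings n k" by auto
  then have p: "\<sigma>\<^sub>1 permutes {..<n}" "\<sigma>\<^sub>2 permutes {..<n}" "length \<tau>s = k" "set \<tau>s \<subseteq> transpositions n"
    and e: "\<sigma>\<^sub>1 \<circ> \<sigma>\<^sub>2 \<circ> Hilbert_Choice.inv \<sigma>\<^sub>1 \<circ> Hilbert_Choice.inv \<sigma>\<^sub>2 \<circ> foldr (\<circ>) \<tau>s id = id"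
    by (auto simp: coverings_def transpositions_def)
  have perm: "permutation \<pi>" if "\<pi> permutes {..<n}" for \<pi>
    using that by (auto simp: permutation_permutes)
  have "sign (foldr (\<circ>) \<tau>s id) = (-1) ^ length \<tau>s" using p(4)
  proof (induction \<tau>s)
    case (Cons \<tau> \<tau>s)
    have "sign \<tau> = -1" using Cons by (auto simp: transpositions_def sign_swap_id)
    moreover have "permutation \<tau>" "permutation (foldr (\<circ>) \<tau>s id)"
      using Cons(2) by (auto intro!: perm intro: transposition_permutes foldr_transpositions_permutes)
    moreover have "foldr (\<circ>) (\<tau> # \<tau>s) id = \<tau> \<circ> foldr (\<circ>) \<tau>s id" by simp
    moreover have "sign (foldr (\<circ>) \<tau>s id) = (-1) ^ length \<tau>s" using Cons by (meson list.set_intros(2) subset_iff)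
    ultimately show ?case using sign_compose[of \<tau> "foldr (\<circ>) \<tau>s id"] by (simp only: list.size power_Suc) simp
  qed simp
  moreover have "sign (\<sigma>\<^sub>1 \<circ> \<sigma>\<^sub>2 \<circ> Hilbert_Choice.inv \<sigma>\<^sub>1 \<circ> Hilbert_Choice.inv \<sigma>\<^sub>2 \<circ> foldr (\<circ>) \<tau>s id) =
      sign (foldr (\<circ>) \<tau>s id)"
  proof -
    have "sign \<sigma>\<^sub>1 * sign \<sigma>\<^sub>2 * sign \<sigma>\<^sub>1 * sign \<sigma>\<^sub>2 = 1"
      using sign_idempotent[of "\<sigma>\<^sub>1"] sign_idempotent[of "\<sigma>\<^sub>2"] by (metis mult.assoc mult.commute mult_1)
    then show ?thesis
      using p foldr_transpositions_permutes[OF p(4)]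
      by (simp add: sign_compose sign_inverse perm permutes_inv permutes_compose permutation_compose)
  qed
  ultimately show False using e assms p(3) by simp
qed

text \<open>Transposing a partition negates its content; here the resulting cancellation is read off
  from the absence of coverings with an odd number of branch points.\<close>

lemma sum_content_odd_zero:
  assumes "n \<le> L" "odd k"
  shows "(\<Sum>\<nu>\<in>partitions L n. total_content L \<nu> ^ k) = 0"
  using card_coverings_eq_sum_content[OF assms(1), of k] coverings_odd_empty[OF assms(2), of n] by simp

lemma finite_coverings: "finite (coverings n k)"
proof (rule finite_subset)
  show "coverings n k \<subseteq> {\<sigma>. \<sigma> permutes {..<n}} \<times> {\<sigma>. \<sigma> permutes {..<n}} \<times>
      {\<tau>s. set \<tau>s \<subseteq> transpositions n \<and> length \<tau>s = k}"
    by (auto simp: coverings_def transpositions_def)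
qed (auto intro!: finite_cartesian_product finite_lists_length_eq)

lemma equiv_covering_equivalence: "equiv (coverings n k) (covering_equivalence n k)"
proof (rule equivI)
  show "covering_equivalence n k \<subseteq> coverings n k \<times> coverings n k"
    by (auto simp: covering_equivalence_def)
  show "refl_on (coverings n k) (covering_equivalence n k)"
  proof (rule refl_onI)
    fix X assume "X \<in> coverings n k"
    moreover have "X = conjugate_monodromy id X"
      by (cases X) (simp add: conjugate_monodromy_def)
    ultimately show "(X, X) \<in> covering_equivalence n k"
      by (auto simp: covering_equivalence_def intro!: exI[of _ id] permutes_id)
  qed
  show "sym (covering_equivalence n k)"
  proof (rule symI)
    fix X Y assume "(X, Y) \<in> covering_equivalence n k"
    then obtain \<pi> where *: "X \<in> coverings n k" "Y \<in> coverings n k" "\<pi> permutes {..<n}" "Y = conjugate_monodromy \<pi> X"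
      by (auto simp: covering_equivalence_def)
    have "X = conjugate_monodromy (Hilbert_Choice.inv \<pi>) Y"
      unfolding *(4) conjugate_monodromy_def using permutes_inverses[OF *(3)] permutes_inv_inv[OF *(3)]
      by (cases X) (auto simp: fun_eq_iff o_def intro!: map_idI[symmetric])
    then show "(Y, X) \<in> covering_equivalence n k"
      using * permutes_inv[OF *(3)] by (auto simp: covering_equivalence_def)
  qed
  show "trans (covering_equivalence n k)"
  proof (rule transI)
    fix X Y Z assume "(X, Y) \<in> covering_equivalence n k" "(Y, Z) \<in> covering_equivalence n k"
    then obtain \<pi> \<rho> where *: "X \<in> coverings n k" "Z \<in> coverings n k" "\<pi> permutes {..<n}" "\<rho> permutes {..<n}"
        "Z = conjugate_monodromy \<rho> (conjugate_monodromy \<pi> X)"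
      by (auto simp: covering_equivalence_def)
    have "Hilbert_Choice.inv (\<rho> \<circ> \<pi>) = Hilbert_Choice.inv \<pi> \<circ> Hilbert_Choice.inv \<rho>"
      using * by (intro o_inv_distrib permutes_bij)
    then have "Z = conjugate_monodromy (\<rho> \<circ> \<pi>) X"
      unfolding *(5) conjugate_monodromy_def by (cases X) (auto simp: o_assoc)
    then show "(X, Z) \<in> covering_equivalence n k"
      using * permutes_compose[OF *(3,4)] by (auto simp: covering_equivalence_def)
  qed
qed

lemma finite_hurwitz_space: "finite (hurwitz_space n k)"
  unfolding hurwitz_space_def
  by (rule finite_quotient[OF finite_coverings]) (auto simp: covering_equivalence_def)

lemma sum_card_hurwitz_space: "(\<Sum>c\<in>hurwitz_space n k. card c) = card (coverings n k)"
proof -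
  have "card (\<Union> (hurwitz_space n k)) = (\<Sum>c\<in>hurwitz_space n k. card c)"
  proof (rule card_Union_disjoint)
    show "disjoint (hurwitz_space n k)"
      using quotient_disj[OF equiv_covering_equivalence]
      unfolding hurwitz_space_def pairwise_def disjnt_def by blast
    fix c assume "c \<in> hurwitz_space n k"
    then show "finite c"
      using finite_subset[OF in_quotient_imp_subset[OF equiv_covering_equivalence] finite_coverings]
      by (simp add: hurwitz_space_def)
  qed
  then show ?thesis
    unfolding hurwitz_space_def Union_quotient[OF equiv_covering_equivalence] by simp
qed

lemma countable_covering_classes: "countable covering_classes"
proof (rule countable_subset)
  show "covering_classes \<subseteq> Sigma UNIV (\<lambda>n. Sigma UNIV (\<lambda>m. hurwitz_space n m))"
    by (auto simp: covering_classes_def)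
  show "countable (Sigma UNIV (\<lambda>n. Sigma UNIV (\<lambda>m. hurwitz_space n m)))"
    by (intro countable_SIGMA) (auto intro: countable_finite finite_hurwitz_space)
qed

definition hurwitz_density :: "real \<Rightarrow> nat \<times> nat \<times> monodromy set \<Rightarrow> real" where
  "hurwitz_density t X = (case X of (n, m, c) \<Rightarrow> exp (- t / 2) ^ n * (t ^ m / fact m) * cover_weight (n, m, c))"

lemma hurwitz_measure_density:
  "hurwitz_measure t = density (count_space covering_classes) (hurwitz_density t)"
  by (simp add: hurwitz_measure_def point_measure_def hurwitz_density_def split_def)

text \<open>Countably many atoms of finite mass; this is what Fubini needs in the case of two
  coverings.\<close>

lemma sigma_finite_hurwitz_measure: "sigma_finite_measure (hurwitz_measure t)"
proof -
  interpret sigma_finite_measure "count_space covering_classes"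
    by (rule sigma_finite_measure_count_space_countable[OF countable_covering_classes])
  show ?thesis
    unfolding hurwitz_measure_density
    using sigma_finite_iff_density_finite[of "\<lambda>X. ennreal (hurwitz_density t X)"] by simp
qed

lemma hurwitz_density_nonneg:
  assumes "X \<in> covering_classes" "t > 0" shows "0 \<le> hurwitz_density t X"
  using assms by (auto simp: hurwitz_density_def covering_classes_def cover_weight_def)

lemma integral_hurwitz_measure:
  fixes f :: "nat \<times> nat \<times> monodromy set \<Rightarrow> real"
  assumes t: "t > 0" and f: "\<And>X. 0 \<le> f X"
    and S: "((\<lambda>X. hurwitz_density t X * f X) has_sum S) covering_classes"
  shows "integrable (hurwitz_measure t) f" "integral\<^sup>L (hurwitz_measure t) f = S"
proof -
  have nn: "0 \<le> hurwitz_density t X * f X" if "X \<in> covering_classes" for X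
    using hurwitz_density_nonneg[OF that t] f by simp
  have "(\<lambda>X. norm (hurwitz_density t X * f X)) summable_on covering_classes"
    using has_sum_imp_summable[OF S] nn by (subst summable_on_cong[of _ _ "\<lambda>X. hurwitz_density t X * f X"]) auto
  then have abs: "Infinite_Set_Sum.abs_summable_on (\<lambda>X. hurwitz_density t X * f X) covering_classes"
    by (rule abs_summable_equivalent[THEN iffD1])
  have AE: "AE x in count_space covering_classes. 0 \<le> hurwitz_density t x"
    by (auto simp: AE_count_space hurwitz_density_nonneg t)
  show "integrable (hurwitz_measure t) f"
    unfolding hurwitz_measure_density
    using abs by (subst integrable_density) (auto simp: AE abs_summable_on_def)
  have "integral\<^sup>L (hurwitz_measure t) f = infsetsum (\<lambda>X. hurwitz_density t X * f X) covering_classes"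
    unfolding hurwitz_measure_density infsetsum_def
    by (subst integral_density) (auto simp: AE)
  also have "\<dots> = S" using infsetsum_infsum[OF abs] infsumI[OF S] by simp
  finally show "integral\<^sup>L (hurwitz_measure t) f = S" .
qed

definition degree_slice :: "nat \<Rightarrow> nat \<Rightarrow> nat \<times> nat \<times> monodromy set \<Rightarrow> real" where
  "degree_slice N n X = of_bool (cover_deg X = n) * real N powi cover_euler X"

lemma degree_slice_nonneg: "0 \<le> degree_slice N n X"
  by (simp add: degree_slice_def)

text \<open>This will be the integral of \<open>degree_slice\<close>. \<open>L\<close> caps the
  number of parts and is free as long as n \<le> L, so that the length dictated by the group can be
  inserted.\<close>

definition slice_mass :: "nat \<Rightarrow> real \<Rightarrow> nat \<Rightarrow> nat \<Rightarrow> real" where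
  "slice_mass L t N n = exp (- t / 2) ^ n * (\<Sum>\<nu>\<in>partitions L n. exp (- (t * total_content L \<nu> / real N)))"

lemma has_sum_finite_sum:
  fixes f :: "'a \<Rightarrow> 'b \<Rightarrow> real"
  assumes "finite A" "\<And>x. x \<in> A \<Longrightarrow> (f x has_sum S x) B"
  shows "((\<lambda>y. \<Sum>x\<in>A. f x y) has_sum (\<Sum>x\<in>A. S x)) B"
  using assms by (induction A rule: finite_induct) (auto intro: has_sum_add)

lemma has_sum_exponential_contents:
  assumes "n \<le> L"
  shows "((\<lambda>m. s ^ m / fact m * (\<Sum>\<nu>\<in>partitions L n. total_content L \<nu> ^ m)) has_sum
    (\<Sum>\<nu>\<in>partitions L n. exp (- (s * total_content L \<nu>)))) {m. even m}"
proof -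
  have "((\<lambda>m. \<Sum>\<nu>\<in>partitions L n. (- (s * total_content L \<nu>)) ^ m / fact m) has_sum
    (\<Sum>\<nu>\<in>partitions L n. exp (- (s * total_content L \<nu>)))) UNIV"
  proof (intro has_sum_finite_sum norm_summable_imp_has_sum)
    fix \<nu>
    show "summable (\<lambda>m. norm ((- (s * total_content L \<nu>)) ^ m / fact m))"
      using summable_norm_exp[of "- (s * total_content L \<nu>)"] by (simp add: divide_inverse mult.commute)
    show "(\<lambda>m. (- (s * total_content L \<nu>)) ^ m / fact m) sums exp (- (s * total_content L \<nu>))"
      using exp_converges[of "- (s * total_content L \<nu>)"] by (simp add: divide_inverse mult.commute)
  qed simp
  moreover have "(\<Sum>\<nu>\<in>partitions L n. (- (s * total_content L \<nu>)) ^ m / fact m) =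
      (- s) ^ m / fact m * (\<Sum>\<nu>\<in>partitions L n. total_content L \<nu> ^ m)" for m
  proof -
    have "(- (s * x)) ^ m = (- s) ^ m * x ^ m" for x by (simp add: power_mult_distrib[symmetric])
    then show ?thesis by (simp add: sum_distrib_left)
  qed
  ultimately have "((\<lambda>m. (- s) ^ m / fact m * (\<Sum>\<nu>\<in>partitions L n. total_content L \<nu> ^ m)) has_sum
    (\<Sum>\<nu>\<in>partitions L n. exp (- (s * total_content L \<nu>)))) UNIV" by simp
  \<comment> \<open>Odd powers have coefficient zero, so the full exponential series lives on the
    even m, where the sign of s does not matter either.\<close>
  moreover have "((\<lambda>m. (- s) ^ m / fact m * (\<Sum>\<nu>\<in>partitions L n. total_content L \<nu> ^ m)) has_sum S) UNIV \<longleftrightarrow>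
      ((\<lambda>m. s ^ m / fact m * (\<Sum>\<nu>\<in>partitions L n. total_content L \<nu> ^ m)) has_sum S) {m. even m}" for S
    by (rule has_sum_cong_neutral) (auto simp: sum_content_odd_zero[OF assms])
  ultimately show ?thesis by simp
qed

lemma integral_degree_slice:
  assumes t: "t > 0" and N: "N \<ge> 1" and L: "n \<le> L"
  shows "integrable (hurwitz_measure t) (degree_slice N n)"
    "integral\<^sup>L (hurwitz_measure t) (degree_slice N n) = slice_mass L t N n"
proof -
  let ?A = "Sigma {m. even m} (hurwitz_space n)"
  let ?g = "\<lambda>(m, c). hurwitz_density t (n, m, c) * degree_slice N n (n, m, c)"
  \<comment> \<open>The Euler characteristic contributes N^(-m), which combines with t^m. The
    weights \<open>card c / n!\<close> of the classes add up to
    \<open>card (coverings n m) / n!\<close>, and the factorial cancels against the one in the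
    content formula.\<close>
  let ?h = "\<lambda>m. exp (- t / 2) ^ n * ((t / real N) ^ m / fact m * (\<Sum>\<nu>\<in>partitions L n. total_content L \<nu> ^ m))"
  have inner: "((\<lambda>c. ?g (m, c)) has_sum ?h m) (hurwitz_space n m)" for m
  proof -
    have "?g (m, c) = exp (- t / 2) ^ n * ((t / real N) ^ m / fact m) / fact n * real (card c)" for c
      using N by (simp add: hurwitz_density_def degree_slice_def cover_deg_def cover_euler_def cover_weight_def
          power_int_minus divide_simps)
    then have "(\<Sum>c\<in>hurwitz_space n m. ?g (m, c)) =
        exp (- t / 2) ^ n * ((t / real N) ^ m / fact m) / fact n * real (card (coverings n m))"
      by (simp only: of_nat_sum sum_distrib_left[symmetric] sum_card_hurwitz_space[symmetric])
    also have "\<dots> = ?h m" by (simp add: card_coverings_eq_sum_content[OF L])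
    finally show ?thesis by (intro has_sum_finiteI finite_hurwitz_space) (rule sym)
  qed
  have outer: "(?h has_sum slice_mass L t N n) {m. even m}"
    using has_sum_cmult_right[OF has_sum_exponential_contents[OF L, of "t / real N"], of "exp (- t / 2) ^ n"]
    by (simp add: slice_mass_def)
  have nn: "0 \<le> ?g (m, c)" if "m \<in> {m. even m}" "c \<in> hurwitz_space n m" for m c
    using that hurwitz_density_nonneg[OF _ t, of "(n, m, c)"]
    by (auto simp: covering_classes_def degree_slice_def)
  have "(?g has_sum slice_mass L t N n) ?A"
    by (rule has_sum_SigmaI[OF inner outer summable_on_SigmaI[OF inner has_sum_imp_summable[OF outer] nn]])
  then have "((\<lambda>X. hurwitz_density t X * degree_slice N n X) has_sum slice_mass L t N n) (Pair n ` ?A)"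
    by (subst has_sum_reindex) (auto simp: inj_on_def o_def split_def)
  then have S: "((\<lambda>X. hurwitz_density t X * degree_slice N n X) has_sum slice_mass L t N n) covering_classes"
    by (rule has_sum_cong_neutral[THEN iffD1, rotated 3])
      (auto simp: covering_classes_def degree_slice_def cover_deg_def)
  show "integrable (hurwitz_measure t) (degree_slice N n)"
    "integral\<^sup>L (hurwitz_measure t) (degree_slice N n) = slice_mass L t N n"
    using integral_hurwitz_measure[OF t degree_slice_nonneg S] by auto
qed

lemma integral_single_truncated:
  assumes t: "t > 0" and N: "N \<ge> 1" and L: "nat \<lfloor>x\<rfloor> \<le> L" and x: "0 \<le> x"
    and \<phi>: "\<And>X. \<Phi> X = \<phi> (cover_deg X)"
  shows "(\<integral>X. of_bool (real (cover_deg X) \<le> x) * \<Phi> X * real N powi (cover_euler X) \<partial>(hurwitz_measure t)) =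
    (\<Sum>n\<le>nat \<lfloor>x\<rfloor>. \<phi> n * slice_mass L t N n)"
proof -
  have le: "real n \<le> x \<longleftrightarrow> n \<le> nat \<lfloor>x\<rfloor>" for n using x by (simp add: le_nat_floor le_nat_iff le_floor_iff)
  have "of_bool (real (cover_deg X) \<le> x) * \<Phi> X * real N powi (cover_euler X) =
      (\<Sum>n\<le>nat \<lfloor>x\<rfloor>. \<phi> n * degree_slice N n X)" for X
    unfolding degree_slice_def le \<phi>
    by (simp add: of_bool_def if_distrib[of "\<lambda>x. x * _"] if_distrib[of "\<lambda>x. _ * x"] cong: if_cong)
  then show ?thesis
    using integral_degree_slice[OF t N, of _ L] L
    by (simp add: Bochner_Integration.integral_sum)
qed

text \<open>Two caps L and L', because the two partitions cut from a unitary weight have different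
  maximal lengths when N is even.\<close>

lemma integral_double_truncated:
  assumes t: "t > 0" and N: "N \<ge> 1" and L: "nat \<lfloor>x\<rfloor> \<le> L" "nat \<lfloor>x\<rfloor> \<le> L'" and x: "0 \<le> x"
    and \<phi>: "\<And>X Y. \<Phi> X Y = \<phi> (cover_deg X) (cover_deg Y)"
  shows "(\<integral>(X, Y). of_bool (real (cover_deg X) \<le> x \<and> real (cover_deg Y) \<le> x) * \<Phi> X Y
      * real N powi (cover_euler X + cover_euler Y) \<partial>(hurwitz_measure t \<Otimes>\<^sub>M hurwitz_measure t)) =
    (\<Sum>m\<le>nat \<lfloor>x\<rfloor>. \<Sum>n\<le>nat \<lfloor>x\<rfloor>. \<phi> m n * (slice_mass L t N m * slice_mass L' t N n))"
proof -
  interpret M: sigma_finite_measure "hurwitz_measure t" by (rule sigma_finite_hurwitz_measure)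
  interpret pair_sigma_finite "hurwitz_measure t" "hurwitz_measure t" ..
  let ?P = "hurwitz_measure t \<Otimes>\<^sub>M hurwitz_measure t" and ?x = "nat \<lfloor>x\<rfloor>"
  let ?d = "\<lambda>m n p. case p of (X, Y) \<Rightarrow> degree_slice N m X * degree_slice N n Y"
  note I = integral_degree_slice[OF t N]
  have [measurable]: "degree_slice N n \<in> borel_measurable (hurwitz_measure t)" for n
    using I(1)[of n n] by auto
  have int: "integrable ?P (\<lambda>(X, Y). degree_slice N m X * degree_slice N n Y)"
    if "m \<le> L" "n \<le> L'" for m n
  proof (rule Fubini_integrable)
    have "(\<lambda>X. \<integral>Y. norm (case (X, Y) of (X, Y) \<Rightarrow> degree_slice N m X * degree_slice N n Y) \<partial>hurwitz_measure t) =
        (\<lambda>X. degree_slice N m X * slice_mass L' t N n)"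
      using I(2)[OF that(2)] by (simp add: abs_mult degree_slice_nonneg abs_of_nonneg)
    then show "integrable (hurwitz_measure t)
        (\<lambda>X. \<integral>Y. norm (case (X, Y) of (X, Y) \<Rightarrow> degree_slice N m X * degree_slice N n Y) \<partial>hurwitz_measure t)"
      using I(1)[OF that(1)] by simp
    show "AE X in hurwitz_measure t. integrable (hurwitz_measure t)
        (\<lambda>Y. case (X, Y) of (X, Y) \<Rightarrow> degree_slice N m X * degree_slice N n Y)"
      using I(1)[OF that(2)] by simp
  qed measurable
  have val: "integral\<^sup>L ?P (\<lambda>(X, Y). degree_slice N m X * degree_slice N n Y) = slice_mass L t N m * slice_mass L' t N n"
    if "m \<le> L" "n \<le> L'" for m n
    using integral_fst'[OF int[OF that]] I[OF that(1)] I[OF that(2)] by simp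
  have le: "real n \<le> x \<longleftrightarrow> n \<le> ?x" for n using x by (simp add: le_nat_floor le_nat_iff le_floor_iff)
  have "of_bool (real (cover_deg X) \<le> x \<and> real (cover_deg Y) \<le> x) * \<Phi> X Y
      * real N powi (cover_euler X + cover_euler Y) =
      (\<Sum>m\<le>?x. \<Sum>n\<le>?x. \<phi> m n * (degree_slice N m X * degree_slice N n Y))" for X Y
  proof -
    have pw: "real N powi (cover_euler X + cover_euler Y) = real N powi cover_euler X * real N powi cover_euler Y"
      using N by (simp add: power_int_add)
    have "\<phi> m n * (degree_slice N m X * degree_slice N n Y) =
        (if cover_deg X = m then if cover_deg Y = n then \<phi> m n * real N powi (cover_euler X + cover_euler Y) else 0 else 0)" for m n
      by (simp add: degree_slice_def pw)
    then have "(\<Sum>n\<le>?x. \<phi> m n * (degree_slice N m X * degree_slice N n Y)) =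
        (if cover_deg X = m then if cover_deg Y \<le> ?x
          then \<phi> m (cover_deg Y) * real N powi (cover_euler X + cover_euler Y) else 0 else 0)" for m
      by simp
    then show ?thesis by (simp add: le \<phi>)
  qed
  then have "(\<integral>(X, Y). of_bool (real (cover_deg X) \<le> x \<and> real (cover_deg Y) \<le> x) * \<Phi> X Y
      * real N powi (cover_euler X + cover_euler Y) \<partial>?P) =
      (\<integral>p. (\<Sum>m\<le>?x. \<Sum>n\<le>?x. \<phi> m n * ?d m n p) \<partial>?P)"
    by (intro Bochner_Integration.integral_cong) auto
  also have "\<dots> = (\<Sum>m\<le>?x. \<Sum>n\<le>?x. \<phi> m n * (slice_mass L t N m * slice_mass L' t N n))"
  proof -
    have i: "integrable ?P (\<lambda>p. \<phi> m n * ?d m n p)"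
      and v: "(\<integral>p. \<phi> m n * ?d m n p \<partial>?P) =
        \<phi> m n * (slice_mass L t N m * slice_mass L' t N n)"
      if "m \<le> ?x" "n \<le> ?x" for m n
      using int[of m n] val[of m n] that L by auto
    have "(\<integral>p. (\<Sum>m\<le>?x. \<Sum>n\<le>?x. \<phi> m n * ?d m n p) \<partial>?P) =
        (\<Sum>m\<le>?x. \<integral>p. (\<Sum>n\<le>?x. \<phi> m n * ?d m n p) \<partial>?P)"
      by (intro Bochner_Integration.integral_sum Bochner_Integration.integrable_sum i) auto
    also have "\<dots> = (\<Sum>m\<le>?x. \<Sum>n\<le>?x. \<integral>p. \<phi> m n * ?d m n p \<partial>?P)"
      by (intro sum.cong refl Bochner_Integration.integral_sum i) auto
    also have "\<dots> = (\<Sum>m\<le>?x. \<Sum>n\<le>?x. \<phi> m n * (slice_mass L t N m * slice_mass L' t N n))"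
      by (intro sum.cong refl v) auto
    finally show ?thesis .
  qed
  finally show ?thesis .
qed

section \<open>Partitions and weights\<close>

definition parts :: "nat \<Rightarrow> int list set" where
  "parts L = {l. length l = L \<and> nonincreasing l \<and> (\<forall>x\<in>set l. x \<ge> 0)}"

text \<open>Absolute values keep this a size for weights of type D, whose last entry may be
  negative.\<close>

definition weight_size :: "int list \<Rightarrow> real" where
  "weight_size l = real_of_int (sum_list (map abs l))"

text \<open>With x = exp (- s), each factor of Euler's product satisfies 1 / (1 - x^j) \<le> exp
  (x^j / (1 - x)), and the exponents summed over all j \<ge> 1 give x / (1 - x)^2, whatever the
  number of factors.\<close>

definition parts_bound :: "real \<Rightarrow> real" where
  "parts_bound s = exp (exp (- s) / (1 - exp (- s))\<^sup>2)"

lemma weight_size_nonneg: "0 \<le> weight_size l"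
  unfolding weight_size_def of_int_0_le_iff by (rule sum_list_nonneg) auto

lemma weight_size_parts: "l \<in> parts L \<Longrightarrow> weight_size l = real_of_int (sum_list l)"
proof -
  assume "l \<in> parts L"
  then have "map abs l = l" by (intro map_idI) (auto simp: parts_def)
  then show ?thesis by (simp add: weight_size_def)
qed

lemma inverse_one_minus_le_exp:
  fixes y :: real
  assumes "0 \<le> y" "y < 1"
  shows "1 / (1 - y) \<le> exp (y / (1 - y))"
proof -
  have "1 / (1 - y) = 1 + y / (1 - y)" using assms by (simp add: field_simps)
  then show ?thesis using exp_ge_add_one_self[of "y / (1 - y)"] by simp
qed

text \<open>The last part c counts the columns of full height L + 1; removing them leaves a
  partition with L parts. This is what makes the generating function a product.\<close>

lemma bij_betw_parts_Suc:
  "bij_betw (\<lambda>(c, l). map ((+) (int c)) l @ [int c]) (UNIV \<times> parts L) (parts (Suc L))"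
proof (rule bij_betw_byWitness[where f' = "\<lambda>l. (nat (last l), map (\<lambda>x. x - last l) (butlast l))"])
  show "\<forall>p\<in>UNIV \<times> parts L. (\<lambda>l. (nat (last l), map (\<lambda>x. x - last l) (butlast l)))
      ((\<lambda>(c, l). map ((+) (int c)) l @ [int c]) p) = p"
    by (auto intro: map_idI)
  have split: "l = butlast l @ [last l]" if "length l = Suc L" for l :: "int list"
    using that by (metis append_butlast_last_id length_0_conv nat.simps(3))
  show "\<forall>l\<in>parts (Suc L). (\<lambda>(c, l). map ((+) (int c)) l @ [int c]) ((\<lambda>l. (nat (last l), map (\<lambda>x. x - last l) (butlast l))) l) = l"
  proof
    fix l :: "int list" assume l: "l \<in> parts (Suc L)"
    then have "l = butlast l @ [last l]" "last l \<in> set l"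
      using split by (auto simp: parts_def intro!: last_in_set)
    then show "(\<lambda>(c, l). map ((+) (int c)) l @ [int c]) ((\<lambda>l. (nat (last l), map (\<lambda>x. x - last l) (butlast l))) l) = l"
      using l by (simp add: parts_def o_def)
  qed
  show "(\<lambda>(c, l). map ((+) (int c)) l @ [int c]) ` (UNIV \<times> parts L) \<subseteq> parts (Suc L)"
    by (auto simp: parts_def nonincreasing_def sorted_wrt_append sorted_wrt_map)
  show "(\<lambda>l. (nat (last l), map (\<lambda>x. x - last l) (butlast l))) ` parts (Suc L) \<subseteq> UNIV \<times> parts L"
  proof (rule image_subsetI)
    fix l :: "int list" assume l: "l \<in> parts (Suc L)"
    then obtain k x where kx: "l = k @ [x]" using split[of l] by (auto simp: parts_def)
    then show "(nat (last l), map (\<lambda>x. x - last l) (butlast l)) \<in> UNIV \<times> parts L"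
      using l by (auto simp: parts_def nonincreasing_def sorted_wrt_append sorted_wrt_map)
  qed
qed

lemma has_sum_geometric:
  fixes y :: real
  assumes "0 \<le> y" "y < 1"
  shows "((\<lambda>c. y ^ c) has_sum (1 / (1 - y))) (UNIV :: nat set)"
  using assms by (intro norm_summable_imp_has_sum geometric_sums) (auto simp: summable_geometric norm_power)

lemma has_sum_parts:
  assumes s: "s > 0"
  shows "\<exists>S. ((\<lambda>l. exp (- s * weight_size l)) has_sum S) (parts L) \<and>
    S \<le> exp ((\<Sum>j<L. exp (- s) ^ Suc j) / (1 - exp (- s)))"
proof (induction L)
  case 0
  have "parts 0 = {[]}" by (auto simp: parts_def nonincreasing_def)
  have "((\<lambda>l. exp (- s * weight_size l)) has_sum 1) (parts 0)"
    unfolding \<open>parts 0 = {[]}\<close> by (rule has_sum_finiteI) (auto simp: weight_size_def)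
  then show ?case by (intro exI[of _ 1]) simp
next
  case (Suc L)
  then obtain S where S: "((\<lambda>l. exp (- s * weight_size l)) has_sum S) (parts L)"
    "S \<le> exp ((\<Sum>j<L. exp (- s) ^ Suc j) / (1 - exp (- s)))" by blast
  let ?x = "exp (- s)" let ?y = "?x ^ Suc L"
  let ?f = "\<lambda>(c, l). ?y ^ c * exp (- s * weight_size l)"
  have x: "0 < ?x" "?x < 1" using s by auto
  have y: "0 \<le> ?y" "?y < 1" "?y \<le> ?x" using x power_decreasing[of 1 "Suc L" ?x]
    power_Suc_less_one[of ?x L] by auto
  have inner: "((\<lambda>l. ?f (c, l)) has_sum (?y ^ c * S)) (parts L)" for c
    using has_sum_cmult_right[OF S(1), of "?y ^ c"] by simp
  have outer: "((\<lambda>c. ?y ^ c * S) has_sum (1 / (1 - ?y) * S)) UNIV"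
    by (intro has_sum_cmult_left has_sum_geometric y)
  have "(?f has_sum (1 / (1 - ?y) * S)) (UNIV \<times> parts L)"
    using y by (intro has_sum_SigmaI[OF inner outer summable_on_SigmaI[OF inner has_sum_imp_summable[OF outer]]]) auto
  moreover have "?f p = exp (- s * weight_size ((\<lambda>(c, l). map ((+) (int c)) l @ [int c]) p))" if mem: "p \<in> UNIV \<times> parts L" for p
  proof -
    obtain c l where p: "p = (c, l)" "l \<in> parts L" using mem by auto
    have "sum_list (map ((+) (int c)) l @ [int c]) = sum_list l + int (Suc L) * int c"
    proof -
      have "sum_list (map ((+) a) l) = sum_list l + int (length l) * a" for a
        by (induction l) (auto simp: algebra_simps)
      then show ?thesis using p(2) by (simp add: parts_def algebra_simps)
    qed
    moreover have "map ((+) (int c)) l @ [int c] \<in> parts (Suc L)"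
      using bij_betw_apply[OF bij_betw_parts_Suc, of "(c, l)" L] p by simp
    ultimately have ws: "weight_size (map ((+) (int c)) l @ [int c]) = weight_size l + real (Suc L) * real c"
      using p(2) by (simp only: weight_size_parts of_int_add of_int_mult of_int_of_nat_eq)
    have y': "?y ^ c = exp (- s * (real (Suc L) * real c))"
      by (simp only: power_mult[symmetric] exp_of_nat_mult[symmetric] of_nat_mult) (simp add: algebra_simps)
    have "?y ^ c * exp (- s * weight_size l) = exp (- s * (weight_size l + real (Suc L) * real c))"
      unfolding y' exp_add[symmetric] by (simp add: algebra_simps)
    then show ?thesis by (simp only: p(1) prod.case ws)
  qed
  ultimately have "((\<lambda>p. exp (- s * weight_size ((\<lambda>(c, l). map ((+) (int c)) l @ [int c]) p))) has_sum
      (1 / (1 - ?y) * S)) (UNIV \<times> parts L)" by (subst has_sum_cong[symmetric]) auto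
  then have sum: "((\<lambda>l. exp (- s * weight_size l)) has_sum (1 / (1 - ?y) * S)) (parts (Suc L))"
    using has_sum_reindex_bij_betw[OF bij_betw_parts_Suc[of L], of "\<lambda>l. exp (- s * weight_size l)"] by simp
  have S0: "0 \<le> S" by (rule has_sum_nonneg[OF S(1)]) simp
  \<comment> \<open>Weakening the denominator 1 - x^(L+1) to 1 - x gives all factors a common
    denominator, so that the exponents add up to a geometric sum.\<close>
  have "1 / (1 - ?y) \<le> exp (?y / (1 - ?y))" using y by (intro inverse_one_minus_le_exp)
  also have "\<dots> \<le> exp (?y / (1 - ?x))"
    using x y by (subst exp_le_cancel_iff, intro divide_left_mono) auto
  finally have "1 / (1 - ?y) * S \<le> exp (?y / (1 - ?x)) * exp ((\<Sum>j<L. ?x ^ Suc j) / (1 - ?x))"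
    using S(2) S0 y by (intro mult_mono) auto
  also have "\<dots> = exp ((\<Sum>j<Suc L. ?x ^ Suc j) / (1 - ?x))"
    by (simp add: exp_add[symmetric] add_divide_distrib)
  finally show ?case using sum by blast
qed

lemma parts_summable:
  assumes s: "s > 0"
  shows "(\<lambda>l. exp (- s * weight_size l)) summable_on parts L"
    and "infsum (\<lambda>l. exp (- s * weight_size l)) (parts L) \<le> parts_bound s"
proof -
  obtain S where S: "((\<lambda>l. exp (- s * weight_size l)) has_sum S) (parts L)"
    "S \<le> exp ((\<Sum>j<L. exp (- s) ^ Suc j) / (1 - exp (- s)))" using has_sum_parts[OF s] by blast
  let ?x = "exp (- s)"
  have x: "0 < ?x" "?x < 1" using s by auto
  have "(\<Sum>j<L. ?x ^ Suc j) = ?x * ((1 - ?x ^ L) / (1 - ?x))"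
    using x by (simp add: sum_distrib_left[symmetric] sum_gp_strict)
  also have "\<dots> \<le> ?x * (1 / (1 - ?x))" using x by (intro mult_left_mono divide_right_mono) auto
  finally have "(\<Sum>j<L. ?x ^ Suc j) / (1 - ?x) \<le> ?x * (1 / (1 - ?x)) / (1 - ?x)"
    using x by (intro divide_right_mono) auto
  also have "\<dots> = ?x / (1 - ?x)\<^sup>2" by (simp add: power2_eq_square)
  finally have "S \<le> parts_bound s" using S(2) unfolding parts_bound_def
    by (meson exp_le_cancel_iff order_trans)
  then show "(\<lambda>l. exp (- s * weight_size l)) summable_on parts L"
    "infsum (\<lambda>l. exp (- s * weight_size l)) (parts L) \<le> parts_bound s"
    using S(1) by (auto simp: has_sum_imp_summable infsumI)
qed

lemma parts_pair_summable:
  assumes s: "s > 0"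
  shows "(\<lambda>(k, l). exp (- s * (weight_size k + weight_size l))) summable_on parts L \<times> parts L'"
    and "infsum (\<lambda>(k, l). exp (- s * (weight_size k + weight_size l))) (parts L \<times> parts L') \<le> (parts_bound s)\<^sup>2"
proof -
  let ?e = "\<lambda>l. exp (- s * weight_size l)"
  define A where "A = infsum ?e (parts L)"
  define B where "B = infsum ?e (parts L')"
  have A: "(?e has_sum A) (parts L)" and B: "(?e has_sum B) (parts L')"
    using parts_summable(1)[OF s] by (auto simp: A_def B_def)
  have inner: "((\<lambda>l. case (k, l) of (k, l) \<Rightarrow> exp (- s * (weight_size k + weight_size l))) has_sum ?e k * B) (parts L')" for k
    by (rule has_sum_cong[THEN iffD1, rotated, OF has_sum_cmult_right[OF B, of "?e k"]])
      (simp add: exp_add[symmetric] algebra_simps)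
  have outer: "((\<lambda>k. ?e k * B) has_sum A * B) (parts L)" by (rule has_sum_cmult_left[OF A])
  have s1: "(\<lambda>(k, l). exp (- s * (weight_size k + weight_size l))) summable_on parts L \<times> parts L'"
    by (rule summable_on_SigmaI[OF inner has_sum_imp_summable[OF outer]]) auto
  have "((\<lambda>(k, l). exp (- s * (weight_size k + weight_size l))) has_sum A * B) (parts L \<times> parts L')"
    by (rule has_sum_SigmaI[OF inner outer s1])
  moreover have "A * B \<le> (parts_bound s)\<^sup>2"
    unfolding power2_eq_square using parts_summable(2)[OF s] infsum_nonneg[of "parts L'" ?e]
    by (intro mult_mono) (auto simp: A_def B_def parts_bound_def)
  ultimately show "infsum (\<lambda>(k, l). exp (- s * (weight_size k + weight_size l))) (parts L \<times> parts L') \<le> (parts_bound s)\<^sup>2"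
    by (simp add: infsumI)
  show "(\<lambda>(k, l). exp (- s * (weight_size k + weight_size l))) summable_on parts L \<times> parts L'" by (rule s1)
qed

text \<open>Decay at rate 2 s is spent in two halves: one is the summable majorant, the other is at
  most exp (- s X) outside \<open>T\<close>. The set \<open>T\<close> is only asked to contain
  whatever is smaller than X.\<close>

lemma exponential_tail_bound:
  fixes size g :: "'a \<Rightarrow> real"
  assumes s: "s > 0" and h: "(\<lambda>a. exp (- s * size a)) summable_on A"
    "infsum (\<lambda>a. exp (- s * size a)) A \<le> H"
    and size: "\<And>a. a \<in> A \<Longrightarrow> 0 \<le> size a"
    and g: "\<And>a. a \<in> A \<Longrightarrow> 0 \<le> g a" "\<And>a. a \<in> A \<Longrightarrow> g a \<le> K * exp (- (2 * s) * size a)"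
    and K: "0 \<le> K" and T: "T \<subseteq> A" "\<And>a. a \<in> A \<Longrightarrow> a \<notin> T \<Longrightarrow> X \<le> size a"
  shows "g summable_on A" and "\<bar>infsum g A - infsum g T\<bar> \<le> K * H * exp (- s * X)"
proof -
  let ?h = "\<lambda>a. exp (- s * size a)"
  have gh: "g a \<le> K * ?h a * exp (- s * size a)" if "a \<in> A" for a
    using g(2)[OF that] by (simp add: mult.assoc exp_add[symmetric])
  show sg: "g summable_on A"
  proof (rule summable_on_comparison_test[OF summable_on_cmult_right[OF h(1), of K]])
    fix a assume a: "a \<in> A"
    have "K * ?h a * exp (- s * size a) \<le> K * ?h a * 1"
      using K s size[OF a] by (intro mult_left_mono) auto
    then show "g a \<le> K * ?h a" using gh[OF a] by simp
  qed (use g in auto)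
  have sub: "A - T \<subseteq> A" by auto
  have "infsum g A = infsum g (T \<union> (A - T))" using T(1) by (simp add: Un_absorb1)
  also have "\<dots> = infsum g T + infsum g (A - T)"
    by (rule infsum_Un_disjoint) (auto intro: summable_on_subset[OF sg] T(1)[THEN subsetD])
  finally have eq: "infsum g A - infsum g T = infsum g (A - T)" by simp
  have "infsum g (A - T) \<le> infsum (\<lambda>a. (K * exp (- s * X)) * ?h a) A"
  proof (rule infsum_mono_neutral)
    show "g summable_on A - T" by (rule summable_on_subset[OF sg sub])
    show "(\<lambda>a. (K * exp (- s * X)) * ?h a) summable_on A" by (rule summable_on_cmult_right[OF h(1)])
    fix a assume "a \<in> (A - T) \<inter> A"
    then have a: "a \<in> A" "X \<le> size a" using T by auto
    have "K * ?h a * exp (- s * size a) \<le> K * ?h a * exp (- s * X)"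
      using K s a by (intro mult_left_mono) auto
    then show "g a \<le> K * exp (- s * X) * ?h a" using gh[OF a(1)] by (simp add: mult_ac)
  qed (use K in auto)
  also have "\<dots> = K * exp (- s * X) * infsum ?h A" by (rule infsum_cmult_right[OF h(1)])
  also have "\<dots> \<le> K * exp (- s * X) * H" using K h(2) by (intro mult_left_mono) auto
  finally have "infsum g (A - T) \<le> K * H * exp (- s * X)" by (simp add: mult_ac)
  moreover have "0 \<le> infsum g (A - T)" using g by (intro infsum_nonneg) auto
  ultimately show "\<bar>infsum g A - infsum g T\<bar> \<le> K * H * exp (- s * X)" unfolding eq by simp
qed

section \<open>Casimir numbers of partitions and their lower bounds\<close>

definition list_content :: "int list \<Rightarrow> real" where
  "list_content l = (\<Sum>i<length l. real_of_int (l ! i) * (real_of_int (l ! i) - 1 - 2 * real i)) / 2"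

lemma sum_list_lessThan: "real_of_int (sum_list l) = (\<Sum>i<length l. real_of_int (l ! i))"
  by (simp add: sum_list_sum_nth atLeast0LessThan)

lemma weight_sum_eq:
  "weight_sum N a l = (\<Sum>i<length l. real_of_int (l ! i) * (real_of_int (l ! i) + real N + real_of_int a - 2 - 2 * real i)) / real N"
proof -
  have "(\<Sum>i = 1..length l. real_of_int (l ! (i - 1) * (l ! (i - 1) + int N + a - 2 * int i))) =
      (\<Sum>i<length l. real_of_int (l ! (Suc i - 1) * (l ! (Suc i - 1) + int N + a - 2 * int (Suc i))))"
    by (rule sum.reindex_bij_witness[of _ Suc "\<lambda>i. i - 1"]) auto
  then show ?thesis unfolding weight_sum_def by (simp add: algebra_simps)
qed

text \<open>For a = 1 the size has coefficient exactly 1. The other types differ by (a - 1) / N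
  times the size, with a = 0 for B and D and a = 2 for C; this is the correction that \<Phi>
  carries.\<close>

lemma weight_sum_content:
  assumes "N \<ge> 1"
  shows "weight_sum N a l = 2 * list_content l / real N + (real N + real_of_int a - 1) / real N * real_of_int (sum_list l)"
proof -
  have "(\<Sum>i<length l. real_of_int (l ! i) * (real_of_int (l ! i) + real N + real_of_int a - 2 - 2 * real i)) =
     2 * list_content l + (real N + real_of_int a - 1) * real_of_int (sum_list l)"
  proof -
    have "2 * list_content l = (\<Sum>i<length l. real_of_int (l ! i) * (real_of_int (l ! i) - 1 - 2 * real i))"
      by (simp add: list_content_def)
    then show ?thesis unfolding sum_list_lessThan sum_distrib_left
      by (simp only: sum.distrib[symmetric]) (auto intro!: sum.cong simp: algebra_simps)
  qed
  then show ?thesis unfolding weight_sum_eq by (simp add: add_divide_distrib)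
qed

lemma nonincreasing_nth: "nonincreasing l \<Longrightarrow> i \<le> j \<Longrightarrow> j < length l \<Longrightarrow> l ! j \<le> l ! i"
  unfolding nonincreasing_def by (cases "i = j") (auto simp: sorted_wrt_iff_nth_less)

text \<open>The weights L - 1 - 2 i are antisymmetric under reflection of the index. Pairing i with
  its reflection gives differences of entries times weights of the same sign.\<close>

lemma chebyshev_parts:
  assumes "l \<in> parts L"
  shows "0 \<le> (\<Sum>i<L. real_of_int (l ! i) * (real L - 1 - 2 * real i))"
proof -
  let ?f = "\<lambda>i. real_of_int (l ! i) * (real L - 1 - 2 * real i)"
  have "(\<Sum>i<L. ?f i) = (\<Sum>i<L. ?f (L - Suc i))" by (rule sum.nat_diff_reindex[symmetric])
  also have "\<dots> = (\<Sum>i<L. - (real_of_int (l ! (L - Suc i)) * (real L - 1 - 2 * real i)))"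
    by (rule sum.cong) (auto simp: of_nat_diff algebra_simps)
  finally have "2 * (\<Sum>i<L. ?f i) =
      (\<Sum>i<L. (real_of_int (l ! i) - real_of_int (l ! (L - Suc i))) * (real L - 1 - 2 * real i))"
    by (simp add: sum_negf sum_subtractf left_diff_distrib)
  also have "\<dots> \<ge> 0"
  proof (rule sum_nonneg)
    fix i assume "i \<in> {..<L}"
    then have i: "i < L" by simp
    have l: "nonincreasing l" "length l = L" using assms by (auto simp: parts_def)
    show "0 \<le> (real_of_int (l ! i) - real_of_int (l ! (L - Suc i))) * (real L - 1 - 2 * real i)"
    proof (cases "i \<le> L - Suc i")
      case True
      then have "l ! (L - Suc i) \<le> l ! i" using i l by (intro nonincreasing_nth) auto
      moreover have "2 * real i \<le> real L - 1" using True i by linarith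
      ultimately show ?thesis by (intro mult_nonneg_nonneg) auto
    next
      case False
      then have "l ! i \<le> l ! (L - Suc i)" using i l by (intro nonincreasing_nth) auto
      moreover have "real L - 1 \<le> 2 * real i" using False i by linarith
      ultimately show ?thesis by (intro mult_nonpos_nonpos) auto
    qed
  qed
  finally show ?thesis by simp
qed

text \<open>The coefficient N + a - 2 - 2 i splits into the constant N + a - 1 - L and the part L -
  1 - 2 i, whose contribution is nonnegative by Chebyshev's inequality.\<close>

lemma weight_sum_lower:
  assumes l: "l \<in> parts L" and N: "N \<ge> 1"
  shows "((\<Sum>i<L. (real_of_int (l ! i))\<^sup>2) + (real N + real_of_int a - 1 - real L) * weight_size l) / real N \<le> weight_sum N a l"
proof -
  have len: "length l = L" using l by (simp add: parts_def)
  have "(\<Sum>i<L. real_of_int (l ! i) * (real_of_int (l ! i) + real N + real_of_int a - 2 - 2 * real i)) =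
      (\<Sum>i<L. (real_of_int (l ! i))\<^sup>2) + (real N + real_of_int a - 1 - real L) * weight_size l +
      (\<Sum>i<L. real_of_int (l ! i) * (real L - 1 - 2 * real i))"
    unfolding weight_size_parts[OF l] sum_list_lessThan len
    unfolding sum_distrib_left sum.distrib[symmetric]
    by (intro sum.cong refl) (simp add: algebra_simps power2_eq_square)
  then show ?thesis unfolding weight_sum_eq len using chebyshev_parts[OF l]
    by (intro divide_right_mono) auto
qed

lemma weight_size_square:
  assumes l: "l \<in> parts L"
  shows "(weight_size l)\<^sup>2 \<le> real L * (\<Sum>i<L. (real_of_int (l ! i))\<^sup>2)"
  unfolding weight_size_parts[OF l] sum_list_lessThan
  using l Cauchy_Schwarz_ineq_sum[of "\<lambda>_. 1" "\<lambda>i. real_of_int (l ! i)" "{..<L}"] by (simp add: parts_def)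

text \<open>The negative square is what type A leaves subtracted from the Casimir number, and what
  remains in type A' after completing the square in n. Cauchy-Schwarz bounds it by the squares of
  the entries, which are given up entirely; the linear coefficient N - L \<ge> N / 2 leaves the
  factor 1/2.\<close>

lemma weight_sum_pair_lower:
  assumes k: "k \<in> parts L" and l: "l \<in> parts L'" and N: "N \<ge> 1"
    and L: "2 * L \<le> N" "2 * L' \<le> N"
  shows "(weight_size k + weight_size l) / 2 \<le>
    weight_sum N 1 k + weight_sum N 1 l - (weight_size k - weight_size l)\<^sup>2 / (real N)\<^sup>2"
proof -
  let ?Q = "\<lambda>L l. \<Sum>i<L. (real_of_int (l ! i))\<^sup>2"
  have half: "(?Q M m + real N / 2 * weight_size m) / real N \<le> weight_sum N 1 m"
    if "m \<in> parts M" "2 * M \<le> N" for M m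
  proof -
    have "real N / 2 * weight_size m \<le> (real N + real_of_int 1 - 1 - real M) * weight_size m"
      using that by (intro mult_right_mono weight_size_nonneg) auto
    then have "(?Q M m + real N / 2 * weight_size m) / real N \<le>
        (?Q M m + (real N + real_of_int 1 - 1 - real M) * weight_size m) / real N"
      by (intro divide_right_mono) auto
    then show ?thesis using weight_sum_lower[OF that(1) N, of 1] by linarith
  qed
  have "(weight_size k - weight_size l)\<^sup>2 \<le> (weight_size k)\<^sup>2 + (weight_size l)\<^sup>2"
    using weight_size_nonneg[of k] weight_size_nonneg[of l] by (simp add: power2_diff)
  also have "\<dots> \<le> real L * ?Q L k + real L' * ?Q L' l"
    using weight_size_square[OF k] weight_size_square[OF l] by simp
  also have "\<dots> \<le> real N * ?Q L k + real N * ?Q L' l"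
    using L by (intro add_mono mult_right_mono sum_nonneg) auto
  finally have "(weight_size k - weight_size l)\<^sup>2 / (real N)\<^sup>2 \<le> (real N * (?Q L k + ?Q L' l)) / (real N)\<^sup>2"
    by (intro divide_right_mono) (auto simp: algebra_simps)
  also have "\<dots> = (?Q L k + ?Q L' l) / real N" using N by (simp add: power2_eq_square)
  finally have "(weight_size k - weight_size l)\<^sup>2 / (real N)\<^sup>2 \<le> (?Q L k + ?Q L' l) / real N" .
  moreover have "(?Q M m + real N / 2 * weight_size m) / real N = ?Q M m / real N + weight_size m / 2" for M m
    using N by (simp add: add_divide_distrib)
  ultimately show ?thesis using half[OF k L(1)] half[OF l L(2)] N by (simp add: add_divide_distrib)
qed

section \<open>Types B, C and D\<close>

lemma bij_betw_partitions_parts: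
  "bij_betw (\<lambda>\<nu>. map (\<lambda>i. int (\<nu> i)) [0..<L]) (partitions L n) {l \<in> parts L. sum_list l = int n}"
proof (rule bij_betw_byWitness[where f' = "\<lambda>l i. if i < L then nat (l ! i) else 0"])
  let ?f = "\<lambda>\<nu>. map (\<lambda>i. int (\<nu> i)) [0..<L]" and ?g = "\<lambda>l i. if i < L then nat (l ! i) else 0"
  show "\<forall>\<nu>\<in>partitions L n. ?g (?f \<nu>) = \<nu>"
    by (auto simp: partitions_def compositions_def fun_eq_iff)
  have nn: "0 \<le> l ! i" if "l \<in> parts L" "i < L" for l i using that by (auto simp: parts_def)
  show "\<forall>l\<in>{l \<in> parts L. sum_list l = int n}. ?f (?g l) = l"
    using nn by (auto simp: parts_def intro!: nth_equalityI)
  show "?f ` partitions L n \<subseteq> {l \<in> parts L. sum_list l = int n}"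
  proof (rule image_subsetI)
    fix \<nu> assume \<nu>: "\<nu> \<in> partitions L n"
    have "nonincreasing (?f \<nu>)"
      using \<nu> by (auto simp: nonincreasing_def sorted_wrt_iff_nth_less partitions_def intro: antimonoD)
    moreover have "sum_list (?f \<nu>) = int (sum \<nu> {..<L})"
      by (simp add: sum_list_sum_nth atLeast0LessThan)
    ultimately show "?f \<nu> \<in> {l \<in> parts L. sum_list l = int n}"
      using \<nu> by (auto simp: parts_def partitions_def compositions_def)
  qed
  show "?g ` {l \<in> parts L. sum_list l = int n} \<subseteq> partitions L n"
  proof (rule image_subsetI)
    fix l assume l: "l \<in> {l \<in> parts L. sum_list l = int n}"
    then have len: "length l = L" "nonincreasing l" by (auto simp: parts_def)
    have "antimono (?g l)"
    proof (rule antimonoI)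
      fix i j :: nat assume "i \<le> j"
      then show "?g l j \<le> ?g l i" using nonincreasing_nth[OF len(2), of i j] len by auto
    qed
    moreover have "int (sum (?g l) {..<L}) = (\<Sum>i<L. l ! i)"
      unfolding of_nat_sum using nn l by (intro sum.cong) auto
    then have "int (sum (?g l) {..<L}) = int n"
      using l len by (simp only: sum_list_sum_nth atLeast0LessThan mem_Collect_eq)
    then have "sum (?g l) {..<L} = n" by (rule of_nat_eq_iff[THEN iffD1])
    ultimately show "?g l \<in> partitions L n" by (auto simp: partitions_def compositions_def)
  qed
qed

lemma finite_parts_sum: "finite {l \<in> parts L. sum_list l = int n}"
  using bij_betw_finite[OF bij_betw_partitions_parts] by simp

text \<open>Here coverings and weights meet: \<open>exp (- t / 2) ^ n\<close> supplies the size and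
  the exponential of the content the rest of the Casimir number with a = 1.\<close>

lemma slice_mass_parts:
  assumes "N \<ge> 1"
  shows "slice_mass L t N n = (\<Sum>l | l \<in> parts L \<and> sum_list l = int n. exp (- (t / 2) * weight_sum N 1 l))"
proof -
  have "(\<Sum>l | l \<in> parts L \<and> sum_list l = int n. exp (- (t / 2) * weight_sum N 1 l)) =
      (\<Sum>l | l \<in> parts L \<and> sum_list l = int n. exp (- t / 2) ^ n * exp (- (t * list_content l / real N)))"
  proof (rule sum.cong)
    fix l assume "l \<in> {l. l \<in> parts L \<and> sum_list l = int n}"
    then have "weight_sum N 1 l = 2 * list_content l / real N + real n"
      using assms by (simp add: weight_sum_content)
    then show "exp (- (t / 2) * weight_sum N 1 l) = exp (- t / 2) ^ n * exp (- (t * list_content l / real N))"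
      by (simp add: exp_of_nat_mult[symmetric] exp_add[symmetric] algebra_simps)
  qed simp
  also have "\<dots> = (\<Sum>\<nu>\<in>partitions L n. exp (- t / 2) ^ n * exp (- (t * list_content (map (\<lambda>i. int (\<nu> i)) [0..<L]) / real N)))"
    by (rule sum.reindex_bij_betw[OF bij_betw_partitions_parts, symmetric])
  also have "\<dots> = slice_mass L t N n"
    unfolding slice_mass_def sum_distrib_left
    by (intro sum.cong refl) (simp add: list_content_def total_content_def)
  finally show ?thesis by simp
qed

lemma truncated_parts:
  assumes "X \<ge> 0"
  shows "l \<in> parts L \<Longrightarrow> weight_size l \<le> X \<longleftrightarrow> nat (sum_list l) \<le> nat \<lfloor>X\<rfloor>"
    and "finite {l \<in> parts L. weight_size l \<le> X}"
proof -
  have eq: "weight_size l \<le> X \<longleftrightarrow> nat (sum_list l) \<le> nat \<lfloor>X\<rfloor>" if "l \<in> parts L" for l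
    using weight_size_parts[OF that] weight_size_nonneg[of l] assms
    by (simp add: le_floor_iff nat_le_iff)
  then show "l \<in> parts L \<Longrightarrow> weight_size l \<le> X \<longleftrightarrow> nat (sum_list l) \<le> nat \<lfloor>X\<rfloor>" .
  have "{l \<in> parts L. weight_size l \<le> X} \<subseteq> (\<Union>n\<le>nat \<lfloor>X\<rfloor>. {l \<in> parts L. sum_list l = int n})"
  proof
    fix l assume l: "l \<in> {l \<in> parts L. weight_size l \<le> X}"
    then have "0 \<le> sum_list l" using weight_size_parts[of l L] weight_size_nonneg[of l] by simp
    then show "l \<in> (\<Union>n\<le>nat \<lfloor>X\<rfloor>. {l \<in> parts L. sum_list l = int n})"
      using l eq[of l] by (auto intro!: bexI[of _ "nat (sum_list l)"])
  qed
  then show "finite {l \<in> parts L. weight_size l \<le> X}"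
    by (rule finite_subset) (auto intro: finite_parts_sum)
qed

lemma sum_slice_mass:
  assumes N: "N \<ge> 1" and X: "X \<ge> 0"
  shows "(\<Sum>n\<le>nat \<lfloor>X\<rfloor>. \<phi> n * slice_mass L t N n) =
    (\<Sum>l | l \<in> parts L \<and> weight_size l \<le> X. \<phi> (nat (sum_list l)) * exp (- (t / 2) * weight_sum N 1 l))"
proof -
  let ?T = "{l. l \<in> parts L \<and> weight_size l \<le> X}"
  have "(\<Sum>l\<in>?T. \<phi> (nat (sum_list l)) * exp (- (t / 2) * weight_sum N 1 l)) =
      (\<Sum>n\<le>nat \<lfloor>X\<rfloor>. \<Sum>l | l \<in> ?T \<and> nat (sum_list l) = n. \<phi> (nat (sum_list l)) * exp (- (t / 2) * weight_sum N 1 l))"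
    using truncated_parts[OF X] by (intro sum.group[symmetric]) auto
  also have "\<dots> = (\<Sum>n\<le>nat \<lfloor>X\<rfloor>. \<phi> n * slice_mass L t N n)"
    unfolding slice_mass_parts[OF N] sum_distrib_left
  proof (rule sum.cong[OF refl], rule sum.cong)
    fix n assume n: "n \<in> {..nat \<lfloor>X\<rfloor>}"
    have "0 \<le> sum_list l" if "l \<in> parts L" for l
      using weight_size_parts[OF that] weight_size_nonneg[of l] by simp
    then show "{l \<in> ?T. nat (sum_list l) = n} = {l. l \<in> parts L \<and> sum_list l = int n}"
      using n truncated_parts(1)[OF X] by auto
  qed auto
  finally show ?thesis by simp
qed

lemma integral_single_parts:
  assumes t: "t > 0" and N: "N \<ge> 1" and X: "0 \<le> X" and L: "nat \<lfloor>X\<rfloor> \<le> L"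
    and \<Phi>: "\<And>Y. \<Phi> Y = exp (- (t / 2) * ((real_of_int a - 1) / real N * real (cover_deg Y)))"
  shows "(\<integral>Y. of_bool (real (cover_deg Y) \<le> X) * \<Phi> Y * real N powi (cover_euler Y) \<partial>(hurwitz_measure t)) =
    infsum (\<lambda>l. exp (- (t / 2) * weight_sum N a l)) {l \<in> parts L. weight_size l \<le> X}"
proof -
  let ?\<phi> = "\<lambda>n. exp (- (t / 2) * ((real_of_int a - 1) / real N * real n))"
  have "(\<integral>Y. of_bool (real (cover_deg Y) \<le> X) * \<Phi> Y * real N powi (cover_euler Y) \<partial>(hurwitz_measure t)) =
      (\<Sum>n\<le>nat \<lfloor>X\<rfloor>. ?\<phi> n * slice_mass L t N n)"
    by (rule integral_single_truncated[OF t N L X]) (rule \<Phi>)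
  also have "\<dots> = (\<Sum>l | l \<in> parts L \<and> weight_size l \<le> X. ?\<phi> (nat (sum_list l)) * exp (- (t / 2) * weight_sum N 1 l))"
    by (rule sum_slice_mass[OF N X])
  also have "\<dots> = (\<Sum>l | l \<in> parts L \<and> weight_size l \<le> X. exp (- (t / 2) * weight_sum N a l))"
  proof (rule sum.cong)
    fix l assume "l \<in> {l. l \<in> parts L \<and> weight_size l \<le> X}"
    then have "0 \<le> sum_list l" using weight_size_parts[of l L] weight_size_nonneg[of l] by simp
    then have n: "real (nat (sum_list l)) = real_of_int (sum_list l)" by simp
    have "weight_sum N a l = (real_of_int a - 1) / real N * real_of_int (sum_list l) + weight_sum N 1 l"
      unfolding weight_sum_content[OF N] using N by (simp add: field_simps)
    then show "?\<phi> (nat (sum_list l)) * exp (- (t / 2) * weight_sum N 1 l) = exp (- (t / 2) * weight_sum N a l)"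
      unfolding n by (simp only: exp_add[symmetric] distrib_left)
  qed simp
  also have "\<dots> = infsum (\<lambda>l. exp (- (t / 2) * weight_sum N a l)) {l \<in> parts L. weight_size l \<le> X}"
    using truncated_parts(2)[OF X, of L] by simp
  finally show ?thesis .
qed

text \<open>The rate t/12 asks for the fraction 1/3. The tightest case is type D, where the
  coefficient of the size is N / 2 - 1, at least N / 3 exactly from N = 6 on.\<close>

lemma weight_sum_single_lower:
  assumes l: "l \<in> parts L" and N: "N \<ge> 1" and L: "real N / 3 \<le> real N + real_of_int a - 1 - real L"
  shows "weight_size l / 3 \<le> weight_sum N a l"
proof -
  have "real N / 3 * weight_size l \<le> (real N + real_of_int a - 1 - real L) * weight_size l"
    using L by (intro mult_right_mono weight_size_nonneg) auto
  also have "\<dots> \<le> (\<Sum>i<L. (real_of_int (l ! i))\<^sup>2) + (real N + real_of_int a - 1 - real L) * weight_size l"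
    by (simp add: sum_nonneg)
  finally have "real N / 3 * weight_size l / real N \<le>
      ((\<Sum>i<L. (real_of_int (l ! i))\<^sup>2) + (real N + real_of_int a - 1 - real L) * weight_size l) / real N"
    by (intro divide_right_mono) auto
  also have "\<dots> \<le> weight_sum N a l" by (rule weight_sum_lower[OF l N])
  finally show ?thesis using N by simp
qed

lemma exp_single_bound:
  fixes t w c :: real
  assumes "t > 0" "w / 3 \<le> c"
  shows "exp (- (t / 2) * c) \<le> 1 * exp (- (2 * (t / 12)) * w)"
  using mult_left_mono[OF assms(2), of "t / 2"] assms(1) by simp

lemma single_error:
  assumes t: "t > 0" and N: "N \<ge> 1" and L: "real N / 3 \<le> real N + real_of_int a - 1 - real L"
  shows "\<bar>infsum (\<lambda>l. exp (- (t / 2) * weight_sum N a l)) (parts L) -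
    infsum (\<lambda>l. exp (- (t / 2) * weight_sum N a l)) {l \<in> parts L. weight_size l \<le> X}\<bar>
    \<le> 1 * parts_bound (t / 12) * exp (- (t / 12) * X)"
proof (rule exponential_tail_bound(2)[where size = weight_size])
  fix l assume "l \<in> parts L"
  then show "exp (- (t / 2) * weight_sum N a l) \<le> 1 * exp (- (2 * (t / 12)) * weight_size l)"
    by (intro exp_single_bound t weight_sum_single_lower[OF _ N L])
qed (use t parts_summable[of "t / 12" L] in \<open>auto simp: weight_size_nonneg\<close>)

section \<open>Type D: weights with a negative last entry\<close>

definition flip_last :: "int list \<Rightarrow> int list" where
  "flip_last l = butlast l @ [- last l]"

lemma highest_weights_D_split:
  assumes "N \<ge> 2"
  shows "highest_weights TypeD N = parts (N div 2) \<union> {l \<in> highest_weights TypeD N. last l < 0}"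
    and "parts (N div 2) \<inter> {l \<in> highest_weights TypeD N. last l < 0} = {}"
    and "flip_last ` {l \<in> highest_weights TypeD N. last l < 0} \<subseteq> parts (N div 2)"
    and "inj_on flip_last {l \<in> highest_weights TypeD N. last l < 0}"
proof -
  let ?A = "highest_weights TypeD N" let ?B = "{l \<in> ?A. last l < 0}"
  have split: "\<exists>k x. l = k @ [x]" if "length l = N div 2" for l :: "int list"
    using that assms by (metis append_butlast_last_id length_0_conv div_greater_zero_iff neq0_conv pos2 bot_nat_0.not_eq_extremum)
  have P: "k @ [x] \<in> parts (N div 2) \<longleftrightarrow> k @ [x] \<in> ?A \<and> 0 \<le> x" for k x
    by (auto simp: parts_def nonincreasing_def sorted_wrt_append intro: order_trans)
  show "?A = parts (N div 2) \<union> ?B"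
  proof (rule Set.set_eqI)
    fix l
    show "l \<in> ?A \<longleftrightarrow> l \<in> parts (N div 2) \<union> ?B"
    proof (cases "length l = N div 2")
      case True
      then obtain k x where "l = k @ [x]" using split by blast
      then show ?thesis using P[of k x] by auto
    qed (auto simp: parts_def)
  qed
  show "parts (N div 2) \<inter> ?B = {}"
  proof -
    have "0 \<le> last l" if "l \<in> parts (N div 2)" for l
      using split[of l] that by (auto simp: parts_def)
    then show ?thesis by force
  qed
  show "flip_last ` ?B \<subseteq> parts (N div 2)"
  proof (rule image_subsetI)
    fix l assume l: "l \<in> ?B"
    then obtain k x where "l = k @ [x]" using split[of l] by auto
    then show "flip_last l \<in> parts (N div 2)"
      using l by (auto simp: flip_last_def P)
  qed
  show "inj_on flip_last ?B"
  proof (rule inj_onI)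
    fix l m assume *: "l \<in> ?B" "m \<in> ?B"
      "flip_last l = flip_last m"
    then obtain k x k' x' where "l = k @ [x]" "m = k' @ [x']" using split[of l] split[of m] by auto
    then show "l = m" using *(3) by (simp add: flip_last_def)
  qed
qed

text \<open>At the last index i = N / 2 the linear coefficient N - 2 i vanishes and only the square
  of the last entry remains. The sign change is the action of the outer automorphism of SO(N) given
  by a reflection.\<close>

lemma weight_flip_last:
  assumes "length l = N div 2" "even N" "N \<ge> 2"
  shows "weight_size (flip_last l) = weight_size l" "weight_sum N 0 (flip_last l) = weight_sum N 0 l"
proof -
  have "l \<noteq> []" using assms by auto
  then obtain k x where l: "l = k @ [x]" by (metis append_butlast_last_id)
  show "weight_size (flip_last l) = weight_size l" by (simp add: l flip_last_def weight_size_def)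
  have N: "real N = 2 * real (length k) + 2" using assms l by (auto elim!: evenE)
  show "weight_sum N 0 (flip_last l) = weight_sum N 0 l"
    unfolding weight_sum_eq l flip_last_def by (simp add: nth_append N)
qed

text \<open>A weight with negative last entry has N / 2 entries of absolute value at least 1, so its
  size is at least N / 2 \<ge> X and it lies in the tail: only genuine partitions contribute to the
  main term. Through the flip these weights at most double the majorant, whence the factor
  2.\<close>

lemma D_error:
  assumes t: "t > 0" and N: "N \<ge> 6" "even N" and X: "X \<le> real N / 2"
  shows "\<bar>infsum (\<lambda>l. exp (- (t / 2) * weight_sum N 0 l)) (highest_weights TypeD N) -
    infsum (\<lambda>l. exp (- (t / 2) * weight_sum N 0 l)) {l \<in> parts (N div 2). weight_size l \<le> X}\<bar>
    \<le> 1 * (2 * parts_bound (t / 12)) * exp (- (t / 12) * X)"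
proof -
  let ?r = "N div 2" let ?A = "highest_weights TypeD N" let ?B = "{l \<in> ?A. last l < 0}"
  let ?h = "\<lambda>l. exp (- (t / 12) * weight_size l)"
  have N2: "N \<ge> 2" "N \<ge> 1" using N by auto
  note split = highest_weights_D_split[OF N2(1)]
  have len: "length l = ?r" if "l \<in> ?A" for l using that by simp
  have r: "real ?r = real N / 2" using N by (auto elim!: evenE)
  have hP: "?h summable_on parts ?r" "infsum ?h (parts ?r) \<le> parts_bound (t / 12)"
    using parts_summable[of "t / 12" ?r] t by auto
  have flip: "?h (flip_last l) = ?h l" if "l \<in> ?B" for l
  proof -
    have "l \<in> ?A" using that by blast
    then show ?thesis by (simp only: weight_flip_last(1)[OF len N(2) N2(1)])
  qed
  have hfB: "?h summable_on flip_last ` ?B" by (rule summable_on_subset[OF hP(1) split(3)])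
  then have hB: "?h summable_on ?B"
    unfolding summable_on_reindex[OF split(4)] by (rule summable_on_cong[THEN iffD1, rotated]) (simp only: o_apply flip)
  have "infsum ?h ?B = infsum (?h \<circ> flip_last) ?B" by (rule infsum_cong) (simp only: o_apply flip)
  also have "\<dots> = infsum ?h (flip_last ` ?B)" by (rule infsum_reindex[OF split(4), symmetric])
  also have "\<dots> \<le> infsum ?h (parts ?r)"
    using split(3) by (intro infsum_mono_neutral hfB hP) auto
  finally have hBle: "infsum ?h ?B \<le> parts_bound (t / 12)" using hP by simp
  have hA: "?h summable_on ?A"
    using summable_on_Un_disjoint[OF hP(1) hB split(2)] split(1) by metis
  have "infsum ?h ?A = infsum ?h (parts ?r) + infsum ?h ?B"
    using infsum_Un_disjoint[OF hP(1) hB split(2)] split(1) by metis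
  then have hAle: "infsum ?h ?A \<le> 2 * parts_bound (t / 12)" using hP hBle by simp
  have lower: "weight_size l / 3 \<le> weight_sum N 0 l" if "l \<in> parts ?r" for l
    using that N by (intro weight_sum_single_lower) (auto simp: r)
  have lower': "weight_size l / 3 \<le> weight_sum N 0 l" if l: "l \<in> ?A" for l
  proof (cases "l \<in> ?B")
    case True
    then show ?thesis using lower[of "flip_last l"] split(3) weight_flip_last[OF len[OF l] N(2) N2(1)] by auto
  next
    case False
    then show ?thesis using lower l split(1) by blast
  qed
  show ?thesis
  proof (rule exponential_tail_bound(2)[OF _ hA hAle])
    fix l assume l: "l \<in> ?A"
    show "exp (- (t / 2) * weight_sum N 0 l) \<le> 1 * exp (- (2 * (t / 12)) * weight_size l)"
      by (intro exp_single_bound t lower' l)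
  next
    fix l assume l: "l \<in> ?A" "l \<notin> {l \<in> parts ?r. weight_size l \<le> X}"
    show "X \<le> weight_size l"
    proof (cases "l \<in> ?B")
      case True
      have "1 \<le> \<bar>x\<bar>" if "x \<in> set l" for x
      proof -
        have "l \<noteq> []" using len[OF l(1)] N by auto
        then have "x \<in> set (butlast l) \<or> x = last l"
          using that by (metis append_butlast_last_id in_set_butlastD set_ConsD rotate1.simps(2) set_rotate1)
        then show ?thesis using True by auto
      qed
      then have "sum_list (map (\<lambda>_. 1) l) \<le> sum_list (map abs l)" by (intro sum_list_mono) auto
      then have "real ?r \<le> weight_size l" using len[OF l(1)]
        by (simp add: weight_size_def sum_list_triv)
      then show ?thesis using X r by simp
    next
      case False
      then show ?thesis using l split(1) by auto
    qed
  qed (use t split(1) in \<open>auto simp: weight_size_nonneg\<close>)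
qed

section \<open>Types A' and A\<close>

lemma summable_exp_abs_int:
  fixes s :: real
  assumes "s > 0"
  shows "(\<lambda>n::int. exp (- s * \<bar>real_of_int n\<bar>)) summable_on UNIV"
proof -
  let ?h = "\<lambda>n::int. exp (- s * \<bar>real_of_int n\<bar>)"
  have "(\<lambda>k. exp (- s) ^ k) summable_on (UNIV :: nat set)"
    using assms by (intro has_sum_imp_summable[OF has_sum_geometric]) auto
  moreover have "exp (- s) ^ k = exp (- s * real k)" for k
    by (simp add: exp_of_nat_mult[symmetric] mult.commute)
  ultimately have base: "(\<lambda>k. exp (- s * real k)) summable_on (UNIV :: nat set)" by simp
  have "?h summable_on range int"
    by (subst summable_on_reindex) (use base in \<open>auto simp: o_def\<close>)
  moreover have "?h summable_on range (\<lambda>k. - int k)"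
    by (subst summable_on_reindex) (use base in \<open>auto simp: o_def inj_on_def\<close>)
  moreover have "(UNIV :: int set) = range int \<union> range (\<lambda>k. - int k)"
  proof -
    have "n \<in> range int \<union> range (\<lambda>k. - int k)" for n by (cases n rule: int_cases2) auto
    then show ?thesis by blast
  qed
  ultimately show ?thesis using summable_on_union by metis
qed

text \<open>The bound is uniform in y because shifting n by the integer part of y reduces to 0 \<le>
  y < 1.\<close>

lemma gaussian_sum_bound:
  fixes t :: real
  assumes t: "t > 0"
  obtains C where "0 \<le> C"
    "\<And>y. (\<lambda>n::int. exp (- (t / 2) * (real_of_int n + y)\<^sup>2)) summable_on UNIV"
    "\<And>y. infsum (\<lambda>n::int. exp (- (t / 2) * (real_of_int n + y)\<^sup>2)) UNIV \<le> C"
proof -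
  let ?h = "\<lambda>n::int. exp (- (t / 2) * \<bar>real_of_int n\<bar>)"
  \<comment> \<open>The exponent is t/2 times 5/4: for u = n + frac y one has u^2 \<ge> |u| - 1/4
    and |u| \<ge> |n| - 1, so u^2 \<ge> |n| - 5/4.\<close>
  let ?c = "exp (5 * t / 8)"
  have h: "?h summable_on UNIV" using summable_exp_abs_int[of "t / 2"] t by simp
  have ch: "(\<lambda>n. ?c * ?h n) summable_on UNIV" by (rule summable_on_cmult_right[OF h])
  have *: "(\<lambda>n::int. exp (- (t / 2) * (real_of_int n + y)\<^sup>2)) summable_on UNIV \<and>
      infsum (\<lambda>n::int. exp (- (t / 2) * (real_of_int n + y)\<^sup>2)) UNIV \<le> ?c * infsum ?h UNIV" for y
  proof -
    let ?f = "\<lambda>n::int. exp (- (t / 2) * (real_of_int n + y)\<^sup>2)"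
    let ?g = "\<lambda>n::int. exp (- (t / 2) * (real_of_int n + frac y)\<^sup>2)"
    have bij: "bij_betw (\<lambda>n. n - \<lfloor>y\<rfloor>) UNIV (UNIV :: int set)"
      by (rule bij_betw_byWitness[where f' = "\<lambda>n. n + \<lfloor>y\<rfloor>"]) auto
    have fg: "?f (n - \<lfloor>y\<rfloor>) = ?g n" for n
      by (simp add: frac_def algebra_simps)
    have le: "?g n \<le> ?c * ?h n" for n
    proof -
      define u where "u = real_of_int n + frac y"
      have "(\<bar>u\<bar> - 1 / 2)\<^sup>2 \<ge> 0" by simp
      then have "\<bar>u\<bar> - 1 / 4 \<le> u\<^sup>2" by (simp add: power2_diff power_divide)
      moreover have "\<bar>real_of_int n\<bar> - 1 \<le> \<bar>u\<bar>"
        unfolding u_def using frac_ge_0[of y] frac_lt_1[of y] by linarith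
      ultimately have "\<bar>real_of_int n\<bar> - 5 / 4 \<le> u\<^sup>2" by simp
      then have "(t / 2) * (\<bar>real_of_int n\<bar> - 5 / 4) \<le> (t / 2) * u\<^sup>2" using t by (intro mult_left_mono) auto
      then have "- (t / 2) * u\<^sup>2 \<le> 5 * t / 8 + - (t / 2) * \<bar>real_of_int n\<bar>" by (simp add: algebra_simps)
      then show ?thesis unfolding u_def[symmetric] exp_add[symmetric] by simp
    qed
    have g: "?g summable_on UNIV" by (rule summable_on_comparison_test[OF ch]) (use le in auto)
    have "infsum ?g UNIV \<le> infsum (\<lambda>n. ?c * ?h n) UNIV" by (rule infsum_mono[OF g ch]) (use le in auto)
    also have "\<dots> = ?c * infsum ?h UNIV" by (rule infsum_cmult_right[OF h])
    finally have "infsum ?g UNIV \<le> ?c * infsum ?h UNIV" .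
    then show ?thesis
      using g infsum_reindex_bij_betw[OF bij, of ?f] summable_on_reindex_bij_betw[OF bij, of ?f]
      unfolding fg by simp
  qed
  show ?thesis
    by (rule that[of "?c * infsum ?h UNIV"]) (use * in \<open>auto intro!: mult_nonneg_nonneg infsum_nonneg\<close>)
qed

text \<open>The dependence of the type A' summand on the middle entry n; y stands for the difference
  of the two sizes divided by N.\<close>

definition theta_term :: "real \<Rightarrow> real \<Rightarrow> int \<Rightarrow> real" where
  "theta_term t y n = exp (- (t / 2) * ((real_of_int n)\<^sup>2 + 2 * real_of_int n * y))"

lemma theta_term_eq: "theta_term t y n = exp ((t / 2) * y\<^sup>2) * exp (- (t / 2) * (real_of_int n + y)\<^sup>2)"
  unfolding theta_term_def exp_add[symmetric] by (simp add: power2_sum algebra_simps)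

lemma theta_term_summable: "t > 0 \<Longrightarrow> theta_term t y summable_on UNIV"
proof -
  assume "t > 0"
  have "(\<lambda>n::int. exp (- (t / 2) * (real_of_int n + y)\<^sup>2)) summable_on UNIV"
    by (rule gaussian_sum_bound[OF \<open>t > 0\<close>])
  then have "(\<lambda>n. exp ((t / 2) * y\<^sup>2) * exp (- (t / 2) * (real_of_int n + y)\<^sup>2)) summable_on UNIV"
    by (rule summable_on_cmult_right)
  then show ?thesis unfolding theta_term_eq[abs_def] .
qed

text \<open>Averaging over n and - n turns the exponential of the linear term into cosh.\<close>

lemma theta_cosh:
  assumes t: "t > 0"
  shows "(\<Sum>\<^sub>\<infinity>n\<in>(UNIV :: int set). exp (- (t / 2) * (real_of_int n)\<^sup>2) * cosh (t * real_of_int n * y)) =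
    infsum (theta_term t y) UNIV"
proof -
  let ?S = "infsum (theta_term t y) UNIV"
  have 1: "(theta_term t y has_sum ?S) UNIV" using theta_term_summable[OF t] by simp
  have "bij_betw uminus UNIV (UNIV :: int set)" by (simp add: bij_uminus)
  from has_sum_reindex_bij_betw[OF this, of "theta_term t y" ?S] 1
  have "((\<lambda>n. theta_term t y (- n)) has_sum ?S) UNIV" by simp
  from has_sum_cmult_right[OF has_sum_add[OF 1 this], of "1 / 2"]
  have "((\<lambda>n. 1 / 2 * (theta_term t y n + theta_term t y (- n))) has_sum ?S) UNIV" by simp
  moreover have "1 / 2 * (theta_term t y n + theta_term t y (- n)) =
      exp (- (t / 2) * (real_of_int n)\<^sup>2) * cosh (t * real_of_int n * y)" for n
  proof -
    have "theta_term t y n = exp (- (t / 2) * (real_of_int n)\<^sup>2) * exp (- (t * real_of_int n * y))"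
      "theta_term t y (- n) = exp (- (t / 2) * (real_of_int n)\<^sup>2) * exp (t * real_of_int n * y)"
      unfolding theta_term_def exp_add[symmetric] by (simp_all add: algebra_simps)
    then show ?thesis by (simp add: cosh_def algebra_simps)
  qed
  ultimately show ?thesis by (simp add: infsumI)
qed

text \<open>Highest weight of the rational representation labelled by two partitions, twisted by the
  n-th power of the determinant; the explicit middle entry makes n recoverable from the
  weight.\<close>

definition rational_weight :: "int list \<Rightarrow> int list \<Rightarrow> int \<Rightarrow> int list" where
  "rational_weight k l n = map ((+) n) (k @ [0] @ rev (map uminus l))"

lemma bij_betw_rational_weight:
  assumes N: "N = L + 1 + L'"
  shows "bij_betw (\<lambda>((k, l), n). rational_weight k l n) ((parts L \<times> parts L') \<times> UNIV) (highest_weights TypeA' N)"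
proof (rule bij_betw_byWitness[where f' = "\<lambda>w. ((map (\<lambda>x. x - w ! L) (take L w), map (\<lambda>x. w ! L - x) (rev (drop (Suc L) w))), w ! L)"])
  let ?f = "\<lambda>((k, l), n). rational_weight k l n"
  let ?g = "\<lambda>w. ((map (\<lambda>x. x - w ! L) (take L w), map (\<lambda>x. w ! L - x) (rev (drop (Suc L) w))), w ! L)"
  show "\<forall>p\<in>(parts L \<times> parts L') \<times> UNIV. ?g (?f p) = p"
    by (auto simp: rational_weight_def parts_def nth_append rev_map o_def intro!: map_idI)
  have split: "w = take L w @ [w ! L] @ drop (Suc L) w" if "w \<in> highest_weights TypeA' N" for w
    using that N by (simp add: id_take_nth_drop[symmetric])
  show "\<forall>w\<in>highest_weights TypeA' N. ?f (?g w) = w"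
  proof
    fix w assume "w \<in> highest_weights TypeA' N"
    then show "?f (?g w) = w"
      using split[of w] by (simp add: rational_weight_def rev_map o_def)
  qed
  show "?f ` ((parts L \<times> parts L') \<times> UNIV) \<subseteq> highest_weights TypeA' N"
  proof clarify
    fix k l n assume kl: "k \<in> parts L" "l \<in> parts L'"
    have "sorted_wrt (\<lambda>x y. y \<le> x) (rev (map uminus l))"
      using kl by (auto simp: parts_def nonincreasing_def sorted_wrt_rev sorted_wrt_map)
    moreover have "\<And>x y. x \<in> set k \<Longrightarrow> y \<in> set l \<Longrightarrow> - y \<le> x"
      using kl by (force simp: parts_def)
    ultimately show "rational_weight k l n \<in> highest_weights TypeA' N"
      using kl N by (auto simp: rational_weight_def parts_def nonincreasing_def sorted_wrt_append sorted_wrt_map)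
  qed
  show "?g ` highest_weights TypeA' N \<subseteq> (parts L \<times> parts L') \<times> UNIV"
  proof (rule image_subsetI)
    fix w assume w: "w \<in> highest_weights TypeA' N"
    define a b c where "a = take L w" and "b = w ! L" and "c = drop (Suc L) w"
    have "w = a @ [b] @ c" using split[OF w] by (simp add: a_def b_def c_def)
    then have "sorted_wrt (\<ge>) (a @ [b] @ c)" using w by (simp add: nonincreasing_def)
    then have ab: "sorted_wrt (\<ge>) a" "sorted_wrt (\<ge>) c" "\<forall>x\<in>set a. b \<le> x" "\<forall>x\<in>set c. x \<le> b"
      unfolding sorted_wrt_append by auto
    have len: "length a = L" "length c = L'" using w N by (auto simp: a_def c_def)
    have "map (\<lambda>x. x - b) a \<in> parts L"
      using ab len by (auto simp: parts_def nonincreasing_def sorted_wrt_map)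
    moreover have "map (\<lambda>x. b - x) (rev c) \<in> parts L'"
      using ab len by (auto simp: parts_def nonincreasing_def sorted_wrt_map sorted_wrt_rev)
    ultimately show "?g w \<in> (parts L \<times> parts L') \<times> UNIV" by (simp add: a_def b_def c_def)
  qed
qed

lemma sum_nth_append:
  "(\<Sum>i<length (xs @ ys). f i ((xs @ ys) ! i)) =
    (\<Sum>i<length xs. f i (xs ! i)) + (\<Sum>i<length ys. f (length xs + i) (ys ! i) :: 'b :: comm_monoid_add)"
proof (induction ys rule: rev_induct)
  case (snoc y ys)
  have "(\<Sum>i<length (xs @ ys @ [y]). f i ((xs @ ys @ [y]) ! i)) =
      (\<Sum>i<length (xs @ ys). f i (((xs @ ys) @ [y]) ! i)) + f (length (xs @ ys)) y"
    by (simp add: nth_append)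
  also have "(\<Sum>i<length (xs @ ys). f i (((xs @ ys) @ [y]) ! i)) = (\<Sum>i<length (xs @ ys). f i ((xs @ ys) ! i))"
    by (rule sum.cong) (auto simp: nth_append)
  also have "(\<Sum>i<length ys. f (length xs + i) (ys ! i)) + f (length (xs @ ys)) y =
     (\<Sum>i<length (ys @ [y]). f (length xs + i) ((ys @ [y]) ! i))"
    by (simp add: nth_append)
  ultimately show ?case using snoc by (simp add: add.assoc)
qed simp

lemma sum_list_rational_weight:
  assumes "k \<in> parts L" "l \<in> parts L'" "N = L + 1 + L'"
  shows "real_of_int (sum_list (rational_weight k l n)) = weight_size k - weight_size l + real N * real_of_int n"
proof -
  have shift: "sum_list (map ((+) n) m) = sum_list m + int (length m) * n" for m
    by (induction m) (auto simp: algebra_simps)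
  have neg: "sum_list (map uminus m) = - sum_list m" for m :: "int list"
    by (induction m) auto
  have "sum_list (rational_weight k l n) = sum_list k - sum_list l + int N * n"
    unfolding rational_weight_def shift using assms by (simp add: neg parts_def algebra_simps)
  then show ?thesis using weight_size_parts[OF assms(1)] weight_size_parts[OF assms(2)] by simp
qed

text \<open>Before division by N, shifting all entries by n costs N n^2, a cross term with the total
  of the entries, and a linear term that vanishes because the coefficients N - 1 - 2 i sum to
  zero.\<close>

lemma weight_sum_rational_weight:
  assumes k: "k \<in> parts L" and l: "l \<in> parts L'" and N: "N = L + 1 + L'"
  shows "weight_sum N 1 (rational_weight k l n) = weight_sum N 1 k + weight_sum N 1 l +
    ((real_of_int n)\<^sup>2 + 2 * real_of_int n * ((weight_size k - weight_size l) / real N))"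
proof -
  define f where "f = (\<lambda>i x. real_of_int x * (real_of_int x + real N - 1 - 2 * real i))"
  have W: "weight_sum N 1 m = (\<Sum>i<length m. f i (m ! i)) / real N" for m
    unfolding weight_sum_eq f_def by simp
  let ?m = "k @ [0] @ rev (map uminus l)"
  have len: "length k = L" "length l = L'" "length ?m = N" using k l N by (auto simp: parts_def)
  have c: "(\<Sum>i<M. real M - 1 - 2 * real i) = 0" for M
  proof (induction M)
    case (Suc M)
    have "(\<Sum>i<Suc M. real (Suc M) - 1 - 2 * real i) = (\<Sum>i<M. (real M - 1 - 2 * real i) + 1) + (real M - 2 * real M)"
      by (simp add: algebra_simps)
    then show ?case unfolding sum.distrib Suc by simp
  qed simp
  have "(\<Sum>i<N. f i (rational_weight k l n ! i)) = (\<Sum>i<N. f i (?m ! i) + 2 * real_of_int n * real_of_int (?m ! i)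
      + (real_of_int n)\<^sup>2 + real_of_int n * (real N - 1 - 2 * real i))"
  proof (rule sum.cong)
    fix i assume "i \<in> {..<N}"
    then have "rational_weight k l n ! i = n + ?m ! i"
      using len by (simp add: rational_weight_def del: map_append)
    then show "f i (rational_weight k l n ! i) = f i (?m ! i) + 2 * real_of_int n * real_of_int (?m ! i)
      + (real_of_int n)\<^sup>2 + real_of_int n * (real N - 1 - 2 * real i)"
      by (simp only: f_def of_int_add) (simp add: algebra_simps power2_eq_square)
  qed simp
  also have "\<dots> = (\<Sum>i<N. f i (?m ! i)) + 2 * real_of_int n * (\<Sum>i<N. real_of_int (?m ! i))
      + real N * (real_of_int n)\<^sup>2 + real_of_int n * (\<Sum>i<N. real N - 1 - 2 * real i)"
    by (simp only: sum.distrib sum_distrib_left[symmetric]) simp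
  also have "(\<Sum>i<N. real N - 1 - 2 * real i) = 0" by (rule c)
  also have "(\<Sum>i<N. real_of_int (?m ! i)) = weight_size k - weight_size l"
  proof -
    have "map ((+) 0) ?m = ?m" by (rule map_idI) simp
    then have "rational_weight k l 0 = ?m" by (simp only: rational_weight_def)
    then show ?thesis using sum_list_rational_weight[OF k l N, of 0] sum_list_lessThan[of ?m]
      by (simp only: len(3) of_int_0 mult_zero_right add_0_right)
  qed
  also have "(\<Sum>i<N. f i (?m ! i)) = (\<Sum>i<L. f i (k ! i)) + (\<Sum>i<L'. f i (l ! i))"
  proof -
    have "(\<Sum>i<N. f i (?m ! i)) = (\<Sum>i<L. f i (k ! i)) + (\<Sum>i<L'. f (Suc (L + i)) (rev (map uminus l) ! i))"
    proof -
      define r where "r = rev (map uminus l)"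
      have r: "length r = L'" "length (k @ [0] @ r) = N" using len by (auto simp: r_def)
      have f0: "(\<Sum>i<length [0::int]. f (L + i) ([0] ! i)) = 0" by (simp add: f_def)
      have "(\<Sum>i<N. f i ((k @ [0] @ r) ! i)) =
          (\<Sum>i<L. f i (k ! i)) + (\<Sum>i<length ([0] @ r). f (L + i) (([0] @ r) ! i))"
        using sum_nth_append[of f k "[0] @ r"] unfolding r len(1) .
      also have "(\<Sum>i<length ([0] @ r). f (L + i) (([0] @ r) ! i)) = (\<Sum>i<L'. f (Suc (L + i)) (r ! i))"
        using sum_nth_append[of "\<lambda>i. f (L + i)" "[0]" r] unfolding f0 r by simp
      finally show ?thesis unfolding r_def .
    qed
    \<comment> \<open>Passage to the dual representation: position N - 1 - i with entry - x gives
      the same value of \<open>f\<close> as position i with entry x.\<close>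
    also have "(\<Sum>i<L'. f (Suc (L + i)) (rev (map uminus l) ! i)) =
        (\<Sum>i<L'. f (Suc (L + (L' - Suc i))) (rev (map uminus l) ! (L' - Suc i)))"
      by (rule sum.nat_diff_reindex[symmetric])
    also have "\<dots> = (\<Sum>i<L'. f i (l ! i))"
    proof (rule sum.cong)
      fix i assume "i \<in> {..<L'}"
      then have "rev (map uminus l) ! (L' - Suc i) = - (l ! i)" "real (Suc (L + (L' - Suc i))) = real N - 1 - real i"
        using len N by (auto simp: rev_nth of_nat_diff)
      then show "f (Suc (L + (L' - Suc i))) (rev (map uminus l) ! (L' - Suc i)) = f i (l ! i)"
        by (simp only: f_def of_int_minus) (simp add: algebra_simps)
    qed simp
    finally show ?thesis .
  qed
  finally have "(\<Sum>i<N. f i (rational_weight k l n ! i)) = (\<Sum>i<L. f i (k ! i)) + (\<Sum>i<L'. f i (l ! i))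
    + 2 * real_of_int n * (weight_size k - weight_size l) + real N * (real_of_int n)\<^sup>2" by simp
  moreover have "length (rational_weight k l n) = N" using len by (simp add: rational_weight_def)
  ultimately show ?thesis unfolding W using len N by (simp add: add_divide_distrib)
qed

text \<open>Common to A' and A: the growth allowed to \<phi> in the difference of sizes is exactly
  the negative square that \<open>weight_sum_pair_lower\<close> absorbs. Outside the truncation one
  of the two sizes exceeds X, hence so does their sum.\<close>

lemma double_error:
  fixes \<phi> :: "nat \<Rightarrow> nat \<Rightarrow> real"
  assumes t: "t > 0" and N: "N \<ge> 1" and L: "2 * L \<le> N" "2 * L' \<le> N"
    and X: "0 \<le> X" "nat \<lfloor>X\<rfloor> \<le> L" "nat \<lfloor>X\<rfloor> \<le> L'"
    and \<Phi>: "\<And>Y Z. \<Phi> Y Z = \<phi> (cover_deg Y) (cover_deg Z)"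
    and \<phi>: "\<And>m n. 0 \<le> \<phi> m n"
      "\<And>m n. \<phi> m n \<le> K * exp ((t / 2) * ((real m - real n) / real N)\<^sup>2)" and K: "0 \<le> K"
  defines "G \<equiv> \<lambda>(k, l). \<phi> (nat (sum_list k)) (nat (sum_list l)) *
      (exp (- (t / 2) * weight_sum N 1 k) * exp (- (t / 2) * weight_sum N 1 l))"
  shows "G summable_on parts L \<times> parts L'"
    and "\<bar>infsum G (parts L \<times> parts L') -
      (\<integral>(Y, Z). of_bool (real (cover_deg Y) \<le> X \<and> real (cover_deg Z) \<le> X) * \<Phi> Y Z
        * real N powi (cover_euler Y + cover_euler Z) \<partial>(hurwitz_measure t \<Otimes>\<^sub>M hurwitz_measure t))\<bar>
      \<le> K * (parts_bound (t / 8))\<^sup>2 * exp (- (t / 8) * X)"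
proof -
  let ?I = "(\<integral>(Y, Z). of_bool (real (cover_deg Y) \<le> X \<and> real (cover_deg Z) \<le> X) * \<Phi> Y Z
      * real N powi (cover_euler Y + cover_euler Z) \<partial>(hurwitz_measure t \<Otimes>\<^sub>M hurwitz_measure t))"
  let ?P = "parts L \<times> parts L'"
  let ?T1 = "\<lambda>L. {l. l \<in> parts L \<and> weight_size l \<le> X}"
  let ?T = "?T1 L \<times> ?T1 L'"
  let ?e = "\<lambda>l. exp (- (t / 2) * weight_sum N 1 l)"
  have fin: "finite (?T1 L)" for L using truncated_parts(2)[OF X(1)] by simp
  have "?I =
      (\<Sum>m\<le>nat \<lfloor>X\<rfloor>. \<Sum>n\<le>nat \<lfloor>X\<rfloor>. \<phi> m n * (slice_mass L t N m * slice_mass L' t N n))"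
    by (rule integral_double_truncated[where \<Phi> = \<Phi> and \<phi> = \<phi>, OF t N X(2,3,1)]) (rule \<Phi>)
  also have "\<dots> = (\<Sum>m\<le>nat \<lfloor>X\<rfloor>. (\<Sum>n\<le>nat \<lfloor>X\<rfloor>. \<phi> m n * slice_mass L' t N n) * slice_mass L t N m)"
    unfolding sum_distrib_right by (simp add: mult_ac)
  also have "\<dots> = (\<Sum>k\<in>?T1 L. (\<Sum>l\<in>?T1 L'. \<phi> (nat (sum_list k)) (nat (sum_list l)) * ?e l) * ?e k)"
    unfolding sum_slice_mass[OF N X(1)] ..
  also have "\<dots> = sum G ?T"
    unfolding G_def sum.cartesian_product[symmetric] sum_distrib_right by (simp add: mult_ac)
  also have "\<dots> = infsum G ?T" using fin by simp
  finally have int: "?I = infsum G ?T" .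
  let ?size = "\<lambda>(k, l). weight_size k + weight_size l"
  have t8: "t / 8 > 0" using t by simp
  have h: "(\<lambda>p. exp (- (t / 8) * ?size p)) summable_on ?P"
    "infsum (\<lambda>p. exp (- (t / 8) * ?size p)) ?P \<le> (parts_bound (t / 8))\<^sup>2"
    using parts_pair_summable[OF t8, of L L'] by (simp_all add: split_def)
  have G: "G p \<le> K * exp (- (2 * (t / 8)) * ?size p)" if p: "p \<in> ?P" for p
  proof -
    obtain k l where kl: "p = (k, l)" "k \<in> parts L" "l \<in> parts L'" using p by auto
    have nat: "real (nat (sum_list k)) = weight_size k" "real (nat (sum_list l)) = weight_size l"
      using weight_size_parts[OF kl(2)] weight_size_parts[OF kl(3)] weight_size_nonneg[of k] weight_size_nonneg[of l] by auto
    have "G p \<le> (K * exp ((t / 2) * ((weight_size k - weight_size l) / real N)\<^sup>2)) * (?e k * ?e l)"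
      unfolding G_def kl(1) prod.case
      using \<phi>(2)[of "nat (sum_list k)" "nat (sum_list l)"] unfolding nat by (rule mult_right_mono) auto
    also have "\<dots> = K * exp (- (t / 2) * (weight_sum N 1 k + weight_sum N 1 l - (weight_size k - weight_size l)\<^sup>2 / (real N)\<^sup>2))"
      unfolding mult.assoc exp_add[symmetric] by (simp add: algebra_simps power_divide)
    also have "\<dots> \<le> K * exp (- (2 * (t / 8)) * ?size p)"
    proof -
      have "(t / 2) * ((weight_size k + weight_size l) / 2) \<le> (t / 2) *
          (weight_sum N 1 k + weight_sum N 1 l - (weight_size k - weight_size l)\<^sup>2 / (real N)\<^sup>2)"
        using t weight_sum_pair_lower[OF kl(2,3) N L] by (intro mult_left_mono) auto
      then show ?thesis unfolding kl(1) prod.case using K by (intro mult_left_mono) auto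
    qed
    finally show ?thesis .
  qed
  have T: "?T \<subseteq> ?P" by auto
  have T': "X \<le> ?size p" if "p \<in> ?P" "p \<notin> ?T" for p
  proof -
    obtain k l where "p = (k, l)" by (cases p)
    then show ?thesis using that weight_size_nonneg[of k] weight_size_nonneg[of l] by auto
  qed
  have G0: "0 \<le> G p" for p unfolding G_def using \<phi>(1) by (simp add: split_def)
  have S0: "0 \<le> ?size p" for p using weight_size_nonneg by (simp add: split_def)
  note E = exponential_tail_bound[OF t8 h S0 G0 G K T T']
  show "G summable_on ?P" by (rule E(1))
  show "\<bar>infsum G ?P - ?I\<bar>
      \<le> K * (parts_bound (t / 8))\<^sup>2 * exp (- (t / 8) * X)"
    unfolding int by (rule E(2))
qed

section \<open>Heat traces\<close>

lemma mat_adjoint_one: "mat_adjoint (1\<^sub>m n :: complex mat) = 1\<^sub>m n"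
proof (rule eq_matI)
  fix i j assume "i < dim_row (1\<^sub>m n :: complex mat)" "j < dim_col (1\<^sub>m n :: complex mat)"
  then show "mat_adjoint (1\<^sub>m n :: complex mat) $$ (i, j) = 1\<^sub>m n $$ (i, j)"
    by (auto simp: mat_adjoint_def mat_of_rows_def)
qed (auto simp: mat_adjoint_def)

lemma one_in_unitary_group: "1\<^sub>m n \<in> unitary_group n"
  by (simp add: unitary_group_def mat_adjoint_one)

lemma one_in_classical_group:
  assumes "admissible \<tau> N"
  shows "1\<^sub>m N \<in> classical_group \<tau> N"
proof (cases \<tau>)
  case TypeC
  then obtain r where r: "N = 2 * r" using assms by (auto elim!: evenE)
  have J: "symplectic_form r \<in> carrier_mat (2 * r) (2 * r)"
    by (auto simp: symplectic_form_def mult_2)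
  then show ?thesis
    using one_in_unitary_group[of "2 * r"] by (simp add: TypeC r compact_symplectic_group_def)
qed (use one_in_unitary_group in \<open>auto simp: special_unitary_group_def special_orthogonal_group_def\<close>)

text \<open>At the identity the character is the dimension d \<ge> 1, so the eigenvalue is unique
  and the description in \<open>c2\<close> is well defined.\<close>

lemma c2_eq_casimir_eigenvalue:
  assumes V: "V \<in> group_dual N G" and one: "1\<^sub>m N \<in> G" and c: "casimir_eigenvalue N G ip V c"
  shows "c2 N G ip V = c"
proof -
  obtain R where R: "R \<in> irreducible_reps N G" "V = rep_equivalence N G `` {R}"
    using V by (auto simp: group_dual_def elim: quotientE)
  obtain d \<rho> where d: "R = (d, \<rho>)" by (cases R)
  have car: "\<rho> g \<in> carrier_mat d d" if "g \<in> G" for g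
    using R(1) that by (auto simp: d irreducible_reps_def continuous_rep_def)
  have "(R, R) \<in> rep_equivalence N G"
  proof -
    have "\<forall>g\<in>G. 1\<^sub>m d * \<rho> g = \<rho> g * 1\<^sub>m d"
      using left_mult_one_mat[OF car] right_mult_one_mat[OF car] by simp
    moreover have "invertible_mat (1\<^sub>m d :: complex mat)"
      by (auto simp: invertible_mat_def inverts_mat_def intro!: exI[of _ "1\<^sub>m d"])
    ultimately show ?thesis using R(1) by (auto simp: rep_equivalence_def d intro!: bexI[of _ "1\<^sub>m d"])
  qed
  then have RV: "R \<in> V" using R(2) by auto
  have "rep_character R (1\<^sub>m N) = of_nat d" "d \<ge> 1"
    using R(1) by (auto simp: d irreducible_reps_def continuous_rep_def rep_character_def mat_trace_def)
  then have nz: "rep_character R (1\<^sub>m N) \<noteq> 0" by auto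
  show ?thesis unfolding c2_def
  proof (rule the_equality)
    fix c' assume "casimir_eigenvalue N G ip V c'"
    then have "- complex_of_real c' * rep_character R (1\<^sub>m N) = - complex_of_real c * rep_character R (1\<^sub>m N)"
      using c RV one unfolding casimir_eigenvalue_def by metis
    then show "c' = c" using nz by simp
  qed (rule c)
qed

lemma central_heat_trace_weights:
  assumes "admissible \<tau> N" "normalized_inner_product \<tau> N ip"
  shows "central_heat_trace N (classical_group \<tau> N) ip t =
    infsum (\<lambda>l. exp (- (t / 2) * casimir_number \<tau> N l)) (highest_weights \<tau> N)"
proof -
  let ?G = "classical_group \<tau> N"
  obtain V where V: "bij_betw V (highest_weights \<tau> N) (group_dual N ?G)"
    "\<And>l. l \<in> highest_weights \<tau> N \<Longrightarrow> casimir_eigenvalue N ?G ip (V l) (casimir_number \<tau> N l)"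
    using assms(2) by (auto simp: normalized_inner_product_def)
  have "central_heat_trace N ?G ip t = infsum (\<lambda>l. exp (- (t / 2) * c2 N ?G ip (V l))) (highest_weights \<tau> N)"
    unfolding central_heat_trace_def by (rule infsum_reindex_bij_betw[OF V(1), symmetric])
  also have "\<dots> = infsum (\<lambda>l. exp (- (t / 2) * casimir_number \<tau> N l)) (highest_weights \<tau> N)"
    by (rule infsum_cong)
      (simp add: c2_eq_casimir_eigenvalue[OF bij_betw_apply[OF V(1)] one_in_classical_group[OF assms(1)] V(2)])
  finally show ?thesis .
qed

section \<open>Truncation level and assembly by type\<close>

lemma powr_eventually_small:
  fixes \<gamma> :: real
  assumes "\<gamma> \<in> {0<..<1}"
  shows "\<exists>N\<^sub>0::nat. \<forall>N\<ge>N\<^sub>0. N \<ge> 6 \<and> real N powr \<gamma> \<le> real N / 2 - 1"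
proof -
  \<comment> \<open>N \<ge> 4 powr (1 / (1 - \<gamma>)) gives N powr (1 - \<gamma>) \<ge> 4, so N
    powr \<gamma> \<le> N / 4, which is at most N / 2 - 1 once N \<ge> 4.\<close>
  define M where "M = nat \<lceil>(4 :: real) powr (1 / (1 - \<gamma>))\<rceil>"
  have "N \<ge> 6 \<and> real N powr \<gamma> \<le> real N / 2 - 1" if "N \<ge> max 6 M" for N
  proof -
    have N: "real N \<ge> 6" "N \<ge> M" using that by auto
    have "4 powr (1 / (1 - \<gamma>)) \<le> real N" using N(2) unfolding M_def by linarith
    then have "(4 powr (1 / (1 - \<gamma>))) powr (1 - \<gamma>) \<le> real N powr (1 - \<gamma>)"
      using assms by (intro powr_mono2) auto
    then have "4 \<le> real N powr (1 - \<gamma>)" using assms by (simp add: powr_powr)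
    then have "real N powr \<gamma> * 4 \<le> real N powr \<gamma> * real N powr (1 - \<gamma>)" by (intro mult_left_mono) auto
    also have "\<dots> = real N" using N by (simp add: powr_add[symmetric])
    finally show ?thesis using N by simp
  qed
  then show ?thesis by blast
qed

text \<open>The \<open>- 1\<close> makes room for the smaller length (N - 1) div 2: the rank in type
  B and the length of the lower partition in types A' and A.\<close>

lemma nat_floor_le_half:
  assumes "0 \<le> X" "X \<le> real N / 2 - 1"
  shows "nat \<lfloor>X\<rfloor> \<le> (N - 1) div 2" "nat \<lfloor>X\<rfloor> \<le> N div 2"
proof -
  have "real (nat \<lfloor>X\<rfloor>) \<le> X" using assms by simp
  then have "2 * nat \<lfloor>X\<rfloor> + 2 \<le> N" using assms by linarith
  then show "nat \<lfloor>X\<rfloor> \<le> (N - 1) div 2" "nat \<lfloor>X\<rfloor> \<le> N div 2" by linarith+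
qed

lemma single_type_error:
  assumes \<tau>: "\<tau> \<in> {TypeB, TypeC, TypeD}" and adm: "admissible \<tau> N" and ip: "normalized_inner_product \<tau> N ip"
    and t: "t > 0" and N: "N \<ge> 6" and X: "0 \<le> X" "X \<le> real N / 2 - 1"
  shows "\<bar>central_heat_trace N (classical_group \<tau> N) ip t -
    (\<integral>Y. of_bool (real (cover_deg Y) \<le> X) * \<Phi>_single \<tau> t N Y * real N powi (cover_euler Y) \<partial>(hurwitz_measure t))\<bar>
    \<le> 2 * parts_bound (t / 12) * exp (- (t / 12) * X)"
proof -
  let ?I = "\<integral>Y. of_bool (real (cover_deg Y) \<le> X)
    * \<Phi>_single \<tau> t N Y * real N powi (cover_euler Y) \<partial>(hurwitz_measure t)"
  have N1: "N \<ge> 1" using N by simp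
  note fl = nat_floor_le_half[OF X]
  \<comment> \<open>Types B and C come with the factor 1; the common factor 2 is that of type
    D.\<close>
  have pb: "1 * parts_bound (t / 12) * exp (- (t / 12) * X) \<le> 2 * parts_bound (t / 12) * exp (- (t / 12) * X)"
    by (intro mult_right_mono) (auto simp: parts_bound_def)
  show ?thesis
  proof (cases \<tau>)
    case TypeB
    let ?L = "(N - 1) div 2"
    have hw: "highest_weights TypeB N = parts ?L" by (auto simp: parts_def)
    have "2 * ?L + 1 \<le> N" using N by simp
    then have "real (2 * ?L + 1) \<le> real N" by (rule of_nat_mono)
    then have "real ?L \<le> (real N - 1) / 2" by (simp only: of_nat_add of_nat_mult) simp
    then have "real N / 3 \<le> real N + real_of_int 0 - 1 - real ?L" using N by simp
    note err = single_error[OF t N1 this, of X]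
    have int: "?I =
      infsum (\<lambda>l. exp (- (t / 2) * weight_sum N 0 l)) {l \<in> parts ?L. weight_size l \<le> X}"
      by (rule integral_single_parts[OF t N1 X(1) fl(1)]) (simp add: \<Phi>_single_def TypeB)
    show ?thesis
      unfolding central_heat_trace_weights[OF adm ip] int
      using err pb unfolding TypeB hw casimir_number.simps by (rule order_trans)
  next
    case TypeC
    let ?L = "N div 2"
    have hw: "highest_weights TypeC N = parts ?L" by (auto simp: parts_def)
    have "real ?L \<le> real N / 2" using N by linarith
    then have "real N / 3 \<le> real N + real_of_int 2 - 1 - real ?L" using N by simp
    note err = single_error[OF t N1 this, of X]
    have int: "?I =
      infsum (\<lambda>l. exp (- (t / 2) * weight_sum N 2 l)) {l \<in> parts ?L. weight_size l \<le> X}"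
      by (rule integral_single_parts[OF t N1 X(1) fl(2)]) (simp add: \<Phi>_single_def TypeC)
    show ?thesis
      unfolding central_heat_trace_weights[OF adm ip] int
      using err pb unfolding TypeC hw casimir_number.simps by (rule order_trans)
  next
    case TypeD
    let ?L = "N div 2"
    have "even N" using adm TypeD by simp
    note err = D_error[OF t N this, of X]
    have int: "?I =
      infsum (\<lambda>l. exp (- (t / 2) * weight_sum N 0 l)) {l \<in> parts ?L. weight_size l \<le> X}"
      by (rule integral_single_parts[OF t N1 X(1) fl(2)]) (simp add: \<Phi>_single_def TypeD)
    show ?thesis
      unfolding central_heat_trace_weights[OF adm ip] int
      using err X unfolding TypeD casimir_number.simps by simp
  qed (use \<tau> in auto)
qed

lemma half_split:
  fixes N :: nat
  assumes "N \<ge> 1"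
  shows "N = N div 2 + 1 + (N - 1) div 2" "2 * (N div 2) \<le> N" "2 * ((N - 1) div 2) \<le> N"
  using assms by presburger+

lemma parts_nat_size: "l \<in> parts L \<Longrightarrow> real (nat (sum_list l)) = weight_size l"
  using weight_size_parts[of l L] weight_size_nonneg[of l] by auto

text \<open>The sum over n is taken first: after the two Casimir factors are taken out it depends on
  the partitions only through the difference of their sizes, as \<Phi> does.\<close>

lemma type_A'_error:
  assumes adm: "admissible TypeA' N" and ip: "normalized_inner_product TypeA' N ip"
    and t: "t > 0" and N: "N \<ge> 6" and X: "0 \<le> X" "X \<le> real N / 2 - 1"
    and C: "0 \<le> C" "\<And>y. infsum (\<lambda>n::int. exp (- (t / 2) * (real_of_int n + y)\<^sup>2)) UNIV \<le> C"
  shows "\<bar>central_heat_trace N (classical_group TypeA' N) ip t -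
    (\<integral>(Y, Z). of_bool (real (cover_deg Y) \<le> X \<and> real (cover_deg Z) \<le> X) * \<Phi>_double TypeA' t N Y Z
      * real N powi (cover_euler Y + cover_euler Z) \<partial>(hurwitz_measure t \<Otimes>\<^sub>M hurwitz_measure t))\<bar>
    \<le> C * (parts_bound (t / 8))\<^sup>2 * exp (- (t / 8) * X)"
proof -
  let ?L = "N div 2" and ?L' = "(N - 1) div 2"
  have N1: "N \<ge> 1" using N by simp
  note half = half_split[OF N1] and fl = nat_floor_le_half[OF X]
  define \<phi> where "\<phi> m n = infsum (theta_term t ((real m - real n) / real N)) UNIV" for m n
  have \<Phi>: "\<Phi>_double TypeA' t N Y Z = \<phi> (cover_deg Y) (cover_deg Z)" for Y Z
    unfolding \<phi>_def theta_cosh[OF t, symmetric] \<Phi>_double_def by simp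
  have \<phi>0: "0 \<le> \<phi> m n" for m n
    unfolding \<phi>_def by (rule infsum_nonneg) (simp add: theta_term_def)
  \<comment> \<open>Completing the square splits off the exponential; the Gaussian sum that remains
    is shifted by y, and C bounds it for all shifts at once.\<close>
  have \<phi>C: "\<phi> m n \<le> C * exp ((t / 2) * ((real m - real n) / real N)\<^sup>2)" for m n
    unfolding \<phi>_def theta_term_eq[abs_def] infsum_cmult_right'
    using C(2) by (subst mult.commute) (intro mult_right_mono, auto)
  note E = double_error[where \<Phi> = "\<Phi>_double TypeA' t N" and \<phi> = \<phi>, OF t N1 half(2,3) X(1) fl(2,1) \<Phi> \<phi>0 \<phi>C C(1)]
  let ?e = "\<lambda>l. exp (- (t / 2) * weight_sum N 1 l)"
  let ?G = "\<lambda>(k, l). \<phi> (nat (sum_list k)) (nat (sum_list l)) * (?e k * ?e l)"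
  let ?P = "parts ?L \<times> parts ?L'"
  let ?F = "\<lambda>((k, l), n). ?e (rational_weight k l n)"
  have inner: "((\<lambda>n. ?F (p, n)) has_sum ?G p) UNIV" if p: "p \<in> ?P" for p
  proof -
    obtain k l where kl: "p = (k, l)" "k \<in> parts ?L" "l \<in> parts ?L'" using p by auto
    let ?y = "(weight_size k - weight_size l) / real N"
    have "?e (rational_weight k l n) = ?e k * ?e l * theta_term t ?y n" for n
      unfolding weight_sum_rational_weight[OF kl(2,3) half(1)] theta_term_def exp_add[symmetric]
      by (simp add: algebra_simps)
    moreover have "((\<lambda>n. ?e k * ?e l * theta_term t ?y n) has_sum (?e k * ?e l * infsum (theta_term t ?y) UNIV)) UNIV"
      using theta_term_summable[OF t] by (intro has_sum_cmult_right) simp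
    ultimately show ?thesis
      using parts_nat_size[OF kl(2)] parts_nat_size[OF kl(3)] by (simp add: kl(1) \<phi>_def mult.commute)
  qed
  have outer: "(?G has_sum infsum ?G ?P) ?P" using E(1) by (rule has_sum_infsum)
  have "(?F has_sum infsum ?G ?P) (?P \<times> UNIV)"
    by (rule has_sum_SigmaI[OF inner outer summable_on_SigmaI[OF inner E(1)]]) auto
  then have "infsum ?F (?P \<times> UNIV) = infsum ?G ?P" by (rule infsumI)
  moreover have "infsum ?F (?P \<times> UNIV) = infsum ?e (highest_weights TypeA' N)"
    using infsum_reindex_bij_betw[OF bij_betw_rational_weight[OF half(1)], of ?e] by (simp add: split_def)
  ultimately have "central_heat_trace N (classical_group TypeA' N) ip t = infsum ?G ?P"
    unfolding central_heat_trace_weights[OF adm ip] by simp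
  then show ?thesis using E(2) by simp
qed

text \<open>The last entry of a unitary weight is n minus the largest part of the lower partition;
  normalising it to 0 forces n = \<open>l ! 0\<close>, a part that exists because L' \<ge>
  1.\<close>

lemma bij_betw_special_weight:
  assumes N: "N = L + 1 + L'" and L': "L' \<ge> 1"
  shows "bij_betw (\<lambda>(k, l). rational_weight k l (l ! 0)) (parts L \<times> parts L') (highest_weights TypeA N)"
proof -
  note bij = bij_betw_rational_weight[OF N]
  have last: "rational_weight k l n ! (N - 1) = n - l ! 0" if "k \<in> parts L" "l \<in> parts L'" for k l n
  proof -
    have len: "length k = L" "length l = L'" using that by (auto simp: parts_def)
    then have "rational_weight k l n ! (N - 1) = n + (k @ [0] @ rev (map uminus l)) ! (N - 1)"
      using N by (simp add: rational_weight_def del: map_append append_Cons)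
    also have "(k @ [0] @ rev (map uminus l)) ! (N - 1) = rev (map uminus l) ! (L' - 1)"
      using len N L' by (auto simp: nth_append nth_Cons split: nat.splits)
    also have "\<dots> = - (l ! 0)" using len L' by (simp add: rev_nth)
    finally show ?thesis by simp
  qed
  have A: "w \<in> highest_weights TypeA N \<longleftrightarrow> w \<in> highest_weights TypeA' N \<and> w ! (N - 1) = 0" for w
  proof -
    have "0 \<le> x" if "length w = N" "nonincreasing w" "w ! (N - 1) = 0" and mem: "x \<in> set w" for x
    proof -
      obtain i where i: "i < N" "x = w ! i" using mem \<open>length w = N\<close> by (auto simp: in_set_conv_nth)
      then have "w ! (N - 1) \<le> w ! i" using that N by (intro nonincreasing_nth) auto
      then show ?thesis using that(3) i by simp
    qed
    then show ?thesis by auto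
  qed
  let ?f = "\<lambda>((k, l), n). rational_weight k l n" and ?P = "parts L \<times> parts L'"
  have inj: "inj_on (\<lambda>(k, l). rational_weight k l (l ! 0)) ?P"
  proof (rule inj_onI)
    fix p q assume pq: "p \<in> ?P" "q \<in> ?P" "(\<lambda>(k, l). rational_weight k l (l ! 0)) p = (\<lambda>(k, l). rational_weight k l (l ! 0)) q"
    have "?f (p, snd p ! 0) = ?f (q, snd q ! 0)" using pq(3) by (simp add: split_def)
    then have "(p, snd p ! 0) = (q, snd q ! 0)"
      using pq(1,2) by (intro inj_onD[OF bij_betw_imp_inj_on[OF bij]]) auto
    then show "p = q" by simp
  qed
  moreover have "(\<lambda>(k, l). rational_weight k l (l ! 0)) ` ?P = highest_weights TypeA N"
  proof
    show "(\<lambda>(k, l). rational_weight k l (l ! 0)) ` ?P \<subseteq> highest_weights TypeA N"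
    proof clarify
      fix k l assume kl: "k \<in> parts L" "l \<in> parts L'"
      then have "rational_weight k l (l ! 0) \<in> highest_weights TypeA' N"
        using bij_betw_apply[OF bij, of "((k, l), l ! 0)"] by simp
      then show "rational_weight k l (l ! 0) \<in> highest_weights TypeA N"
        unfolding A using last[OF kl, of "l ! 0"] by simp
    qed
    show "highest_weights TypeA N \<subseteq> (\<lambda>(k, l). rational_weight k l (l ! 0)) ` ?P"
    proof
      fix w assume "w \<in> highest_weights TypeA N"
      then have w: "w \<in> highest_weights TypeA' N" "w ! (N - 1) = 0" using A by blast+
      have "w \<in> ?f ` (?P \<times> UNIV)" using w(1) bij by (simp only: bij_betw_def)
      then obtain k l n where kl: "k \<in> parts L" "l \<in> parts L'" "w = rational_weight k l n" by auto
      then have "n = l ! 0" using last[OF kl(1,2), of n] w(2) by simp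
      then show "w \<in> (\<lambda>(k, l). rational_weight k l (l ! 0)) ` ?P" using kl by force
    qed
  qed
  ultimately show ?thesis by (simp add: bij_betw_def)
qed

lemma type_A_error:
  assumes adm: "admissible TypeA N" and ip: "normalized_inner_product TypeA N ip"
    and t: "t > 0" and N: "N \<ge> 6" and X: "0 \<le> X" "X \<le> real N / 2 - 1"
  shows "\<bar>central_heat_trace N (classical_group TypeA N) ip t -
    (\<integral>(Y, Z). of_bool (real (cover_deg Y) \<le> X \<and> real (cover_deg Z) \<le> X) * \<Phi>_double TypeA t N Y Z
      * real N powi (cover_euler Y + cover_euler Z) \<partial>(hurwitz_measure t \<Otimes>\<^sub>M hurwitz_measure t))\<bar>
    \<le> 1 * (parts_bound (t / 8))\<^sup>2 * exp (- (t / 8) * X)"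
proof -
  let ?L = "N div 2" and ?L' = "(N - 1) div 2"
  have N1: "N \<ge> 1" "?L' \<ge> 1" using N by auto
  note half = half_split[OF N1(1)] and fl = nat_floor_le_half[OF X]
  define \<phi> where "\<phi> m n = exp ((t / 2) * ((real m - real n) / real N)\<^sup>2)" for m n :: nat
  have \<Phi>: "\<Phi>_double TypeA t N Y Z = \<phi> (cover_deg Y) (cover_deg Z)" for Y Z
    unfolding \<phi>_def \<Phi>_double_def by (simp add: power_divide)
  have \<phi>0: "0 \<le> \<phi> m n" and \<phi>C: "\<phi> m n \<le> 1 * exp ((t / 2) * ((real m - real n) / real N)\<^sup>2)" for m n
    by (simp_all add: \<phi>_def)
  note E = double_error[where \<Phi> = "\<Phi>_double TypeA t N" and \<phi> = \<phi>, OF t N1(1) half(2,3) X(1) fl(2,1) \<Phi> \<phi>0 \<phi>C zero_le_one]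
  let ?e = "\<lambda>l. exp (- (t / 2) * weight_sum N 1 l)"
  let ?G = "\<lambda>(k, l). \<phi> (nat (sum_list k)) (nat (sum_list l)) * (?e k * ?e l)"
  let ?P = "parts ?L \<times> parts ?L'"
  let ?f = "\<lambda>(k, l). rational_weight k l (l ! 0)"
  have G: "exp (- (t / 2) * casimir_number TypeA N (?f p)) = ?G p" if p: "p \<in> ?P" for p
  proof -
    obtain k l where kl: "p = (k, l)" "k \<in> parts ?L" "l \<in> parts ?L'" using p by auto
    let ?d = "weight_size k - weight_size l" and ?n = "real_of_int (l ! 0)"
    have sq: "((?d + real N * ?n) / real N)\<^sup>2 = (?d / real N + ?n)\<^sup>2" using N by (simp add: add_divide_distrib)
    \<comment> \<open>Subtracting the squared total cancels the whole dependence of the Casimir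
      number on n, since n^2 + 2 n d / N occurs in both; only - (d / N)^2 is left.\<close>
    have "(?d + real N * ?n)\<^sup>2 / (real N)\<^sup>2 = (?d / real N)\<^sup>2 + (?n\<^sup>2 + 2 * ?n * (?d / real N))"
      unfolding power_divide[symmetric] sq by (simp add: power2_sum)
    then have cas: "casimir_number TypeA N (?f p) = weight_sum N 1 k + weight_sum N 1 l - (?d / real N)\<^sup>2"
      unfolding kl(1) prod.case casimir_number.simps sum_list_rational_weight[OF kl(2,3) half(1)]
        weight_sum_rational_weight[OF kl(2,3) half(1)] by simp
    have "exp (- (t / 2) * casimir_number TypeA N (?f p)) = exp ((t / 2) * (?d / real N)\<^sup>2) * (?e k * ?e l)"
      unfolding cas exp_add[symmetric] by (simp add: algebra_simps)
    then show ?thesis by (simp add: kl(1) \<phi>_def parts_nat_size[OF kl(2)] parts_nat_size[OF kl(3)])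
  qed
  have "central_heat_trace N (classical_group TypeA N) ip t =
      infsum (\<lambda>p. exp (- (t / 2) * casimir_number TypeA N (?f p))) ?P"
    unfolding central_heat_trace_weights[OF adm ip]
    by (rule infsum_reindex_bij_betw[OF bij_betw_special_weight[OF half(1) N1(2)], symmetric])
  also have "\<dots> = infsum ?G ?P" by (rule infsum_cong) (rule G)
  finally show ?thesis using E(2) by simp
qed

theorem theorem4p4:
  fixes \<tau> :: classical_type
    and ip :: "nat \<Rightarrow> complex mat \<Rightarrow> complex mat \<Rightarrow> real"
  assumes "\<And>N. admissible \<tau> N \<Longrightarrow> normalized_inner_product \<tau> N (ip N)"
  shows "(\<tau> \<in> {TypeA', TypeA} \<longrightarrow>
      (\<forall>t>0. \<exists>C. \<forall>\<gamma>\<in>{0<..<1}. \<exists>N\<^sub>0. \<forall>N\<ge>N\<^sub>0. admissible \<tau> N \<longrightarrow>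
        \<bar>central_heat_trace N (classical_group \<tau> N) (ip N) t
          - (\<integral>(X\<^sub>1, X\<^sub>2).
               of_bool (real (cover_deg X\<^sub>1) \<le> real N powr \<gamma> \<and> real (cover_deg X\<^sub>2) \<le> real N powr \<gamma>)
               * \<Phi>_double \<tau> t N X\<^sub>1 X\<^sub>2
               * real N powi (cover_euler X\<^sub>1 + cover_euler X\<^sub>2)
             \<partial>(hurwitz_measure t \<Otimes>\<^sub>M hurwitz_measure t))\<bar>
        \<le> C * exp (- (t / 8) * real N powr \<gamma>)))
    \<and> (\<tau> \<in> {TypeB, TypeC, TypeD} \<longrightarrow>
      (\<forall>t>0. \<exists>C. \<forall>\<gamma>\<in>{0<..<1}. \<exists>N\<^sub>0. \<forall>N\<ge>N\<^sub>0. admissible \<tau> N \<longrightarrow>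
        \<bar>central_heat_trace N (classical_group \<tau> N) (ip N) t
          - (\<integral>X.
               of_bool (real (cover_deg X) \<le> real N powr \<gamma>)
               * \<Phi>_single \<tau> t N X
               * real N powi (cover_euler X)
             \<partial>(hurwitz_measure t))\<bar>
        \<le> C * exp (- (t / 12) * real N powr \<gamma>)))"
proof (intro conjI impI allI, goal_cases)
  case (1 t)
  obtain C\<^sub>\<theta> where C: "0 \<le> C\<^sub>\<theta>"
    "\<And>y. infsum (\<lambda>n::int. exp (- (t / 2) * (real_of_int n + y)\<^sup>2)) UNIV \<le> C\<^sub>\<theta>"
    using gaussian_sum_bound[OF 1(2)] by metis
  \<comment> \<open>The constant is fixed before \<gamma> and depends on the type and t only;
    \<gamma> enters through \<open>N\<^sub>0\<close> alone.\<close>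
  show ?case
  proof (rule exI[of _ "(if \<tau> = TypeA' then C\<^sub>\<theta> else 1) * (parts_bound (t / 8))\<^sup>2"], rule ballI, goal_cases)
    case (1 \<gamma>)
    then obtain N\<^sub>0 :: nat where N\<^sub>0: "\<forall>N\<ge>N\<^sub>0. N \<ge> 6 \<and> real N powr \<gamma> \<le> real N / 2 - 1"
      using powr_eventually_small by blast
    show ?case
    proof (rule exI[of _ N\<^sub>0], intro allI impI, goal_cases)
      case (1 N)
      have X: "N \<ge> 6" "0 \<le> real N powr \<gamma>" "real N powr \<gamma> \<le> real N / 2 - 1" using N\<^sub>0 1 by auto
      note adm = \<open>admissible \<tau> N\<close>
      show ?case
      proof (cases "\<tau> = TypeA'")
        case True
        show ?thesis
          using type_A'_error[OF adm[unfolded True] assms[OF adm, unfolded True] \<open>0 < t\<close> X C] True by simp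
      next
        case False
        then have "\<tau> = TypeA" using \<open>\<tau> \<in> {TypeA', TypeA}\<close> by simp
        then show ?thesis using type_A_error[of N "ip N", OF _ _ \<open>0 < t\<close> X] adm assms[OF adm] by simp
      qed
    qed
  qed
next
  case (2 t)
  show ?case
  proof (rule exI[of _ "2 * parts_bound (t / 12)"], rule ballI, goal_cases)
    case (1 \<gamma>)
    then obtain N\<^sub>0 :: nat where "\<forall>N\<ge>N\<^sub>0. N \<ge> 6 \<and> real N powr \<gamma> \<le> real N / 2 - 1"
      using powr_eventually_small by blast
    then show ?case
      by (intro exI[of _ N\<^sub>0] allI impI single_type_error 2 assms) auto
  qed
qed

end
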